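(* Let $p$ be a prime, let $K$ be a finite field extension of $\mathbb{Q}_p$, let $R$ be the ring of integers of $K$, let $\pi\in R$ be a uniformizing parameter, and let $q$ be the cardinality of the residue field of $R$. Let $n\geq 2$, $k\geq 1$ and $m\geq 0$ be integers. Then the following holds. (1) The $\mathbb{Z}_p$-Lie lattice $\mathrm{sl}_n^m(R)$ is self-similar of index $q^{(n-1)k}$. (2) For $n$ even, the $\mathbb{Z}_p$-Lie lattice $\mathrm{sp}_n^m(R)$ is self-similar of index $q^{nk}$. (3) For $n\geq 3$, the $\mathbb{Z}_p$-Lie lattice $\mathrm{so}_n^m(R)$ is self-similar of index $q^{(n-2)k}$.
   Context: A $\mathbb{Z}_p$-Lie lattice is a finitely generated free $\mathbb{Z}_p$-module with a structure of Lie algebra over $\mathbb{Z}_p$. A virtual endomorphism of index $p^j$ ($j\in\mathbb{N}$) of a $\mathbb{Z}_p$-Lie lattice $L$ is a $\mathbb{Z}_p$-Lie algebra homomorphism $\varphi:M\to L$, where $M$ is a $\mathbb{Z}_p$-subalgebra of $L$ of index $p^j$ (index as additive groups). It is simple if there is no nonzero ideal $I$ of $L$ with $I\subseteq M$ and $\varphi(I)\subseteq I$. $L$ is self-similar of index $p^j$ if it has a simple virtual endomorphism of index $p^j$. Lie lattices (with commutator bracket): $\mathrm{sl}_n(R)=\{x\in\mathrm{M}_n(R):\mathrm{tr}(x)=0\}$; for $n=2l$, $\mathrm{sp}_n(R)=\{x\in\mathrm{M}_n(R): sx+x^{\mathrm t}s=0\}$ with $s=\begin{bmatrix}0&\mathrm{Id}_l\\-\mathrm{Id}_l&0\end{bmatrix}$;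 $\mathrm{so}_n(R)=\{x\in\mathrm{M}_n(R): sx+x^{\mathrm t}s=0\}$ with $s=\begin{bmatrix}0&\mathrm{Id}_l\\ \mathrm{Id}_l&0\end{bmatrix}$ if $n=2l$ and $s=\begin{bmatrix}1&0&0\\0&0&\mathrm{Id}_l\\0&\mathrm{Id}_l&0\end{bmatrix}$ if $n=2l+1$. For $\sigma\in\{\mathrm{sl},\mathrm{sp},\mathrm{so}\}$, $\sigma_n^m(R)=\pi^m\sigma_n(R)$. These are $R$-Lie lattices, regarded as $\mathbb{Z}_p$-Lie lattices by restriction of scalars. *)

theory Defs
  imports
    "HOL-Algebra.QuotRing"
    "HOL-Computational_Algebra.Polynomial_Factorial"
    "Berlekamp_Zassenhaus.Finite_Field"
    "Jordan_Normal_Form.VS_Connect"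
begin

hide_const (open) Multiset.mult Polynomial.smult

section \<open>The $p$-adic numbers\<close>

text \<open>
  The prime $p$ is the cardinality of the type parameter \<open>'p\<close>, as for the type of
  residues modulo $p$ in the library. A $p$-adic integer is an element of the inverse limit of
  the rings $\mathbb{Z}/p^n\mathbb{Z}$, each residue class being represented in $[0,p^n)$.
\<close>

typedef (overloaded) ('p::prime_card) padic_int =
  "{f :: nat \<Rightarrow> int. \<forall>n. 0 \<le> f n \<and> f n < int CARD('p) ^ n \<and>
      f (Suc n) mod int CARD('p) ^ n = f n}"
  morphisms residue Abs_padic_int
proof -
  have "0 < CARD('p)"
    using prime_card[where 'a = 'p] prime_gt_0_nat by blast
  thus ?thesis
    by (intro exI[of _ "\<lambda>_. 0"]) auto
qed

setup_lifting type_definition_padic_int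

lemma prime_int_card: "prime (int CARD('p::prime_card))"
  using prime_card[where 'a = 'p] by simp

lemma card_pos_int: "0 < int CARD('p::prime_card)"
  using prime_int_card[where 'p = 'p] prime_gt_0_int by blast

lemma padic_op_closed:
  fixes g :: "nat \<Rightarrow> int"
  assumes "\<And>n. [g (Suc n) = g n] (mod int CARD('p::prime_card) ^ n)"
  shows "0 \<le> g n mod int CARD('p) ^ n \<and> g n mod int CARD('p) ^ n < int CARD('p) ^ n \<and>
    g (Suc n) mod int CARD('p) ^ Suc n mod int CARD('p) ^ n = g n mod int CARD('p) ^ n"
proof -
  have "g (Suc n) mod int CARD('p) ^ Suc n mod int CARD('p) ^ n = g (Suc n) mod int CARD('p) ^ n"
    by (rule mod_mod_cancel) (simp add: le_imp_power_dvd)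
  thus ?thesis
    using assms[of n] card_pos_int[where 'p = 'p] by (simp add: cong_def)
qed

lemma residue_cong_Suc:
  "[residue (x :: 'p::prime_card padic_int) (Suc n) = residue x n] (mod int CARD('p) ^ n)"
  using residue[of x] by (auto simp: cong_def)

lemma residue_mod [simp]:
  "residue (x :: 'p::prime_card padic_int) n mod int CARD('p) ^ n = residue x n"
  using residue[of x] by auto

lemma residue_cong_add:
  "[residue (x :: 'p::prime_card padic_int) (n + k) = residue x n] (mod int CARD('p) ^ n)"
proof (induction k)
  case (Suc k)
  have "[residue x (Suc (n + k)) = residue x (n + k)] (mod int CARD('p) ^ n)"
    by (rule cong_dvd_modulus[OF residue_cong_Suc]) (simp add: le_imp_power_dvd)
  thus ?case
    using Suc by (auto intro: cong_trans)
qed auto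

instantiation padic_int :: (prime_card) comm_ring_1
begin

lift_definition zero_padic_int :: "'a padic_int" is "\<lambda>n. 0"
  using card_pos_int[where 'p = 'a] by auto

lift_definition one_padic_int :: "'a padic_int" is "\<lambda>n. 1 mod int CARD('a) ^ n"
  using padic_op_closed[where 'p = 'a and g = "\<lambda>_. 1"] by auto

lift_definition plus_padic_int :: "'a padic_int \<Rightarrow> 'a padic_int \<Rightarrow> 'a padic_int"
  is "\<lambda>f g n. (f n + g n) mod int CARD('a) ^ n"
  by (intro allI padic_op_closed cong_add) (auto simp: cong_def)

lift_definition minus_padic_int :: "'a padic_int \<Rightarrow> 'a padic_int \<Rightarrow> 'a padic_int"
  is "\<lambda>f g n. (f n - g n) mod int CARD('a) ^ n"
  by (intro allI padic_op_closed cong_diff) (auto simp: cong_def)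

lift_definition uminus_padic_int :: "'a padic_int \<Rightarrow> 'a padic_int"
  is "\<lambda>f n. (- f n) mod int CARD('a) ^ n"
  by (intro allI padic_op_closed) (auto simp: cong_minus_minus_iff, auto simp: cong_def)

lift_definition times_padic_int :: "'a padic_int \<Rightarrow> 'a padic_int \<Rightarrow> 'a padic_int"
  is "\<lambda>f g n. (f n * g n) mod int CARD('a) ^ n"
  by (intro allI padic_op_closed cong_mult) (auto simp: cong_def)

instance
proof
  fix a b c :: "'a padic_int"
  show "a * b * c = a * (b * c)"
    by transfer (simp add: fun_eq_iff mod_simps ac_simps)
  show "a * b = b * a"
    by transfer (simp add: fun_eq_iff ac_simps)
  show "1 * a = a"
    by transfer (auto simp: fun_eq_iff mod_simps)
  show "a + b + c = a + (b + c)"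
    by transfer (simp add: fun_eq_iff mod_simps ac_simps)
  show "a + b = b + a"
    by transfer (simp add: fun_eq_iff ac_simps)
  show "0 + a = a"
    by transfer (auto simp: fun_eq_iff)
  show "- a + a = 0"
    by transfer (simp add: fun_eq_iff mod_simps)
  show "a - b = a + - b"
    by transfer (simp add: fun_eq_iff mod_simps)
  show "(a + b) * c = a * c + b * c"
    by transfer (simp add: fun_eq_iff mod_simps algebra_simps)
  have "(1 :: int) mod int CARD('a) ^ 1 \<noteq> 0"
    using prime_gt_1_int[OF prime_int_card[where 'p = 'a]] by simp
  thus "(0 :: 'a padic_int) \<noteq> 1"
    by transfer (metis (no_types))
qed

end

instance padic_int :: (prime_card) idom
proof
  fix a b :: "'a padic_int"
  assume "a \<noteq> 0" "b \<noteq> 0"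
  then obtain i j where i: "residue a i \<noteq> 0" and j: "residue b j \<noteq> 0"
    by (metis residue_inject zero_padic_int.rep_eq ext)
  let ?p = "int CARD('a)"
  have "\<not> ?p ^ i dvd residue a (i + j)"
    using i residue_cong_add[of a i j] by (auto simp: cong_def dvd_eq_mod_eq_0)
  moreover have "\<not> ?p ^ j dvd residue b (i + j)"
    using j residue_cong_add[of b j i] by (auto simp: cong_def dvd_eq_mod_eq_0 add.commute)
  moreover have "i \<noteq> 0"
  proof
    assume "i = 0"
    thus False
      using i residue_mod[of a 0] by simp
  qed
  ultimately have "\<not> ?p ^ (i + j - 1) dvd residue a (i + j) * residue b (i + j)"
    using prime_elem_power_dvd_cases[of ?p "i + j - 1" "residue a (i + j)" "residue b (i + j)" i j]
      prime_imp_prime_elem[OF prime_int_card[where 'p = 'a]] by linarith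
  hence "\<not> ?p ^ (i + j) dvd residue a (i + j) * residue b (i + j)"
    using power_le_dvd[of ?p "i + j" _ "i + j - 1"] by auto
  hence "residue (a * b) (i + j) \<noteq> 0"
    by (simp add: times_padic_int.rep_eq dvd_eq_mod_eq_0)
  thus "a * b \<noteq> 0"
    by (auto simp: zero_padic_int.rep_eq)
qed

type_synonym 'p padic = "'p padic_int fract"


section \<open>Finite extensions and their rings of integers\<close>

locale finite_padic_extension = field_hom emb
  for emb :: "'p::prime_card padic \<Rightarrow> 'k::field" +
  assumes finite_degree: "\<exists>B. finite B \<and> (\<forall>x. \<exists>c. x = (\<Sum>b\<in>B. emb (c b) * b))"

text \<open>The integral closure of $\mathbb{Z}_p$ in the extension field.\<close>

definition integers :: "('p::prime_card padic \<Rightarrow> 'k::field) \<Rightarrow> 'k set" where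
  "integers emb = {x. \<exists>f :: 'p padic_int poly.
     lead_coeff f = 1 \<and> poly (map_poly (\<lambda>a. emb (to_fract a)) f) x = 0}"

definition integer_ring :: "('p::prime_card padic \<Rightarrow> 'k::field) \<Rightarrow> 'k ring" where
  "integer_ring emb = class_ring\<lparr>carrier := integers emb\<rparr>"

text \<open>The ring of integers is local, so its maximal ideal is the set of its non-units.\<close>

definition max_ideal :: "('p::prime_card padic \<Rightarrow> 'k::field) \<Rightarrow> 'k set" where
  "max_ideal emb = carrier (integer_ring emb) - Units (integer_ring emb)"

definition uniformizer :: "('p::prime_card padic \<Rightarrow> 'k::field) \<Rightarrow> 'k \<Rightarrow> bool" where
  "uniformizer emb \<pi> \<longleftrightarrow>
     \<pi> \<in> carrier (integer_ring emb) \<and> PIdl\<^bsub>integer_ring emb\<^esub> \<pi> = max_ideal emb"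

definition residue_field :: "('p::prime_card padic \<Rightarrow> 'k::field) \<Rightarrow> 'k set ring" where
  "residue_field emb = integer_ring emb Quot max_ideal emb"


section \<open>Lie lattices and self-similarity\<close>

text \<open>
  A Lie algebra is a module record whose multiplication is the Lie bracket; the field \<open>one\<close> of
  the record is not used.
\<close>

locale lie_algebra = module R L for R (structure) and L (structure) +
  assumes bracket_closed:
      "\<lbrakk>x \<in> carrier L; y \<in> carrier L\<rbrakk> \<Longrightarrow> x \<otimes>\<^bsub>L\<^esub> y \<in> carrier L"
    and bracket_add_left:
      "\<lbrakk>x \<in> carrier L; y \<in> carrier L; z \<in> carrier L\<rbrakk> \<Longrightarrow>
        (x \<oplus>\<^bsub>L\<^esub> y) \<otimes>\<^bsub>L\<^esub> z = x \<otimes>\<^bsub>L\<^esub> z \<oplus>\<^bsub>L\<^esub> y \<otimes>\<^bsub>L\<^esub> z"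
    and bracket_add_right:
      "\<lbrakk>x \<in> carrier L; y \<in> carrier L; z \<in> carrier L\<rbrakk> \<Longrightarrow>
        x \<otimes>\<^bsub>L\<^esub> (y \<oplus>\<^bsub>L\<^esub> z) = x \<otimes>\<^bsub>L\<^esub> y \<oplus>\<^bsub>L\<^esub> x \<otimes>\<^bsub>L\<^esub> z"
    and bracket_smult_left:
      "\<lbrakk>a \<in> carrier R; x \<in> carrier L; y \<in> carrier L\<rbrakk> \<Longrightarrow>
        (a \<odot>\<^bsub>L\<^esub> x) \<otimes>\<^bsub>L\<^esub> y = a \<odot>\<^bsub>L\<^esub> (x \<otimes>\<^bsub>L\<^esub> y)"
    and bracket_smult_right:
      "\<lbrakk>a \<in> carrier R; x \<in> carrier L; y \<in> carrier L\<rbrakk> \<Longrightarrow>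
        x \<otimes>\<^bsub>L\<^esub> (a \<odot>\<^bsub>L\<^esub> y) = a \<odot>\<^bsub>L\<^esub> (x \<otimes>\<^bsub>L\<^esub> y)"
    and bracket_self: "x \<in> carrier L \<Longrightarrow> x \<otimes>\<^bsub>L\<^esub> x = \<zero>\<^bsub>L\<^esub>"
    and jacobi:
      "\<lbrakk>x \<in> carrier L; y \<in> carrier L; z \<in> carrier L\<rbrakk> \<Longrightarrow>
        x \<otimes>\<^bsub>L\<^esub> (y \<otimes>\<^bsub>L\<^esub> z) \<oplus>\<^bsub>L\<^esub> y \<otimes>\<^bsub>L\<^esub> (z \<otimes>\<^bsub>L\<^esub> x) \<oplus>\<^bsub>L\<^esub> z \<otimes>\<^bsub>L\<^esub> (x \<otimes>\<^bsub>L\<^esub> y)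
          = \<zero>\<^bsub>L\<^esub>"

definition lie_lattice :: "('a, 'm) ring_scheme \<Rightarrow> ('a, 'b, 'n) module_scheme \<Rightarrow> bool" where
  "lie_lattice R L \<longleftrightarrow> lie_algebra R L \<and>
     (\<exists>B. finite B \<and> B \<subseteq> carrier L \<and> \<not> module.lin_dep R L B \<and> module.span R L B = carrier L)"

definition lie_subalgebra ::
    "'b set \<Rightarrow> ('a, 'm) ring_scheme \<Rightarrow> ('a, 'b, 'n) module_scheme \<Rightarrow> bool" where
  "lie_subalgebra M R L \<longleftrightarrow> Module.submodule M R L \<and> (\<forall>x\<in>M. \<forall>y\<in>M. x \<otimes>\<^bsub>L\<^esub> y \<in> M)"

definition lie_ideal ::
    "'b set \<Rightarrow> ('a, 'm) ring_scheme \<Rightarrow> ('a, 'b, 'n) module_scheme \<Rightarrow> bool" where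
  "lie_ideal I R L \<longleftrightarrow> Module.submodule I R L \<and> (\<forall>x\<in>carrier L. \<forall>y\<in>I. x \<otimes>\<^bsub>L\<^esub> y \<in> I)"

definition virtual_endomorphism ::
    "('a, 'm) ring_scheme \<Rightarrow> ('a, 'b, 'n) module_scheme \<Rightarrow> nat \<Rightarrow> 'b set \<Rightarrow> ('b \<Rightarrow> 'b) \<Rightarrow> bool" where
  "virtual_endomorphism R L N M \<phi> \<longleftrightarrow>
     lie_subalgebra M R L \<and>
     finite (a_rcosets\<^bsub>L\<^esub> M) \<and> card (a_rcosets\<^bsub>L\<^esub> M) = N \<and>
     \<phi> \<in> module_hom R (L\<lparr>carrier := M\<rparr>) L \<and>
     (\<forall>x\<in>M. \<forall>y\<in>M. \<phi> (x \<otimes>\<^bsub>L\<^esub> y) = \<phi> x \<otimes>\<^bsub>L\<^esub> \<phi> y)"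

definition simple_virtual_endomorphism ::
    "('a, 'm) ring_scheme \<Rightarrow> ('a, 'b, 'n) module_scheme \<Rightarrow> nat \<Rightarrow> 'b set \<Rightarrow> ('b \<Rightarrow> 'b) \<Rightarrow> bool" where
  "simple_virtual_endomorphism R L N M \<phi> \<longleftrightarrow>
     virtual_endomorphism R L N M \<phi> \<and>
     \<not> (\<exists>I. lie_ideal I R L \<and> I \<noteq> {\<zero>\<^bsub>L\<^esub>} \<and> I \<subseteq> M \<and> \<phi> ` I \<subseteq> I)"

definition self_similar ::
    "('a, 'm) ring_scheme \<Rightarrow> ('a, 'b, 'n) module_scheme \<Rightarrow> nat \<Rightarrow> bool" where
  "self_similar R L N \<longleftrightarrow>
     lie_lattice R L \<and> (\<exists>M \<phi>. simple_virtual_endomorphism R L N M \<phi>)"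

abbreviation padic_ring :: "'p::prime_card padic_int ring" where
  "padic_ring \<equiv> class_ring"


section \<open>Classical Lie lattices\<close>

definition sl_mats :: "nat \<Rightarrow> 'k::field set \<Rightarrow> 'k mat set" where
  "sl_mats n A = {x \<in> carrier_mat n n. elements_mat x \<subseteq> A \<and> (\<Sum>i<n. x $$ (i, i)) = 0}"

text \<open>The matrices over \<open>A\<close> that are skew for the bilinear form with Gram matrix \<open>s\<close>.\<close>

definition skew_mats :: "nat \<Rightarrow> 'k::field mat \<Rightarrow> 'k set \<Rightarrow> 'k mat set" where
  "skew_mats n s A = {x \<in> carrier_mat n n. elements_mat x \<subseteq> A \<and>
     s * x + transpose_mat x * s = 0\<^sub>m n n}"

text \<open>Meaningful only for even \<open>n\<close>.\<close>

definition sp_form :: "nat \<Rightarrow> 'k::field mat" where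
  "sp_form n = (let l = n div 2 in
     four_block_mat (0\<^sub>m l l) (1\<^sub>m l) (- 1\<^sub>m l) (0\<^sub>m l l))"

definition so_form :: "nat \<Rightarrow> 'k::field mat" where
  "so_form n = (let l = n div 2; h = four_block_mat (0\<^sub>m l l) (1\<^sub>m l) (1\<^sub>m l) (0\<^sub>m l l) in
     if even n then h
     else four_block_mat (1\<^sub>m 1) (0\<^sub>m 1 (2 * l)) (0\<^sub>m (2 * l) 1) h)"

definition sp_mats :: "nat \<Rightarrow> 'k::field set \<Rightarrow> 'k mat set" where
  "sp_mats n A = skew_mats n (sp_form n) A"

definition so_mats :: "nat \<Rightarrow> 'k::field set \<Rightarrow> 'k mat set" where
  "so_mats n A = skew_mats n (so_form n) A"

text \<open>
  A set of $n \times n$ matrices with the commutator bracket, the scalars being restricted to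
  $\mathbb{Z}_p$.
\<close>

definition commutator_lie ::
    "('p::prime_card padic \<Rightarrow> 'k::field) \<Rightarrow> nat \<Rightarrow> 'k mat set \<Rightarrow> ('p padic_int, 'k mat) module" where
  "commutator_lie emb n X =
     \<lparr>carrier = X, mult = (\<lambda>x y. x * y - y * x), one = undefined, zero = 0\<^sub>m n n, add = (+),
      smult = (\<lambda>a x. emb (to_fract a) \<cdot>\<^sub>m x)\<rparr>"

definition sl_lattice ::
    "('p::prime_card padic \<Rightarrow> 'k::field) \<Rightarrow> 'k \<Rightarrow> nat \<Rightarrow> nat \<Rightarrow> ('p padic_int, 'k mat) module" where
  "sl_lattice emb \<pi> n m = commutator_lie emb n ((\<cdot>\<^sub>m) (\<pi> ^ m) ` sl_mats n (integers emb))"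

definition sp_lattice ::
    "('p::prime_card padic \<Rightarrow> 'k::field) \<Rightarrow> 'k \<Rightarrow> nat \<Rightarrow> nat \<Rightarrow> ('p padic_int, 'k mat) module" where
  "sp_lattice emb \<pi> n m = commutator_lie emb n ((\<cdot>\<^sub>m) (\<pi> ^ m) ` sp_mats n (integers emb))"

definition so_lattice ::
    "('p::prime_card padic \<Rightarrow> 'k::field) \<Rightarrow> 'k \<Rightarrow> nat \<Rightarrow> nat \<Rightarrow> ('p padic_int, 'k mat) module" where
  "so_lattice emb \<pi> n m = commutator_lie emb n ((\<cdot>\<^sub>m) (\<pi> ^ m) ` so_mats n (integers emb))"

end

theory Submission
  imports Defs "Jordan_Normal_Form.Char_Poly"
begin

text \<open>
  Conjugation by a diagonal matrix whose entries are powers of the uniformizer is an automorphism of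
  the Lie algebra over $K$; restricted to the elements of the lattice that it maps into the lattice,
  it is a virtual endomorphism. The weights are chosen such that the only part of negative degree is
  given by the first row of the matrix, which can be prescribed freely: this gives the index.
  On an invariant ideal this row vanishes off the diagonal, being divisible by all powers of the
  uniformizer, and taking brackets shows that the ideal is zero.

  A separated torsion-free $\mathbb{Z}_p$-module of bounded rank has a finite basis: a maximal set
  that is independent modulo $p$ is independent and, by completeness, spanning. This shows that the
  lattices are free, that the residue field is finite and, by the characteristic polynomial
  of $\pi^{-1}$, that the powers of the maximal ideal intersect trivially.
\<close>

hide_const (open) Multiset.mult Polynomial.smult

section \<open>Divisibility and completeness of the p-adic integers\<close>

text \<open>The exponents of the theorem are \<open>k\<close> times the total weight of the free
  columns of the distinguished row. For \<open>sl\<close> the weights are 0, 1, ..., 1, with sum n -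
  1. For a bilinear form, conjugation preserves the Lie algebra only if the weights of two dual
  basis vectors have a constant sum. This forces 0 on an isotropic basis vector, 2 on its dual and 1
  elsewhere. The entry of weight 2 vanishes for a symmetric form, leaving n - 2, and is free for an
  alternating one, giving (n - 2) + 2 = n. The scaling by \<pi>^m does not affect the index, because
  the lattice and the divisibility conditions on the row shift together. For \<open>so\<close> with
  n odd the distinguished row is the second one, since the first basis vector is not isotropic. No
  valuation on K is constructed: \<open>integers\<close> is the integral closure, so integrality is
  tested on finitely generated modules and divisibility by \<pi>^n means that x / \<pi>^n is
  integral. Primes dividing 2 or n cause no trouble, since coefficients such as 2 and n are
  cancelled in K, which has characteristic 0.\<close>

abbreviation padic_prime :: "'p::prime_card padic_int" where
  "padic_prime \<equiv> of_nat CARD('p)"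

lemma residue_of_nat:
  "residue (of_nat m :: 'p::prime_card padic_int) n = int m mod int CARD('p) ^ n"
  by (induction m)
    (simp_all add: zero_padic_int.rep_eq one_padic_int.rep_eq plus_padic_int.rep_eq mod_simps)

lemma residue_mult:
  "residue (x * y :: 'p::prime_card padic_int) n = residue x n * residue y n mod int CARD('p) ^ n"
  by (simp add: times_padic_int.rep_eq)

lemma residue_diff:
  "residue (x - y :: 'p::prime_card padic_int) n = (residue x n - residue y n) mod int CARD('p) ^ n"
  by (simp add: minus_padic_int.rep_eq)

lemma residue_mod_le:
  assumes "m \<le> n"
  shows "residue (x :: 'p::prime_card padic_int) n mod int CARD('p) ^ m = residue x m"
proof -
  obtain k where "n = m + k"
    using assms le_Suc_ex by blast
  thus ?thesis
    using residue_cong_add[of x m k] by (simp add: cong_def)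
qed

lemma residue_prime_power:
  "residue (padic_prime ^ k :: 'p::prime_card padic_int) n = int CARD('p) ^ k mod int CARD('p) ^ n"
  using residue_of_nat[of "CARD('p) ^ k" n, where 'p = 'p] by simp

lemma padic_eqI: "(\<And>n. residue x n = residue y n) \<Longrightarrow> x = y"
  by (metis residue_inject ext)

text \<open>If the residue modulo p^k vanishes, all later residues are divisible by p^k. Dividing by
  p^k costs k places of precision, so the n-th residue of the quotient is read off from the residue
  of index n + k.\<close>

lemma prime_power_dvd_iff_residue:
  "padic_prime ^ k dvd (x :: 'p::prime_card padic_int) \<longleftrightarrow> residue x k = 0"
proof
  assume "padic_prime ^ k dvd x"
  then obtain y where "x = padic_prime ^ k * y" ..
  thus "residue x k = 0"
    by (simp add: residue_mult residue_prime_power)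
next
  assume x: "residue x k = 0"
  let ?p = "int CARD('p)"
  have p: "0 < ?p"
    by (rule card_pos_int)
  define f where "f n = residue x (n + k) div ?p ^ k" for n
  have split: "a mod (?p ^ k * ?p ^ n) div ?p ^ k = a div ?p ^ k mod ?p ^ n" for a n
    using p by (simp add: zmod_zmult2_eq)
  have f_mod: "f (n + j) mod ?p ^ n = f n" for n j
    using residue_mod_le[of "n + k" "n + j + k" x] split[of "residue x (n + j + k)" n]
    by (simp add: f_def power_add mult.commute)
  have f: "0 \<le> f n \<and> f n < ?p ^ n \<and> f (Suc n) mod ?p ^ n = f n" for n
    using f_mod[of n 0] f_mod[of n 1] p
    by (metis add.right_neutral add_Suc_right One_nat_def pos_mod_bound pos_mod_sign zero_less_power)
  hence rep: "residue (Abs_padic_int f :: 'p padic_int) = f"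
    by (intro Abs_padic_int_inverse) auto
  have "x = padic_prime ^ k * Abs_padic_int f"
  proof (rule padic_eqI)
    fix n
    have "?p ^ k dvd residue x (n + k)"
      using residue_mod_le[of k "n + k" x] x by (simp add: dvd_eq_mod_eq_0)
    hence "?p ^ k * f n = residue x (n + k)"
      by (simp add: f_def)
    thus "residue x n = residue (padic_prime ^ k * Abs_padic_int f :: 'p padic_int) n"
      using residue_mod_le[of n "n + k" x]
      by (simp add: residue_mult residue_prime_power rep mod_mult_left_eq)
  qed
  thus "padic_prime ^ k dvd x"
    by simp
qed

lemma prime_dvd_iff_residue:
  "padic_prime dvd (x :: 'p::prime_card padic_int) \<longleftrightarrow> residue x 1 = 0"
  using prime_power_dvd_iff_residue[of 1 x] by simp

lemma not_prime_dvd_one: "\<not> padic_prime dvd (1 :: 'p::prime_card padic_int)"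
  using prime_gt_1_int[OF prime_int_card[where 'p = 'p]]
  by (simp add: prime_dvd_iff_residue one_padic_int.rep_eq)

lemma padic_prime_nonzero: "(padic_prime :: 'p::prime_card padic_int) \<noteq> 0"
  using prime_power_dvd_iff_residue[of 2 "padic_prime :: 'p padic_int"]
    prime_gt_1_int[OF prime_int_card[where 'p = 'p]]
  by (auto simp: residue_of_nat zero_padic_int.rep_eq power2_eq_square zmod_eq_0_iff
      dest!: arg_cong[where f = "\<lambda>x. residue x 2"])

text \<open>Every residue is invertible modulo p^n. Inverses modulo p^n are unique, so the
  separately chosen ones are compatible and form a p-adic integer.\<close>

lemma unit_if_not_prime_dvd:
  assumes "\<not> padic_prime dvd (x :: 'p::prime_card padic_int)"
  shows "x dvd 1"
proof -
  let ?p = "int CARD('p)"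
  have "\<not> ?p dvd residue x (Suc n)" for n
    using assms residue_mod_le[of 1 "Suc n" x] by (simp add: prime_dvd_iff_residue dvd_eq_mod_eq_0)
  hence coprime_Suc: "coprime (residue x (Suc n)) ?p" for n
    using prime_imp_coprime[OF prime_int_card[where 'p = 'p]] coprime_commute by blast
  have coprime: "coprime (residue x n) (?p ^ n)" for n
    using coprime_Suc by (cases n) auto
  have "\<exists>g. [residue x n * g = 1] (mod ?p ^ n)" for n
    using coprime by (simp add: cong_solve_coprime_int)
  then obtain g where g: "\<And>n. [residue x n * g n = 1] (mod ?p ^ n)"
    by metis
  have "[g (Suc n) = g n] (mod ?p ^ n)" for n
  proof -
    have "[residue x (Suc n) * g (Suc n) = 1] (mod ?p ^ n)"
      using cong_dvd_modulus[OF g[of "Suc n"]] by (simp add: le_imp_power_dvd)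
    moreover have "[residue x n * g (Suc n) = residue x (Suc n) * g (Suc n)] (mod ?p ^ n)"
      using residue_cong_Suc[of x n] by (intro cong_mult) (auto simp: cong_sym_eq)
    ultimately have "[residue x n * g (Suc n) = residue x n * g n] (mod ?p ^ n)"
      using g[of n] by (meson cong_sym cong_trans)
    thus ?thesis
      using coprime[of n] by (simp add: cong_mult_lcancel)
  qed
  hence "residue (Abs_padic_int (\<lambda>n. g n mod ?p ^ n) :: 'p padic_int) = (\<lambda>n. g n mod ?p ^ n)"
    by (intro Abs_padic_int_inverse) (use padic_op_closed[where 'p = 'p and g = g] in auto)
  hence "x * Abs_padic_int (\<lambda>n. g n mod ?p ^ n) = 1"
    using g by (intro padic_eqI) (simp add: residue_mult one_padic_int.rep_eq cong_def mod_mult_right_eq)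
  thus ?thesis
    by (metis dvd_triv_left)
qed

lemma eq_zero_if_all_prime_powers_dvd:
  assumes "\<And>k. padic_prime ^ k dvd (x :: 'p::prime_card padic_int)"
  shows "x = 0"
  using assms by (intro padic_eqI) (simp add: prime_power_dvd_iff_residue zero_padic_int.rep_eq)

lemma padic_int_cases:
  assumes "(x :: 'p::prime_card padic_int) \<noteq> 0"
  obtains k u where "x = padic_prime ^ k * u" "u dvd 1"
proof -
  obtain m where "\<not> padic_prime ^ m dvd x"
    using assms eq_zero_if_all_prime_powers_dvd by blast
  then obtain k where k: "padic_prime ^ k dvd x" "\<not> padic_prime ^ Suc k dvd x"
    by (induction m) auto
  then obtain u where u: "x = padic_prime ^ k * u"
    by blast
  have "\<not> padic_prime dvd u"
    using k(2) u by (auto simp: mult.assoc mult.left_commute)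
  thus thesis
    using that u unit_if_not_prime_dvd by blast
qed

text \<open>The limit is the diagonal: its n-th residue is the n-th residue of \<open>c n\<close>,
  which no later term changes.\<close>

lemma padic_complete:
  fixes c :: "nat \<Rightarrow> 'p::prime_card padic_int"
  assumes "\<And>n. padic_prime ^ n dvd c (Suc n) - c n"
  obtains l where "\<And>n. padic_prime ^ n dvd l - c n"
proof -
  let ?p = "int CARD('p)"
  have Suc: "[residue (c (Suc n)) (Suc n) = residue (c n) n] (mod ?p ^ n)" for n
  proof -
    have "?p ^ n dvd residue (c (Suc n)) n - residue (c n) n"
      using assms[of n] by (simp add: prime_power_dvd_iff_residue residue_diff dvd_eq_mod_eq_0)
    hence "residue (c (Suc n)) n mod ?p ^ n = residue (c n) n mod ?p ^ n"
      by (simp only: mod_eq_dvd_iff)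
    hence "residue (c (Suc n)) n = residue (c n) n"
      by simp
    thus ?thesis
      using residue_cong_Suc[of "c (Suc n)" n] by (simp add: cong_def)
  qed
  define f where "f n = residue (c n) n" for n
  have "residue (Abs_padic_int f :: 'p padic_int) = f"
    using Suc residue by (intro Abs_padic_int_inverse) (auto simp: f_def cong_def)
  hence "padic_prime ^ n dvd Abs_padic_int f - c n" for n
    by (simp add: prime_power_dvd_iff_residue residue_diff f_def)
  thus thesis
    using that by blast
qed

text \<open>If m is zero in the p-adic integers, then p^m divides m, but m < p^m. Characteristic
  zero is what later permits cancelling n in the trace and 2 in the skew case.\<close>

lemma of_nat_padic_eq_0_iff:
  "(of_nat m :: 'p::prime_card padic_int) = 0 \<longleftrightarrow> m = 0"
proof
  assume "(of_nat m :: 'p padic_int) = 0"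
  hence "int CARD('p) ^ m dvd int m"
    using residue_of_nat[of m m, where 'p = 'p] by (simp add: zero_padic_int.rep_eq dvd_eq_mod_eq_0)
  hence "CARD('p) ^ m dvd m"
    by (metis of_nat_dvd_iff of_nat_power)
  moreover have "m < CARD('p) ^ m"
    using prime_gt_1_nat[OF prime_card[where 'a = 'p]] by (simp add: power_gt_expt)
  ultimately show "m = 0"
    using dvd_imp_le by (metis not_le gr0I)
qed simp

section \<open>Separated modules of finite rank over the p-adic integers\<close>

text \<open>Separatedness stands in for finite generation, which is to be derived. Both axioms pass
  to modules of integral elements and of integral matrices.\<close>

locale padic_module = module "padic_ring :: 'p::prime_card padic_int ring" L
  for L :: "('p::prime_card padic_int, 'b, 'm) module_scheme" (structure) +
  assumes torsion_free: "\<lbrakk>x \<in> carrier L; padic_prime \<odot> x = \<zero>\<^bsub>L\<^esub>\<rbrakk> \<Longrightarrow> x = \<zero>\<^bsub>L\<^esub>"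
    and separated:
      "\<lbrakk>x \<in> carrier L; \<And>n. \<exists>y\<in>carrier L. x = padic_prime ^ n \<odot> y\<rbrakk> \<Longrightarrow> x = \<zero>\<^bsub>L\<^esub>"
begin

lemma smult_mult: "x \<in> carrier L \<Longrightarrow> (a * b) \<odot>\<^bsub>L\<^esub> x = a \<odot>\<^bsub>L\<^esub> (b \<odot>\<^bsub>L\<^esub> x)"
  using smult_assoc1[of a b x] by simp

lemma smult_plus: "x \<in> carrier L \<Longrightarrow> (a + b) \<odot>\<^bsub>L\<^esub> x = a \<odot>\<^bsub>L\<^esub> x \<oplus>\<^bsub>L\<^esub> b \<odot>\<^bsub>L\<^esub> x"
  using smult_l_distr[of a b x] by simp

lemma smult_in [simp, intro]: "x \<in> carrier L \<Longrightarrow> a \<odot>\<^bsub>L\<^esub> x \<in> carrier L"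
  using smult_closed[of a x] by simp

lemma lincomb_in [simp, intro]: "B \<subseteq> carrier L \<Longrightarrow> lincomb c B \<in> carrier L"
  by (rule lincomb_closed) auto

lemma lincomb_plus:
  assumes "B \<subseteq> carrier L"
  shows "lincomb (\<lambda>v. a v + b v) B = lincomb a B \<oplus>\<^bsub>L\<^esub> lincomb b B"
proof -
  have "lincomb (\<lambda>v. a v + b v) B = (\<Oplus>\<^bsub>L\<^esub>v\<in>B. a v \<odot>\<^bsub>L\<^esub> v \<oplus>\<^bsub>L\<^esub> b v \<odot>\<^bsub>L\<^esub> v)"
    unfolding lincomb_def using assms by (intro finsum_cong') (auto simp: smult_plus)
  also have "\<dots> = lincomb a B \<oplus>\<^bsub>L\<^esub> lincomb b B"
    unfolding lincomb_def using assms by (intro finsum_addf) auto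
  finally show ?thesis .
qed

lemma lincomb_scale:
  assumes "B \<subseteq> carrier L"
  shows "lincomb (\<lambda>v. c * a v) B = c \<odot>\<^bsub>L\<^esub> lincomb a B"
  using lincomb_smult[OF assms, of a c] by simp

lemma smult_zero: "a \<odot>\<^bsub>L\<^esub> \<zero>\<^bsub>L\<^esub> = \<zero>\<^bsub>L\<^esub>"
  using smult_r_null[of a] by simp

lemma smult_minus_right:
  assumes "x \<in> carrier L" "y \<in> carrier L"
  shows "a \<odot>\<^bsub>L\<^esub> (x \<ominus>\<^bsub>L\<^esub> y) = a \<odot>\<^bsub>L\<^esub> x \<ominus>\<^bsub>L\<^esub> a \<odot>\<^bsub>L\<^esub> y"
proof -
  have "a \<odot>\<^bsub>L\<^esub> (x \<ominus>\<^bsub>L\<^esub> y) \<oplus>\<^bsub>L\<^esub> a \<odot>\<^bsub>L\<^esub> y = a \<odot>\<^bsub>L\<^esub> (x \<ominus>\<^bsub>L\<^esub> y \<oplus>\<^bsub>L\<^esub> y)"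
    using assms by (simp add: smult_r_distr)
  also have "x \<ominus>\<^bsub>L\<^esub> y \<oplus>\<^bsub>L\<^esub> y = x"
    using assms by (simp add: M.minus_eq M.add.m_assoc M.l_neg)
  finally show ?thesis
    using assms by (metis M.minus_closed M.minus_eq M.add.inv_solve_right smult_in)
qed

lemma minus_plus_cancel:
  assumes "x \<in> carrier L" "y \<in> carrier L" "z \<in> carrier L"
  shows "(x \<oplus>\<^bsub>L\<^esub> y) \<ominus>\<^bsub>L\<^esub> (x \<oplus>\<^bsub>L\<^esub> z) = y \<ominus>\<^bsub>L\<^esub> z"
proof -
  have "(x \<oplus>\<^bsub>L\<^esub> y) \<ominus>\<^bsub>L\<^esub> (x \<oplus>\<^bsub>L\<^esub> z) = (y \<oplus>\<^bsub>L\<^esub> x) \<oplus>\<^bsub>L\<^esub> (\<ominus>\<^bsub>L\<^esub> x \<oplus>\<^bsub>L\<^esub> \<ominus>\<^bsub>L\<^esub> z)"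
    using assms M.a_comm[of x y] by (simp add: M.minus_eq M.minus_add)
  also have "\<dots> = y \<oplus>\<^bsub>L\<^esub> (x \<oplus>\<^bsub>L\<^esub> (\<ominus>\<^bsub>L\<^esub> x \<oplus>\<^bsub>L\<^esub> \<ominus>\<^bsub>L\<^esub> z))"
    using assms by (intro M.a_assoc) auto
  finally show ?thesis
    using assms by (simp add: M.r_neg2 M.minus_eq)
qed

lemma eq_minus_if_plus_eq:
  assumes "x \<in> carrier L" "y \<in> carrier L" "z = x \<oplus>\<^bsub>L\<^esub> y"
  shows "x = z \<ominus>\<^bsub>L\<^esub> y"
  unfolding assms(3) using assms(1,2) by (simp add: M.minus_eq M.a_assoc M.r_neg)

lemma prime_smult_cancel:
  assumes "x \<in> carrier L" "y \<in> carrier L" "padic_prime \<odot>\<^bsub>L\<^esub> x = padic_prime \<odot>\<^bsub>L\<^esub> y"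
  shows "x = y"
proof -
  have "padic_prime \<odot>\<^bsub>L\<^esub> (x \<ominus>\<^bsub>L\<^esub> y) = \<zero>\<^bsub>L\<^esub>"
    using assms by (simp only: smult_minus_right) (simp add: M.r_neg M.minus_eq)
  hence "x \<ominus>\<^bsub>L\<^esub> y = \<zero>\<^bsub>L\<^esub>"
    using assms torsion_free by blast
  thus ?thesis
    using assms by simp
qed

text \<open>Linear independence of the classes of \<open>B\<close> in L / pL over the field with p
  elements, phrased without forming the quotient.\<close>

definition indep_mod_prime :: "'b set \<Rightarrow> bool" where
  "indep_mod_prime B \<longleftrightarrow> finite B \<and> B \<subseteq> carrier L \<and>
     (\<forall>c. \<forall>y\<in>carrier L. lincomb c B = padic_prime \<odot>\<^bsub>L\<^esub> y \<longrightarrow> (\<forall>b\<in>B. padic_prime dvd c b))"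

text \<open>One factor p is divided out of the coefficients at a time; torsion-freeness cancels it
  on both sides.\<close>

lemma indep_mod_prime_power:
  assumes B: "indep_mod_prime B" and "y \<in> carrier L"
    and "lincomb c B = padic_prime ^ n \<odot>\<^bsub>L\<^esub> y" and "b \<in> B"
  shows "padic_prime ^ n dvd c b"
  using assms(2-)
proof (induction n arbitrary: c)
  case (Suc n)
  have BL: "B \<subseteq> carrier L"
    using B by (simp add: indep_mod_prime_def)
  have eq: "lincomb c B = padic_prime \<odot>\<^bsub>L\<^esub> (padic_prime ^ n \<odot>\<^bsub>L\<^esub> y)"
    using Suc.prems by (simp add: smult_mult)
  hence "\<forall>b\<in>B. padic_prime dvd c b"
    using B Suc.prems(1) unfolding indep_mod_prime_def by blast
  then obtain d where d: "\<And>b. b \<in> B \<Longrightarrow> c b = padic_prime * d b"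
    unfolding dvd_def by metis
  have "lincomb c B = padic_prime \<odot>\<^bsub>L\<^esub> lincomb d B"
    using lincomb_cong[OF refl BL, of c "\<lambda>b. padic_prime * d b"] d lincomb_scale[OF BL] by simp
  hence "padic_prime \<odot>\<^bsub>L\<^esub> lincomb d B = padic_prime \<odot>\<^bsub>L\<^esub> (padic_prime ^ n \<odot>\<^bsub>L\<^esub> y)"
    using eq by (rule trans[OF sym])
  hence "lincomb d B = padic_prime ^ n \<odot>\<^bsub>L\<^esub> y"
    by (rule prime_smult_cancel[OF lincomb_in[OF BL] smult_in[OF Suc.prems(1)]])
  thus ?case
    using Suc.IH[OF Suc.prems(1) _ Suc.prems(3)] d[OF Suc.prems(3)] by simp
qed simp

lemma indep_mod_prime_lin_indpt:
  assumes "indep_mod_prime B"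
  shows "\<not> lin_dep B"
proof (rule finite_lin_indpt2)
  fix a assume "lincomb a B = \<zero>\<^bsub>L\<^esub>"
  hence "lincomb a B = padic_prime ^ n \<odot>\<^bsub>L\<^esub> \<zero>\<^bsub>L\<^esub>" for n
    by (simp add: smult_zero)
  hence "padic_prime ^ n dvd a v" if "v \<in> B" for n v
    using indep_mod_prime_power[OF assms M.zero_closed _ that] by blast
  hence "a v = 0" if "v \<in> B" for v
    using that by (intro eq_zero_if_all_prime_powers_dvd)
  thus "\<forall>v\<in>B. a v = \<zero>\<^bsub>padic_ring\<^esub>"
    by simp
qed (use assms in \<open>auto simp: indep_mod_prime_def\<close>)

text \<open>Maximality gives a nontrivial relation modulo p between \<open>x\<close> and
  \<open>B\<close>. Its coefficient at \<open>x\<close> is a unit of the p-adic integers, so the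
  relation can be solved for \<open>x\<close>.\<close>

lemma maximal_indep_mod_prime_spans:
  assumes B: "indep_mod_prime B"
    and max: "\<And>x. x \<in> carrier L - B \<Longrightarrow> \<not> indep_mod_prime (insert x B)"
    and x: "x \<in> carrier L"
  shows "\<exists>c. \<exists>y\<in>carrier L. x = lincomb c B \<oplus>\<^bsub>L\<^esub> padic_prime \<odot>\<^bsub>L\<^esub> y"
proof (cases "x \<in> B")
  case True
  have fin: "finite B" and BL: "B \<subseteq> carrier L"
    using B by (auto simp: indep_mod_prime_def)
  have "lincomb (\<lambda>v. if v = x then 1 else 0) B = x"
  proof -
    have "lincomb (\<lambda>v. if v = x then 1 else 0) B = (\<Oplus>\<^bsub>L\<^esub>v\<in>B. if x = v then v else \<zero>\<^bsub>L\<^esub>)"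
      unfolding lincomb_def using BL smult_one smult_l_null by (intro finsum_cong') auto
    also have "\<dots> = x"
      using True fin BL by (intro M.add.finprod_singleton) auto
    finally show ?thesis .
  qed
  hence "x = lincomb (\<lambda>v. if v = x then 1 else 0) B \<oplus>\<^bsub>L\<^esub> padic_prime \<odot>\<^bsub>L\<^esub> \<zero>\<^bsub>L\<^esub>"
    using x by (simp add: smult_zero)
  thus ?thesis
    by blast
next
  case False
  have fin: "finite B" and BL: "B \<subseteq> carrier L"
    using B by (auto simp: indep_mod_prime_def)
  obtain c y where y: "y \<in> carrier L" "lincomb c (insert x B) = padic_prime \<odot>\<^bsub>L\<^esub> y"
    and not_dvd: "\<exists>b\<in>insert x B. \<not> padic_prime dvd c b"
    using max[of x] False x fin BL unfolding indep_mod_prime_def by auto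
  have eq: "c x \<odot>\<^bsub>L\<^esub> x \<oplus>\<^bsub>L\<^esub> lincomb c B = padic_prime \<odot>\<^bsub>L\<^esub> y"
    using lincomb_insert[OF fin BL, of c x] False x y(2) by simp
  \<comment> \<open>Otherwise the term of \<open>x\<close> could be absorbed into the multiple of p,
    leaving a nontrivial relation modulo p within \<open>B\<close>.\<close>
  have "\<not> padic_prime dvd c x"
  proof
    assume dvd: "padic_prime dvd c x"
    then obtain a where a: "c x = padic_prime * a" ..
    have "padic_prime \<odot>\<^bsub>L\<^esub> (a \<odot>\<^bsub>L\<^esub> x) \<oplus>\<^bsub>L\<^esub> lincomb c B = padic_prime \<odot>\<^bsub>L\<^esub> y"
      using eq a x by (simp add: smult_mult)
    hence "lincomb c B = padic_prime \<odot>\<^bsub>L\<^esub> y \<ominus>\<^bsub>L\<^esub> padic_prime \<odot>\<^bsub>L\<^esub> (a \<odot>\<^bsub>L\<^esub> x)"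
      using x y BL by (metis M.add.inv_solve_right M.add.m_comm M.minus_eq lincomb_in smult_in)
    hence "lincomb c B = padic_prime \<odot>\<^bsub>L\<^esub> (y \<ominus>\<^bsub>L\<^esub> a \<odot>\<^bsub>L\<^esub> x)"
      using x y by (simp add: smult_minus_right)
    moreover have "y \<ominus>\<^bsub>L\<^esub> a \<odot>\<^bsub>L\<^esub> x \<in> carrier L"
      using x y by simp
    ultimately have "\<forall>b\<in>B. padic_prime dvd c b"
      using B unfolding indep_mod_prime_def by blast
    thus False
      using dvd not_dvd by blast
  qed
  then obtain u where u: "u * c x = 1"
    using unit_if_not_prime_dvd by (metis dvdE mult.commute)
  have "x = u \<odot>\<^bsub>L\<^esub> (c x \<odot>\<^bsub>L\<^esub> x)"
    using u x smult_mult[of x u "c x"] smult_one[of x] by simp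
  also have "c x \<odot>\<^bsub>L\<^esub> x = padic_prime \<odot>\<^bsub>L\<^esub> y \<ominus>\<^bsub>L\<^esub> lincomb c B"
    using eq x y BL by (metis M.add.inv_solve_right M.minus_eq lincomb_in smult_in)
  also have "u \<odot>\<^bsub>L\<^esub> \<dots> = u \<odot>\<^bsub>L\<^esub> (padic_prime \<odot>\<^bsub>L\<^esub> y) \<ominus>\<^bsub>L\<^esub> u \<odot>\<^bsub>L\<^esub> lincomb c B"
    using y BL by (simp add: smult_minus_right)
  also have "\<dots> = (- u) \<odot>\<^bsub>L\<^esub> lincomb c B \<oplus>\<^bsub>L\<^esub> padic_prime \<odot>\<^bsub>L\<^esub> (u \<odot>\<^bsub>L\<^esub> y)"
  proof -
    have "(- u) \<odot>\<^bsub>L\<^esub> lincomb c B \<oplus>\<^bsub>L\<^esub> u \<odot>\<^bsub>L\<^esub> lincomb c B = \<zero>\<^bsub>L\<^esub>"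
      using smult_plus[of "lincomb c B" "- u" u] BL smult_l_null[of "lincomb c B"] by simp
    hence "(- u) \<odot>\<^bsub>L\<^esub> lincomb c B = \<ominus>\<^bsub>L\<^esub> (u \<odot>\<^bsub>L\<^esub> lincomb c B)"
      using BL by (simp add: M.minus_equality)
    thus ?thesis
      using y BL by (simp add: M.minus_eq M.add.m_comm smult_mult[symmetric] mult.commute)
  qed
  also have "(- u) \<odot>\<^bsub>L\<^esub> lincomb c B = lincomb (\<lambda>v. - u * c v) B"
    using lincomb_scale[OF BL, of "- u" c] by simp
  finally show ?thesis
    using y by blast
qed

text \<open>Iterating the hypothesis expands \<open>x\<close> modulo every p^n. The coefficients
  form Cauchy sequences; the combination with their limits differs from \<open>x\<close> by an
  element divisible by all p^n, which is zero by separatedness.\<close>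

lemma spans_mod_prime_spans:
  assumes B: "indep_mod_prime B"
    and span: "\<And>x. x \<in> carrier L \<Longrightarrow> \<exists>c. \<exists>y\<in>carrier L. x = lincomb c B \<oplus>\<^bsub>L\<^esub> padic_prime \<odot>\<^bsub>L\<^esub> y"
    and x: "x \<in> carrier L"
  obtains c where "x = lincomb c B"
proof -
  have BL: "B \<subseteq> carrier L"
    using B by (auto simp: indep_mod_prime_def)
  have "\<exists>c. \<exists>y\<in>carrier L. x = lincomb c B \<oplus>\<^bsub>L\<^esub> padic_prime ^ n \<odot>\<^bsub>L\<^esub> y" for n
  proof (induction n)
    case 0
    have "lincomb (\<lambda>_. 0) B = \<zero>\<^bsub>L\<^esub>"
      using lincomb_scale[OF BL, of 0 "\<lambda>_. 0"] BL smult_l_null[of "lincomb (\<lambda>_. 0) B"] by simp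
    hence "x = lincomb (\<lambda>_. 0) B \<oplus>\<^bsub>L\<^esub> padic_prime ^ 0 \<odot>\<^bsub>L\<^esub> x"
      using x smult_one[of x] by simp
    thus ?case
      using x by blast
  next
    case (Suc n)
    then obtain c y where y: "y \<in> carrier L" and c: "x = lincomb c B \<oplus>\<^bsub>L\<^esub> padic_prime ^ n \<odot>\<^bsub>L\<^esub> y"
      by blast
    obtain d z where z: "z \<in> carrier L" and d: "y = lincomb d B \<oplus>\<^bsub>L\<^esub> padic_prime \<odot>\<^bsub>L\<^esub> z"
      using span[OF y] by blast
    have "x = lincomb c B \<oplus>\<^bsub>L\<^esub> (padic_prime ^ n \<odot>\<^bsub>L\<^esub> lincomb d B \<oplus>\<^bsub>L\<^esub> padic_prime ^ Suc n \<odot>\<^bsub>L\<^esub> z)"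
      using c z BL unfolding d
      by (simp add: smult_r_distr smult_mult[symmetric] mult.commute)
    also have "\<dots> = lincomb (\<lambda>v. c v + padic_prime ^ n * d v) B \<oplus>\<^bsub>L\<^esub> padic_prime ^ Suc n \<odot>\<^bsub>L\<^esub> z"
      using z BL by (simp add: lincomb_plus lincomb_scale M.add.m_assoc)
    finally show ?case
      using z by blast
  qed
  then obtain c y where y: "\<And>n. y n \<in> carrier L"
    and c: "\<And>n. x = lincomb (c n) B \<oplus>\<^bsub>L\<^esub> padic_prime ^ n \<odot>\<^bsub>L\<^esub> y n"
    by metis
  \<comment> \<open>The expansions were chosen separately for each n, so they are not successive
    refinements by construction. Their difference is a combination of \<open>B\<close> lying in p^n
    L, and independence modulo p makes its coefficients divisible by p^n.\<close>
  have step: "padic_prime ^ n dvd c (Suc n) b - c n b" if b: "b \<in> B" for n b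
  proof -
    have 1: "lincomb (\<lambda>v. c (Suc n) v - c n v) B \<oplus>\<^bsub>L\<^esub> lincomb (c n) B = lincomb (c (Suc n)) B"
      using lincomb_plus[OF BL, of "\<lambda>v. c (Suc n) v - c n v" "c n"] by simp
    have 2: "padic_prime ^ Suc n \<odot>\<^bsub>L\<^esub> y (Suc n) = padic_prime ^ n \<odot>\<^bsub>L\<^esub> (padic_prime \<odot>\<^bsub>L\<^esub> y (Suc n))"
      using y by (simp add: smult_mult[symmetric] mult.commute)
    let ?d = "lincomb (\<lambda>v. c (Suc n) v - c n v) B"
    have dc: "?d \<in> carrier L" "lincomb (c n) B \<in> carrier L"
      using BL by auto
    let ?y = "padic_prime ^ n \<odot>\<^bsub>L\<^esub> (padic_prime \<odot>\<^bsub>L\<^esub> y (Suc n))"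
    have yc: "?y \<in> carrier L" "padic_prime ^ n \<odot>\<^bsub>L\<^esub> y n \<in> carrier L"
      using y by auto
    have "padic_prime ^ n \<odot>\<^bsub>L\<^esub> y n \<oplus>\<^bsub>L\<^esub> lincomb (c n) B = x"
      by (rule trans[OF M.a_comm[OF yc(2) dc(2)] sym[OF c]])
    also have "\<dots> = ?d \<oplus>\<^bsub>L\<^esub> lincomb (c n) B \<oplus>\<^bsub>L\<^esub> ?y"
      using c[of "Suc n"] unfolding 1 2 .
    also have "\<dots> = ?d \<oplus>\<^bsub>L\<^esub> ?y \<oplus>\<^bsub>L\<^esub> lincomb (c n) B"
      using dc yc by (simp only: M.a_ac M.a_closed)
    finally have "padic_prime ^ n \<odot>\<^bsub>L\<^esub> y n = ?d \<oplus>\<^bsub>L\<^esub> ?y"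
      by (rule M.add.right_cancel[OF dc(2) yc(2) M.a_closed[OF dc(1) yc(1)], THEN iffD1])
    hence "?d = padic_prime ^ n \<odot>\<^bsub>L\<^esub> y n \<ominus>\<^bsub>L\<^esub> ?y"
      by (rule eq_minus_if_plus_eq[OF dc(1) yc(1)])
    also have "\<dots> = padic_prime ^ n \<odot>\<^bsub>L\<^esub> (y n \<ominus>\<^bsub>L\<^esub> padic_prime \<odot>\<^bsub>L\<^esub> y (Suc n))"
      using y by (intro smult_minus_right[symmetric]) auto
    finally show ?thesis
      by (rule indep_mod_prime_power[OF B _ _ b, rotated]) (use y in auto)
  qed
  have "\<exists>l. \<forall>n. padic_prime ^ n dvd l - c n b" if "b \<in> B" for b
    using padic_complete[of "\<lambda>n. c n b"] step[OF that] by blast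
  then obtain l where l: "\<And>b n. b \<in> B \<Longrightarrow> padic_prime ^ n dvd l b - c n b"
    by metis
  have "x \<ominus>\<^bsub>L\<^esub> lincomb l B = \<zero>\<^bsub>L\<^esub>"
  proof (rule separated)
    fix n
    obtain e where e: "\<And>b. b \<in> B \<Longrightarrow> l b - c n b = padic_prime ^ n * e b"
      using l[of _ n] unfolding dvd_def by metis
    have "lincomb l B = lincomb (\<lambda>v. c n v + padic_prime ^ n * e v) B"
      using e BL by (intro lincomb_cong) (auto simp: algebra_simps)
    hence "lincomb l B = lincomb (c n) B \<oplus>\<^bsub>L\<^esub> padic_prime ^ n \<odot>\<^bsub>L\<^esub> lincomb e B"
      using BL by (simp add: lincomb_plus lincomb_scale)
    hence "x \<ominus>\<^bsub>L\<^esub> lincomb l B = padic_prime ^ n \<odot>\<^bsub>L\<^esub> y n \<ominus>\<^bsub>L\<^esub> padic_prime ^ n \<odot>\<^bsub>L\<^esub> lincomb e B"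
      using y BL by (subst c[of n]) (simp add: minus_plus_cancel)
    also have "\<dots> = padic_prime ^ n \<odot>\<^bsub>L\<^esub> (y n \<ominus>\<^bsub>L\<^esub> lincomb e B)"
      using y BL by (simp add: smult_minus_right)
    finally show "\<exists>z\<in>carrier L. x \<ominus>\<^bsub>L\<^esub> lincomb l B = padic_prime ^ n \<odot>\<^bsub>L\<^esub> z"
      using y BL by blast
  qed (use x BL in auto)
  hence "x = lincomb l B"
    using x BL by simp
  thus thesis
    using that by blast
qed

text \<open>The rank bound limits the size of sets that are independent modulo p, so one of largest
  size exists. It is maximal, hence spanning.\<close>

theorem finite_basis_exists:
  assumes rank: "\<And>B. \<lbrakk>finite B; B \<subseteq> carrier L; N < card B\<rbrakk> \<Longrightarrow> lin_dep B"
  obtains B where "finite B" "B \<subseteq> carrier L" "\<not> lin_dep B" "span B = carrier L"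
proof -
  have card: "card B \<le> N" if "indep_mod_prime B" for B
    using rank indep_mod_prime_lin_indpt that by (meson indep_mod_prime_def not_le)
  moreover have "indep_mod_prime {}"
    by (simp add: indep_mod_prime_def)
  ultimately obtain B where B: "indep_mod_prime B" "\<And>C. indep_mod_prime C \<Longrightarrow> card C \<le> card B"
    using ex_has_greatest_nat[of indep_mod_prime "{}" card "Suc N"] by (metis le_imp_less_Suc)
  have fin: "finite B" and BL: "B \<subseteq> carrier L"
    using B(1) by (auto simp: indep_mod_prime_def)
  have "\<not> indep_mod_prime (insert x B)" if "x \<in> carrier L - B" for x
    using B(2)[of "insert x B"] fin that by auto
  hence spans: "\<exists>c. x = lincomb c B" if "x \<in> carrier L" for x
    using maximal_indep_mod_prime_spans[OF B(1)] spans_mod_prime_spans[OF B(1)] that by metis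
  have "span B = carrier L"
    unfolding finite_span[OF fin BL] using spans BL by auto
  thus thesis
    using that fin BL indep_mod_prime_lin_indpt[OF B(1)] by blast
qed

end

section \<open>Linear algebra over the fraction field\<close>

text \<open>Gaussian elimination without division: the unknown \<open>t0\<close> is eliminated by
  means of the equation \<open>s\<close>, the others being cross-multiplied with its
  coefficients.\<close>

lemma homogeneous_solution:
  fixes v :: "'t \<Rightarrow> 's \<Rightarrow> 'f::idom"
  assumes "finite S" "finite T" "card S < card T"
  shows "\<exists>c. (\<exists>t\<in>T. c t \<noteq> 0) \<and> (\<forall>s\<in>S. (\<Sum>t\<in>T. c t * v t s) = 0)"
  using assms
proof (induction S arbitrary: T v rule: finite_induct)
  case empty
  hence "\<exists>t\<in>T. (1 :: 'f) \<noteq> 0"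
    by (metis card.empty ex_in_conv less_irrefl one_neq_zero)
  thus ?case
    by (intro exI[of _ "\<lambda>_. 1"]) auto
next
  case (insert s S)
  show ?case
  proof (cases "\<forall>t\<in>T. v t s = 0")
    case True
    thus ?thesis
      using insert.IH[of T v] insert.prems insert.hyps by auto
  next
    case False
    then obtain t0 where t0: "t0 \<in> T" "v t0 s \<noteq> 0"
      by blast
    define T' where "T' = T - {t0}"
    have T: "T = insert t0 T'" "t0 \<notin> T'" "finite T'"
      using t0 insert.prems by (auto simp: T'_def)
    have "card S < card T'"
      using insert.prems insert.hyps T by simp
    then obtain c where c: "\<exists>t\<in>T'. c t \<noteq> 0"
      and sol: "\<And>r. r \<in> S \<Longrightarrow> (\<Sum>t\<in>T'. c t * (v t0 s * v t r - v t s * v t0 r)) = 0"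
      using insert.IH[of T' "\<lambda>t r. v t0 s * v t r - v t s * v t0 r"] T by blast
    \<comment> \<open>Back substitution: scaling the solution by \<open>v t0 s\<close> makes the
      equation \<open>s\<close> solvable for the unknown \<open>t0\<close> inside the
      domain.\<close>
    define d where "d t = (if t = t0 then - (\<Sum>t\<in>T'. c t * v t s) else c t * v t0 s)" for t
    have "(\<Sum>t\<in>T. d t * v t r) = (\<Sum>t\<in>T'. c t * (v t0 s * v t r - v t s * v t0 r))" for r
    proof -
      have "(\<Sum>t\<in>T'. d t * v t r) = (\<Sum>t\<in>T'. c t * v t0 s * v t r)"
        using T by (intro sum.cong) (auto simp: d_def)
      thus ?thesis
        using T by (simp add: d_def sum_distrib_right sum_distrib_left sum_subtractf algebra_simps)
    qed
    moreover have "\<exists>t\<in>T. d t \<noteq> 0"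
      using c T t0 by (auto simp: d_def)
    ultimately show ?thesis
      using sol by (intro exI[of _ d]) (auto simp: algebra_simps)
  qed
qed

lemma common_denominator:
  fixes c :: "'s \<Rightarrow> 'a::idom fract"
  assumes "finite S"
  shows "\<exists>d. d \<noteq> 0 \<and> (\<forall>s\<in>S. \<exists>a. to_fract d * c s = to_fract a)"
  using assms
proof induction
  case empty
  thus ?case
    using one_neq_zero by blast
next
  case (insert s S)
  then obtain d where d: "d \<noteq> 0" "\<forall>s\<in>S. \<exists>a. to_fract d * c s = to_fract a"
    by blast
  obtain x y where xy: "c s = Fract x y" "y \<noteq> 0"
    by (rule Fract_cases[of "c s"])
  have "to_fract (d * y) * c s = to_fract (d * x)"
    using xy by (simp add: Fract_conv_to_fract)
  moreover have "\<exists>a. to_fract (d * y) * c r = to_fract a" if r: "r \<in> S" for r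
  proof -
    obtain a where "to_fract d * c r = to_fract a"
      by (rule exE[OF bspec[OF d(2) r]])
    hence "to_fract y * (to_fract d * c r) = to_fract (y * a)"
      by simp
    hence "to_fract (d * y) * c r = to_fract (y * a)"
      by (simp add: ac_simps)
    thus ?thesis ..
  qed
  ultimately have "\<forall>r\<in>insert s S. \<exists>a. to_fract (d * y) * c r = to_fract a"
    unfolding ball_simps(7) by blast
  moreover have "d * y \<noteq> 0"
    using d(1) xy(2) by simp
  ultimately show ?case
    by blast
qed

section \<open>The ring of integers\<close>

context finite_padic_extension
begin

definition \<iota> :: "'p padic_int \<Rightarrow> 'k" where
  "\<iota> a = emb (to_fract a)"

lemma \<iota>_fun: "(\<lambda>a. emb (to_fract a)) = \<iota>"
  by (simp add: \<iota>_def fun_eq_iff)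

sublocale zp: inj_idom_hom \<iota>
  by unfold_locales (simp_all add: \<iota>_def hom_add hom_mult)

lemmas [simp] = zp.hom_add zp.hom_mult zp.hom_power zp.hom_uminus zp.hom_minus

declare padic_prime_nonzero [simp]

text \<open>The generators form a family rather than a set, since monomials x^i y^j with different
  exponents may coincide in K.\<close>

definition zspan :: "'t set \<Rightarrow> ('t \<Rightarrow> 'k) \<Rightarrow> 'k set" where
  "zspan T b = range (\<lambda>c. \<Sum>t\<in>T. \<iota> (c t) * b t)"

lemma zspanI: "x = (\<Sum>t\<in>T. \<iota> (c t) * b t) \<Longrightarrow> x \<in> zspan T b"
  by (auto simp: zspan_def)

lemma zspan_add: "x \<in> zspan T b \<Longrightarrow> y \<in> zspan T b \<Longrightarrow> x + y \<in> zspan T b"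
proof -
  assume "x \<in> zspan T b" "y \<in> zspan T b"
  then obtain c d where "x = (\<Sum>t\<in>T. \<iota> (c t) * b t)" "y = (\<Sum>t\<in>T. \<iota> (d t) * b t)"
    by (auto simp: zspan_def)
  thus ?thesis
    by (intro zspanI[of _ "\<lambda>t. c t + d t"]) (simp add: sum.distrib algebra_simps)
qed

lemma zspan_scale: "x \<in> zspan T b \<Longrightarrow> \<iota> a * x \<in> zspan T b"
proof -
  assume "x \<in> zspan T b"
  then obtain c where "x = (\<Sum>t\<in>T. \<iota> (c t) * b t)"
    by (auto simp: zspan_def)
  thus ?thesis
    by (intro zspanI[of _ "\<lambda>t. a * c t"]) (simp add: sum_distrib_left algebra_simps)
qed

lemma zspan_sum: "(\<And>s. s \<in> S \<Longrightarrow> x s \<in> zspan T b) \<Longrightarrow> sum x S \<in> zspan T b"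
proof (induction S rule: infinite_finite_induct)
  case (insert s S)
  thus ?case
    by (simp add: zspan_add)
qed (auto intro!: zspanI[of _ "\<lambda>_. 0"])

lemma zspan_base: "finite T \<Longrightarrow> t \<in> T \<Longrightarrow> b t \<in> zspan T b"
proof (rule zspanI)
  assume "finite T" "t \<in> T"
  moreover have "\<iota> (if s = t then 1 else 0) * b s = (if t = s then b s else 0)" for s
    by auto
  ultimately show "b t = (\<Sum>s\<in>T. \<iota> (if s = t then 1 else 0) * b s)"
    by simp
qed

lemma mult_zspan:
  assumes "\<And>t. t \<in> T \<Longrightarrow> z * b t \<in> zspan T b" "x \<in> zspan T b"
  shows "z * x \<in> zspan T b"
proof -
  obtain c where x: "x = (\<Sum>t\<in>T. \<iota> (c t) * b t)"
    using assms(2) by (auto simp: zspan_def)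
  have "(\<Sum>t\<in>T. \<iota> (c t) * (z * b t)) \<in> zspan T b"
    using assms(1) by (intro zspan_sum zspan_scale)
  thus ?thesis
    unfolding x by (simp add: sum_distrib_left algebra_simps)
qed

text \<open>The determinant trick: multiplication by \<open>z\<close> on the generators is given by
  a matrix over the p-adic integers. The vector of generators is an eigenvector for
  \<open>z\<close>, nonzero because some generator is, so \<open>z\<close> is a root of the monic
  characteristic polynomial.\<close>

lemma integral_if_mult_zspan:
  assumes fin: "finite T" and nonzero: "t \<in> T" "b t \<noteq> 0"
    and stable: "\<And>t. t \<in> T \<Longrightarrow> z * b t \<in> zspan T b"
  shows "z \<in> integers emb"
proof -
  have "\<forall>t\<in>T. \<exists>c. z * b t = (\<Sum>s\<in>T. \<iota> (c s) * b s)"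
    using stable by (auto simp: zspan_def)
  then obtain c where c: "\<And>t. t \<in> T \<Longrightarrow> z * b t = (\<Sum>s\<in>T. \<iota> (c t s) * b s)"
    by metis
  define n where "n = card T"
  obtain f where f: "bij_betw f {..<n} T"
    using ex_bij_betw_nat_finite[OF fin] by (auto simp: n_def lessThan_atLeast0)
  define A where "A = mat n n (\<lambda>(i, j). c (f i) (f j))"
  define v where "v = vec n (\<lambda>i. b (f i))"
  have A: "A \<in> carrier_mat n n" "map_mat \<iota> A \<in> carrier_mat n n"
    by (auto simp: A_def)
  obtain i where i: "i < n" "f i = t"
    using f nonzero(1) by (auto simp: bij_betw_def)
  have "v \<noteq> 0\<^sub>v n"
  proof
    assume "v = 0\<^sub>v n"
    hence "v $ i = 0\<^sub>v n $ i"
      by simp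
    thus False
      using i nonzero by (simp add: v_def)
  qed
  moreover have "map_mat \<iota> A *\<^sub>v v = z \<cdot>\<^sub>v v"
  proof (rule eq_vecI)
    fix i assume "i < dim_vec (z \<cdot>\<^sub>v v)"
    hence i: "i < n"
      by (simp add: v_def)
    hence fi: "f i \<in> T"
      using f by (auto simp: bij_betw_def)
    have "(map_mat \<iota> A *\<^sub>v v) $ i = (\<Sum>j<n. \<iota> (c (f i) (f j)) * b (f j))"
      using i by (auto simp: A_def v_def scalar_prod_def lessThan_atLeast0 intro!: sum.cong)
    also have "\<dots> = (\<Sum>s\<in>T. \<iota> (c (f i) s) * b s)"
      by (rule sum.reindex_bij_betw[OF f])
    finally show "(map_mat \<iota> A *\<^sub>v v) $ i = (z \<cdot>\<^sub>v v) $ i"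
      using c[OF fi] i by (simp add: v_def)
  qed (simp add: A_def v_def)
  ultimately have "eigenvalue (map_mat \<iota> A) z"
    unfolding eigenvalue_def eigenvector_def using A by (intro exI[of _ v]) (auto simp: v_def A_def)
  hence "poly (map_poly \<iota> (char_poly A)) z = 0"
    using eigenvalue_root_char_poly[OF A(2)] zp.char_poly_hom[OF A(1)] by simp
  moreover have "lead_coeff (char_poly A) = 1"
    using degree_monic_char_poly[OF A(1)] by simp
  ultimately show ?thesis
    by (auto simp: integers_def \<iota>_fun)
qed

lemma \<iota>_integral: "\<iota> a \<in> integers emb"
  by (rule integral_if_mult_zspan[of "{()}" "()" "\<lambda>_. 1"]) (auto intro!: zspanI[of _ "\<lambda>_. a"])

lemma integral_equation:
  assumes "x \<in> integers emb"
  obtains d f where "d > 0" "x ^ d = (\<Sum>i<d. \<iota> (f i) * x ^ i)"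
proof -
  obtain f :: "'p padic_int poly" where f: "lead_coeff f = 1" "poly (map_poly \<iota> f) x = 0"
    using assms by (auto simp: integers_def \<iota>_fun)
  have "poly (map_poly \<iota> f) x = (\<Sum>i\<le>degree f. \<iota> (coeff f i) * x ^ i)"
    by (simp add: poly_altdef coeff_map_poly)
  also have "\<dots> = x ^ degree f + (\<Sum>i<degree f. \<iota> (coeff f i) * x ^ i)"
    using f(1) by (simp add: lessThan_Suc_atMost[symmetric])
  finally have eq: "x ^ degree f = (\<Sum>i<degree f. \<iota> (- coeff f i) * x ^ i)"
    using f(2) by (simp add: sum_negf eq_neg_iff_add_eq_0)
  have "degree f > 0"
  proof (rule ccontr)
    assume "\<not> degree f > 0"
    hence "degree f = 0"
      by simp
    thus False
      using eq by simp
  qed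
  thus thesis
    by (rule that[OF _ eq])
qed

text \<open>The span of the monomials x^i y^j with exponents below the degrees of the two integral
  equations is stable under multiplication by x and by y, hence by x + y and x y.\<close>

lemma integral_plus_mult:
  assumes "x \<in> integers emb" "y \<in> integers emb"
  shows "x + y \<in> integers emb" "x * y \<in> integers emb"
proof -
  obtain d f where d: "d > 0" "x ^ d = (\<Sum>i<d. \<iota> (f i) * x ^ i)"
    using integral_equation[OF assms(1)] by blast
  obtain e g where e: "e > 0" "y ^ e = (\<Sum>i<e. \<iota> (g i) * y ^ i)"
    using integral_equation[OF assms(2)] by blast
  define T where "T = {..<d} \<times> {..<e}"
  define b where "b = (\<lambda>(i, j). x ^ i * y ^ j)"
  have fin: "finite T"
    by (simp add: T_def)
  have base: "x ^ i * y ^ j \<in> zspan T b" if "i < d" "j < e" for i j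
    using zspan_base[OF fin, of "(i, j)" b] that by (simp add: T_def b_def)
  have x: "x * b t \<in> zspan T b" if t: "t \<in> T" for t
  proof -
    obtain i j where ij: "t = (i, j)" "i < d" "j < e"
      using t by (auto simp: T_def)
    show ?thesis
    proof (cases "Suc i = d")
      case True
      have "x * b t = x ^ d * y ^ j"
        using True ij by (auto simp: b_def mult.assoc)
      also have "\<dots> = (\<Sum>i<d. \<iota> (f i) * (x ^ i * y ^ j))"
        by (simp add: d(2) sum_distrib_right mult.assoc)
      also have "\<dots> \<in> zspan T b"
        using ij by (intro zspan_sum zspan_scale base) auto
      finally show ?thesis .
    next
      case False
      thus ?thesis
        using base[of "Suc i" j] ij by (simp add: b_def mult.assoc)
    qed
  qed
  have y: "y * b t \<in> zspan T b" if t: "t \<in> T" for t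
  proof -
    obtain i j where ij: "t = (i, j)" "i < d" "j < e"
      using t by (auto simp: T_def)
    show ?thesis
    proof (cases "Suc j = e")
      case True
      have "y * b t = x ^ i * y ^ e"
        using True ij by (auto simp: b_def)
      also have "\<dots> = (\<Sum>j<e. \<iota> (g j) * (x ^ i * y ^ j))"
        by (simp add: e(2) sum_distrib_left algebra_simps)
      also have "\<dots> \<in> zspan T b"
        using ij by (intro zspan_sum zspan_scale base) auto
      finally show ?thesis .
    next
      case False
      thus ?thesis
        using base[of i "Suc j"] ij by (simp add: b_def algebra_simps)
    qed
  qed
  have nonzero: "(0, 0) \<in> T" "b (0, 0) \<noteq> 0"
    using d(1) e(1) by (auto simp: T_def b_def)
  have "(x + y) * b t \<in> zspan T b" if "t \<in> T" for t
    using zspan_add[OF x y] that by (simp add: distrib_right)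
  thus "x + y \<in> integers emb"
    by (rule integral_if_mult_zspan[where b = b, OF fin nonzero])
  have "(x * y) * b t \<in> zspan T b" if "t \<in> T" for t
    using mult_zspan[OF x y] that by (simp add: mult.assoc)
  thus "x * y \<in> integers emb"
    by (rule integral_if_mult_zspan[where b = b, OF fin nonzero])
qed

lemma integral_0 [simp]: "0 \<in> integers emb"
  using \<iota>_integral[of 0] by simp

lemma integral_1 [simp]: "1 \<in> integers emb"
  using \<iota>_integral[of 1] by simp

lemma integral_uminus: "x \<in> integers emb \<Longrightarrow> - x \<in> integers emb"
  using integral_plus_mult(2)[OF \<iota>_integral[of "- 1"], of x] by simp

lemma integral_minus: "x \<in> integers emb \<Longrightarrow> y \<in> integers emb \<Longrightarrow> x - y \<in> integers emb"
  using integral_plus_mult(1)[of x "- y"] integral_uminus[of y] by simp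

lemma integral_power: "x \<in> integers emb \<Longrightarrow> x ^ n \<in> integers emb"
  by (induction n) (auto intro: integral_plus_mult)

section \<open>Denominators, separatedness and rank bounds from the finite degree of K\<close>

lemma obtain_generators:
  obtains B :: "'k set" where "finite B" "\<And>x. \<exists>c. x = (\<Sum>b\<in>B. emb (c b) * b)"
  using finite_degree by blast

text \<open>A common denominator of the coefficients that express \<open>z\<close> times each
  generator of K makes the span of the generators over the p-adic integers stable, and the
  determinant trick applies.\<close>

lemma integral_multiple:
  obtains d where "d \<noteq> 0" "\<iota> d * z \<in> integers emb"
proof -
  obtain B :: "'k set" where B: "finite B" "\<And>x. \<exists>c. x = (\<Sum>b\<in>B. emb (c b) * b)"
    using obtain_generators by blast
  obtain c where c: "\<And>x. x = (\<Sum>b\<in>B. emb (c x b) * b)"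
    using B(2) by metis
  \<comment> \<open>Some generator is nonzero because the generators represent 1.\<close>
  obtain t where t: "t \<in> B" "t \<noteq> 0"
    using c[of 1] by (metis (no_types, lifting) mult_zero_right sum.neutral zero_neq_one)
  obtain d where d: "d \<noteq> 0" "\<And>r s. r \<in> B \<Longrightarrow> s \<in> B \<Longrightarrow> \<exists>a. to_fract d * c (z * r) s = to_fract a"
    using common_denominator[of "B \<times> B" "\<lambda>(r, s). c (z * r) s"] B(1) by auto
  then obtain a where a: "\<And>r s. r \<in> B \<Longrightarrow> s \<in> B \<Longrightarrow> to_fract d * c (z * r) s = to_fract (a r s)"
    by metis
  have "\<iota> d * z * r \<in> zspan B (\<lambda>b. b)" if r: "r \<in> B" for r
  proof (rule zspanI)
    have "\<iota> d * z * r = \<iota> d * (\<Sum>b\<in>B. emb (c (z * r) b) * b)"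
      unfolding mult.assoc using c[of "z * r"] by (rule arg_cong)
    also have "\<dots> = (\<Sum>b\<in>B. \<iota> d * (emb (c (z * r) b) * b))"
      by (rule sum_distrib_left)
    also have "\<dots> = (\<Sum>b\<in>B. \<iota> (a r b) * b)"
      using a r by (intro sum.cong) (auto simp: \<iota>_def mult.assoc[symmetric] hom_mult[symmetric])
    finally show "\<iota> d * z * r = (\<Sum>b\<in>B. \<iota> (a r b) * b)" .
  qed
  hence "\<iota> d * z \<in> integers emb"
    using integral_if_mult_zspan[OF B(1) t(1), of "\<lambda>b. b"] t(2) by blast
  thus thesis
    using that d(1) by blast
qed

text \<open>Multiplying an integral equation of degree d for 1/p by p^d would write 1 as a multiple
  of p in the p-adic integers.\<close>

lemma inverse_prime_not_integral: "1 / \<iota> padic_prime \<notin> integers emb"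
proof
  assume "1 / \<iota> padic_prime \<in> integers emb"
  then obtain d f where d: "d > 0"
    and eq: "(1 / \<iota> padic_prime) ^ d = (\<Sum>i<d. \<iota> (f i) * (1 / \<iota> padic_prime) ^ i)"
    by (rule integral_equation)
  have "1 = \<iota> padic_prime ^ d * (\<Sum>i<d. \<iota> (f i) * (1 / \<iota> padic_prime) ^ i)"
    unfolding eq[symmetric] by (simp add: power_one_over)
  also have "\<dots> = (\<Sum>i<d. \<iota> (f i * padic_prime ^ (d - i)))"
    unfolding sum_distrib_left
  proof (intro sum.cong refl)
    fix i assume "i \<in> {..<d}"
    hence "d = (d - i) + i"
      by simp
    hence "\<iota> padic_prime ^ d = \<iota> padic_prime ^ (d - i) * \<iota> padic_prime ^ i"
      by (metis power_add)
    thus "\<iota> padic_prime ^ d * (\<iota> (f i) * (1 / \<iota> padic_prime) ^ i) = \<iota> (f i * padic_prime ^ (d - i))"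
      by (simp add: power_one_over)
  qed
  also have "\<dots> = \<iota> (\<Sum>i<d. f i * padic_prime ^ (d - i))"
    by (simp add: zp.hom_sum)
  finally have "1 = (\<Sum>i<d. f i * padic_prime ^ (d - i))"
    by (metis zp.hom_one zp.injectivity)
  moreover have "padic_prime dvd (\<Sum>i<d. f i * padic_prime ^ (d - i))"
    by (intro dvd_sum dvd_mult dvd_power) auto
  ultimately show False
    using not_prime_dvd_one by metis
qed

text \<open>If x is nonzero, some d / x with d = p^k u is integral. Multiplying it by x / p^(k+1)
  and by the inverse of the unit u would make 1/p integral.\<close>

lemma integers_separated:
  assumes "\<And>n. x / \<iota> padic_prime ^ n \<in> integers emb"
  shows "x = 0"
proof (rule ccontr)
  assume x: "x \<noteq> 0"
  obtain d where d: "d \<noteq> 0" "\<iota> d * (1 / x) \<in> integers emb"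
    using integral_multiple by blast
  obtain k u w where u: "d = padic_prime ^ k * u" "1 = u * w"
    using padic_int_cases[OF d(1)] by (metis dvdE)
  have "\<iota> d * (1 / x) * (x / \<iota> padic_prime ^ Suc k) * \<iota> w \<in> integers emb"
    by (intro integral_plus_mult(2) assms d(2) \<iota>_integral)
  also have "\<iota> d * (1 / x) * (x / \<iota> padic_prime ^ Suc k) * \<iota> w = \<iota> (u * w) / \<iota> padic_prime"
    using x unfolding u(1) by (simp add: zp.hom_mult zp.hom_power)
  finally show False
    using inverse_prime_not_integral u(2) by simp
qed

text \<open>Over the p-adic field, a relation between vectors in K^S amounts to at most |S| |B|
  linear equations, where B generates K. With more unknowns than this there is a nonzero solution,
  whose denominators are then cleared.\<close>

lemma bounded_rank:
  assumes "finite S"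
  obtains N where "\<And>(T :: 't set) (v :: 't \<Rightarrow> 's \<Rightarrow> 'k). \<lbrakk>finite T; N < card T\<rbrakk> \<Longrightarrow>
    \<exists>c. (\<exists>t\<in>T. c t \<noteq> 0) \<and> (\<forall>s\<in>S. (\<Sum>t\<in>T. \<iota> (c t) * v t s) = 0)"
proof -
  obtain B :: "'k set" where B: "finite B" "\<And>x. \<exists>c. x = (\<Sum>b\<in>B. emb (c b) * b)"
    using obtain_generators by blast
  obtain e where e: "\<And>x. x = (\<Sum>b\<in>B. emb (e x b) * b)"
    using B(2) by metis
  have "\<exists>c. (\<exists>t\<in>T. c t \<noteq> 0) \<and> (\<forall>s\<in>S. (\<Sum>t\<in>T. \<iota> (c t) * v t s) = 0)"
    if T: "finite T" "card (S \<times> B) < card T" for T :: "'t set" and v :: "'t \<Rightarrow> 's \<Rightarrow> 'k"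
  proof -
    obtain c where c: "\<exists>t\<in>T. c t \<noteq> 0"
      "\<And>s b. s \<in> S \<Longrightarrow> b \<in> B \<Longrightarrow> (\<Sum>t\<in>T. c t * e (v t s) b) = 0"
      using homogeneous_solution[OF _ T, of "\<lambda>t (s, b). e (v t s) b"] assms B(1) by auto
    obtain d where d: "d \<noteq> 0" "\<forall>t\<in>T. \<exists>a. to_fract d * c t = to_fract a"
      using common_denominator[OF T(1)] by blast
    then obtain a where a: "\<And>t. t \<in> T \<Longrightarrow> to_fract d * c t = to_fract (a t)"
      by metis
    have "(\<Sum>t\<in>T. \<iota> (a t) * v t s) = 0" if s: "s \<in> S" for s
    proof -
      have "(\<Sum>t\<in>T. \<iota> (a t) * v t s) = (\<Sum>t\<in>T. \<Sum>b\<in>B. emb (to_fract d * (c t * e (v t s) b)) * b)"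
      proof (intro sum.cong refl)
        fix t assume t: "t \<in> T"
        have "\<iota> (a t) * v t s = emb (to_fract d * c t) * (\<Sum>b\<in>B. emb (e (v t s) b) * b)"
          using a[OF t] e[of "v t s"] by (simp add: \<iota>_def)
        thus "\<iota> (a t) * v t s = (\<Sum>b\<in>B. emb (to_fract d * (c t * e (v t s) b)) * b)"
          by (simp add: sum_distrib_left mult.assoc hom_mult)
      qed
      also have "\<dots> = (\<Sum>b\<in>B. emb (to_fract d * (\<Sum>t\<in>T. c t * e (v t s) b)) * b)"
        by (subst sum.swap) (simp add: hom_sum sum_distrib_left sum_distrib_right)
      also have "\<dots> = 0"
        using c(2)[OF s] by simp
      finally show ?thesis .
    qed
    moreover have "\<exists>t\<in>T. a t \<noteq> 0"
      using c(1) a d(1) by (metis mult_eq_0_iff to_fract_eq_0_iff)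
    ultimately show ?thesis
      by blast
  qed
  thus thesis
    using that by blast
qed

text \<open>The multiplication plays no role: the record only carries the module structure.\<close>

definition scalar_module :: "'k set \<Rightarrow> ('p padic_int, 'k) module" where
  "scalar_module X = \<lparr>carrier = X, mult = (*), one = 1, zero = 0, add = (+),
     smult = (\<lambda>a x. \<iota> a * x)\<rparr>"

lemma padic_module_scalar_module:
  assumes X: "X \<subseteq> integers emb" "0 \<in> X"
    and add: "\<And>x y. x \<in> X \<Longrightarrow> y \<in> X \<Longrightarrow> x + y \<in> X"
    and scale: "\<And>a x. x \<in> X \<Longrightarrow> \<iota> a * x \<in> X"
  shows "padic_module (scalar_module X)"
proof -
  have "module padic_ring (scalar_module X)"
  proof (rule module_criteria)
    show "\<forall>v\<in>carrier (scalar_module X).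
        \<exists>neg_v\<in>carrier (scalar_module X). v \<oplus>\<^bsub>scalar_module X\<^esub> neg_v = \<zero>\<^bsub>scalar_module X\<^esub>"
    proof
      fix v assume "v \<in> carrier (scalar_module X)"
      thus "\<exists>neg_v\<in>carrier (scalar_module X). v \<oplus>\<^bsub>scalar_module X\<^esub> neg_v = \<zero>\<^bsub>scalar_module X\<^esub>"
        using scale[of v "- 1"] by (intro bexI[of _ "- v"]) (auto simp: scalar_module_def)
    qed
  qed (use X add scale in \<open>auto simp: scalar_module_def algebra_simps intro: class_cring.cring_axioms\<close>)
  moreover have "padic_module_axioms (scalar_module X)"
  proof
    fix x assume x: "x \<in> carrier (scalar_module X)"
    show "x = \<zero>\<^bsub>scalar_module X\<^esub>" if "padic_prime \<odot>\<^bsub>scalar_module X\<^esub> x = \<zero>\<^bsub>scalar_module X\<^esub>"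
    proof -
      have "\<iota> padic_prime * x = 0"
        using that by (simp add: scalar_module_def)
      thus ?thesis
        by (simp add: scalar_module_def)
    qed
    show "x = \<zero>\<^bsub>scalar_module X\<^esub>"
      if "\<And>n. \<exists>y\<in>carrier (scalar_module X). x = padic_prime ^ n \<odot>\<^bsub>scalar_module X\<^esub> y"
    proof -
      have "x / \<iota> padic_prime ^ n \<in> integers emb" for n
      proof -
        obtain y where y: "y \<in> X" "x = \<iota> (padic_prime ^ n) * y"
          using \<open>\<And>n. \<exists>y\<in>carrier (scalar_module X). x = padic_prime ^ n \<odot>\<^bsub>scalar_module X\<^esub> y\<close>[of n]
          by (auto simp: scalar_module_def)
        have "x / \<iota> padic_prime ^ n = y"
          using y(2) by (simp add: zp.hom_power)
        thus ?thesis
          using y(1) X by auto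
      qed
      hence "x = 0"
        by (rule integers_separated)
      thus ?thesis
        by (simp add: scalar_module_def)
    qed
  qed
  ultimately show ?thesis
    by (rule padic_module.intro)
qed

text \<open>This replaces Noetherianity. It is applied to the ring of integers, to obtain a finite
  residue field, and to the intersection of the powers of its maximal ideal.\<close>

lemma finitely_generated:
  assumes X: "X \<subseteq> integers emb" "0 \<in> X"
    and add: "\<And>x y. x \<in> X \<Longrightarrow> y \<in> X \<Longrightarrow> x + y \<in> X"
    and scale: "\<And>a x. x \<in> X \<Longrightarrow> \<iota> a * x \<in> X"
  obtains B where "finite B" "B \<subseteq> X" "X = zspan B (\<lambda>b. b)"
proof -
  interpret padic_module "scalar_module X"
    by (rule padic_module_scalar_module[OF assms])
  have lincomb_eq: "lincomb c B = (\<Sum>b\<in>B. \<iota> (c b) * b)" if "finite B" "B \<subseteq> X" for c B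
    using that
  proof (induction B rule: finite_induct)
    case empty
    show ?case
      unfolding lincomb_def by simp (simp add: scalar_module_def)
  next
    case (insert x B)
    thus ?case
      using lincomb_insert[of B c x] by (simp add: scalar_module_def)
  qed
  obtain N where N: "\<And>(T :: 'k set) (v :: 'k \<Rightarrow> unit \<Rightarrow> 'k). \<lbrakk>finite T; N < card T\<rbrakk> \<Longrightarrow>
      \<exists>c. (\<exists>t\<in>T. c t \<noteq> 0) \<and> (\<forall>s\<in>{()}. (\<Sum>t\<in>T. \<iota> (c t) * v t s) = 0)"
    using bounded_rank[of "{()}"] by blast
  have "lin_dep B" if B: "finite B" "B \<subseteq> carrier (scalar_module X)" "N < card B" for B
  proof -
    obtain c b where c: "b \<in> B" "c b \<noteq> 0" "(\<Sum>t\<in>B. \<iota> (c t) * t) = 0"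
      using N[OF B(1,3), of "\<lambda>t _. t"] by auto
    have "lincomb c B = \<zero>\<^bsub>scalar_module X\<^esub>"
      using lincomb_eq[OF B(1), of c] B(2) c(3) by (simp add: scalar_module_def)
    thus ?thesis
      using lin_dep_crit[OF B(1) subset_refl, of c b] c by simp
  qed
  then obtain B where B: "finite B" "B \<subseteq> carrier (scalar_module X)" "span B = carrier (scalar_module X)"
    using finite_basis_exists by metis
  have "X = span B"
    using B(3) by (simp add: scalar_module_def)
  also have "span B = range (\<lambda>c. lincomb c B)"
    using finite_span[OF B(1,2)] by auto
  also have "\<dots> = zspan B (\<lambda>b. b)"
    using lincomb_eq[OF B(1)] B(2) by (auto simp: zspan_def scalar_module_def)
  finally show thesis
    using that B by (simp add: scalar_module_def)
qed

end

section \<open>Counting cosets\<close>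

text \<open>Representatives turn coset counting into counting elements, both for the residue field
  and for the index of the domain.\<close>

lemma bij_betw_transversal_a_rcosets:
  assumes "abelian_subgroup H G" and S: "S \<subseteq> carrier G"
    and unique: "\<And>x. x \<in> carrier G \<Longrightarrow> \<exists>!s. s \<in> S \<and> (\<exists>h\<in>H. x = h \<oplus>\<^bsub>G\<^esub> s)"
  shows "bij_betw (\<lambda>s. H +>\<^bsub>G\<^esub> s) S (a_rcosets\<^bsub>G\<^esub> H)"
proof -
  interpret abelian_subgroup H G
    by fact
  have coset: "H +>\<^bsub>G\<^esub> x = {h \<oplus>\<^bsub>G\<^esub> x | h. h \<in> H}" for x
    by (auto simp: a_r_coset_def')
  have eq: "H +>\<^bsub>G\<^esub> s = H +>\<^bsub>G\<^esub> x" if "s \<in> S" "h \<in> H" "x = h \<oplus>\<^bsub>G\<^esub> s" for s h x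
    using that S by (intro a_repr_independence') (auto simp: coset)
  show ?thesis
    unfolding bij_betw_def
  proof
    show "inj_on (\<lambda>s. H +>\<^bsub>G\<^esub> s) S"
    proof
      fix s t assume st: "s \<in> S" "t \<in> S" "H +>\<^bsub>G\<^esub> s = H +>\<^bsub>G\<^esub> t"
      have "s \<in> H +>\<^bsub>G\<^esub> t"
        using st(3) a_rcos_self[of s] S st(1) by auto
      hence t: "t \<in> S \<and> (\<exists>h\<in>H. s = h \<oplus>\<^bsub>G\<^esub> t)"
        using st(2) by (auto simp: coset)
      have s: "s \<in> S \<and> (\<exists>h\<in>H. s = h \<oplus>\<^bsub>G\<^esub> s)"
        using S st(1) by (intro conjI bexI[of _ "\<zero>\<^bsub>G\<^esub>"]) auto
      have "\<exists>!y. y \<in> S \<and> (\<exists>h\<in>H. s = h \<oplus>\<^bsub>G\<^esub> y)"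
        using S st(1) by (intro unique) auto
      then obtain r where r: "\<forall>y. y \<in> S \<and> (\<exists>h\<in>H. s = h \<oplus>\<^bsub>G\<^esub> y) \<longrightarrow> y = r"
        by (rule ex1E)
      show "s = t"
        using r[rule_format, OF s] r[rule_format, OF t] by (rule trans[OF _ sym])
    qed
    show "(\<lambda>s. H +>\<^bsub>G\<^esub> s) ` S = a_rcosets\<^bsub>G\<^esub> H"
      unfolding A_RCOSETS_def'
    proof (intro equalityI subsetI)
      fix X assume "X \<in> (\<lambda>s. H +>\<^bsub>G\<^esub> s) ` S"
      thus "X \<in> (\<Union>a\<in>carrier G. {H +>\<^bsub>G\<^esub> a})"
        using S by auto
    next
      fix X assume "X \<in> (\<Union>a\<in>carrier G. {H +>\<^bsub>G\<^esub> a})"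
      then obtain x where x: "x \<in> carrier G" "X = H +>\<^bsub>G\<^esub> x"
        by auto
      then obtain s h where s: "s \<in> S" "h \<in> H" "x = h \<oplus>\<^bsub>G\<^esub> s"
        using unique by blast
      thus "X \<in> (\<lambda>s. H +>\<^bsub>G\<^esub> s) ` S"
        using eq[OF s] x(2) by blast
    qed
  qed
qed

section \<open>Powers of the maximal ideal\<close>

locale padic_uniformizer = finite_padic_extension emb
  for emb :: "'p::prime_card padic \<Rightarrow> 'k::field" +
  fixes \<pi> :: 'k
  assumes uniformizer: "uniformizer emb \<pi>"
begin

lemma mem_max_ideal_iff: "x \<in> max_ideal emb \<longleftrightarrow> x \<in> integers emb \<and> (\<forall>y\<in>integers emb. x * y \<noteq> 1)"
  by (auto simp: max_ideal_def integer_ring_def Units_def mult.commute)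

lemma max_ideal_eq: "max_ideal emb = {x * \<pi> | x. x \<in> integers emb}"
  using uniformizer by (auto simp: uniformizer_def cgenideal_def integer_ring_def)

lemma uniformizer_integral: "\<pi> \<in> integers emb"
  using uniformizer by (auto simp: uniformizer_def integer_ring_def)

lemma prime_mem_max_ideal: "\<iota> padic_prime \<in> max_ideal emb"
  unfolding mem_max_ideal_iff
proof (intro conjI ballI notI)
  fix y assume y: "y \<in> integers emb" "\<iota> padic_prime * y = 1"
  hence "y = 1 / \<iota> padic_prime"
    by (simp add: field_simps)
  thus False
    using y(1) inverse_prime_not_integral by simp
qed (rule \<iota>_integral)

text \<open>The maximal ideal contains the nonzero element p, so its generator is not zero.\<close>

lemma uniformizer_nonzero [simp]: "\<pi> \<noteq> 0"
proof
  assume "\<pi> = 0"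
  hence "\<iota> padic_prime = 0"
    using prime_mem_max_ideal unfolding max_ideal_eq by auto
  thus False
    by simp
qed

lemma inverse_uniformizer_not_integral: "1 / \<pi> \<notin> integers emb"
proof
  assume "1 / \<pi> \<in> integers emb"
  moreover have "\<pi> \<in> max_ideal emb"
    unfolding max_ideal_eq using integral_1 by (intro CollectI exI[of _ 1]) auto
  ultimately show False
    unfolding mem_max_ideal_iff by (metis nonzero_eq_divide_eq mult.commute uniformizer_nonzero)
qed

text \<open>The ideal generated by \<pi>^n. As a divisibility condition in K, it makes
  multiplication and division by powers of \<pi> mere shifts of the exponent, which is all that a
  valuation would be used for.\<close>

definition ideal_power :: "nat \<Rightarrow> 'k set" where
  "ideal_power n = {x. x / \<pi> ^ n \<in> integers emb}"

lemma ideal_power_0 [simp]: "ideal_power 0 = integers emb"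
  by (simp add: ideal_power_def)

lemma ideal_power_eq: "ideal_power n = (*) (\<pi> ^ n) ` integers emb"
proof (intro equalityI subsetI)
  fix x assume "x \<in> ideal_power n"
  thus "x \<in> (*) (\<pi> ^ n) ` integers emb"
    by (intro image_eqI[of _ _ "x / \<pi> ^ n"]) (auto simp: ideal_power_def)
qed (auto simp: ideal_power_def)

lemma max_ideal_eq_ideal_power: "max_ideal emb = ideal_power 1"
  unfolding max_ideal_eq ideal_power_eq by (auto simp: mult.commute)

lemma zero_ideal_power [simp]: "0 \<in> ideal_power n"
  by (simp add: ideal_power_def)

lemma ideal_power_add: "x \<in> ideal_power n \<Longrightarrow> y \<in> ideal_power n \<Longrightarrow> x + y \<in> ideal_power n"
  by (simp add: ideal_power_def add_divide_distrib integral_plus_mult)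

lemma ideal_power_uminus: "x \<in> ideal_power n \<Longrightarrow> - x \<in> ideal_power n"
  by (simp add: ideal_power_def integral_uminus)

lemma ideal_power_uminus_iff [simp]: "- x \<in> ideal_power n \<longleftrightarrow> x \<in> ideal_power n"
  using ideal_power_uminus[of x n] ideal_power_uminus[of "- x" n] by auto

lemma ideal_power_minus: "x \<in> ideal_power n \<Longrightarrow> y \<in> ideal_power n \<Longrightarrow> x - y \<in> ideal_power n"
  by (simp add: ideal_power_def diff_divide_distrib integral_minus)

lemma ideal_power_sum: "(\<And>s. s \<in> S \<Longrightarrow> x s \<in> ideal_power n) \<Longrightarrow> sum x S \<in> ideal_power n"
  by (induction S rule: infinite_finite_induct) (auto intro: ideal_power_add)

lemma ideal_power_mult: "x \<in> ideal_power m \<Longrightarrow> y \<in> ideal_power n \<Longrightarrow> x * y \<in> ideal_power (m + n)"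
  using integral_plus_mult(2)[of "x / \<pi> ^ m" "y / \<pi> ^ n"] by (simp add: ideal_power_def power_add)

lemma ideal_power_integral_mult: "x \<in> integers emb \<Longrightarrow> y \<in> ideal_power n \<Longrightarrow> x * y \<in> ideal_power n"
  using ideal_power_mult[of x 0 y n] by simp

lemma ideal_power_antimono: "m \<le> n \<Longrightarrow> ideal_power n \<subseteq> ideal_power m"
proof
  fix x assume mn: "m \<le> n" and x: "x \<in> ideal_power n"
  have "\<pi> ^ (n - m) * (x / \<pi> ^ n) \<in> integers emb"
    using x by (intro integral_plus_mult integral_power uniformizer_integral) (simp add: ideal_power_def)
  also have "\<pi> ^ (n - m) * (x / \<pi> ^ n) = x / \<pi> ^ m"
    using mn by (simp add: power_diff)
  finally show "x \<in> ideal_power m"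
    by (simp add: ideal_power_def)
qed

lemma ideal_power_integral: "ideal_power n \<subseteq> integers emb"
  using ideal_power_antimono[of 0 n] by simp

lemma uniformizer_power_ideal_power [simp]: "\<pi> ^ n \<in> ideal_power n"
  by (simp add: ideal_power_def)

text \<open>
  The intersection of all powers is finitely generated over $\mathbb{Z}_p$ and stable under
  multiplication by $\pi^{-1}$, so it would make $\pi^{-1}$ integral if it were nonzero.
\<close>

lemma ideal_powers_separated:
  assumes "\<And>n. x \<in> ideal_power n"
  shows "x = 0"
proof (rule ccontr)
  assume x0: "x \<noteq> 0"
  define X where "X = {x. \<forall>n. x \<in> ideal_power n}"
  have "X \<subseteq> integers emb"
    unfolding X_def using ideal_power_0 by blast
  moreover have "0 \<in> X"
    by (simp add: X_def)
  moreover have "x + y \<in> X" if "x \<in> X" "y \<in> X" for x y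
    using that by (simp add: X_def ideal_power_add)
  moreover have "\<iota> a * x \<in> X" if "x \<in> X" for a x
    using that by (simp add: X_def ideal_power_integral_mult \<iota>_integral)
  ultimately obtain B where B: "finite B" "B \<subseteq> X" "X = zspan B (\<lambda>b. b)"
    by (rule finitely_generated)
  have "x \<in> zspan B (\<lambda>b. b)"
    using assms unfolding B(3)[symmetric] by (simp add: X_def)
  then obtain c where "x = (\<Sum>b\<in>B. \<iota> (c b) * b)"
    by (auto simp: zspan_def)
  then obtain b where b: "b \<in> B" "b \<noteq> 0"
    using x0 by (metis (no_types, lifting) mult_zero_right sum.neutral)
  have "1 / \<pi> * y \<in> zspan B (\<lambda>b. b)" if "y \<in> B" for y
  proof -
    have "y \<in> ideal_power (Suc n)" for n
      using that B(2) by (auto simp: X_def)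
    hence "1 / \<pi> * y \<in> ideal_power n" for n
      by (simp add: ideal_power_def)
    thus ?thesis
      unfolding B(3)[symmetric] by (simp add: X_def)
  qed
  hence "1 / \<pi> \<in> integers emb"
    using b by (intro integral_if_mult_zspan[OF B(1), of b "\<lambda>b. b"])
  thus False
    using inverse_uniformizer_not_integral by contradiction
qed

section \<open>Representatives modulo powers of the maximal ideal\<close>

definition transversal :: "nat \<Rightarrow> nat \<Rightarrow> 'k set \<Rightarrow> bool" where
  "transversal m k T \<longleftrightarrow> finite T \<and> T \<subseteq> ideal_power m \<and>
     (\<forall>x\<in>ideal_power m. \<exists>!t. t \<in> T \<and> x - t \<in> ideal_power (m + k))"

lemma transversal_unique:
  "\<lbrakk>transversal m k T; s \<in> T; t \<in> T; s - t \<in> ideal_power (m + k)\<rbrakk> \<Longrightarrow> s = t"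
  unfolding transversal_def by (metis diff_self subsetD zero_ideal_power)

text \<open>A choice of representatives exists for any quotient; the point is finiteness. The
  coordinates modulo p with respect to finitely many generators determine the class of an integer,
  since p lies in the maximal ideal.\<close>

lemma residue_transversal_exists: "\<exists>T. transversal 0 1 T"
proof -
  define f where "f x = (SOME y. y \<in> integers emb \<and> x - y \<in> ideal_power 1)" for x
  have f: "f x \<in> integers emb" "x - f x \<in> ideal_power 1" if "x \<in> integers emb" for x
    using someI[of "\<lambda>y. y \<in> integers emb \<and> x - y \<in> ideal_power 1" x] that by (auto simp: f_def)
  have f_eq: "f x = f y" if "x - y \<in> ideal_power 1" for x y
  proof -
    \<comment> \<open>Congruent elements satisfy the same predicate under \<open>SOME\<close>, so
      \<open>f\<close> is constant on classes.\<close>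
    have "x - z \<in> ideal_power 1 \<longleftrightarrow> y - z \<in> ideal_power 1" for z
      using ideal_power_minus[OF _ that, of "x - z"] ideal_power_add[OF _ that, of "y - z"] by auto
    thus ?thesis
      by (simp add: f_def)
  qed
  define T where "T = f ` integers emb"
  have unique: "t = f x" if tx: "t \<in> T" "x - t \<in> ideal_power 1" for t x
  proof -
    obtain y where y: "y \<in> integers emb" "t = f y"
      using tx(1) by (auto simp: T_def)
    have "x - y \<in> ideal_power 1"
      using ideal_power_minus[OF tx(2) f(2)[OF y(1)]] y(2) by simp
    thus ?thesis
      using f_eq y(2) by simp
  qed
  have ex1: "\<exists>!t. t \<in> T \<and> x - t \<in> ideal_power 1" if x: "x \<in> integers emb" for x
  proof (rule ex1I)
    show "f x \<in> T \<and> x - f x \<in> ideal_power 1"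
      using f(2)[OF x] x by (simp add: T_def)
  qed (use unique in blast)
  obtain B where B: "finite B" "B \<subseteq> integers emb" "integers emb = zspan B (\<lambda>b. b)"
    by (rule finitely_generated[of "integers emb"]) (auto intro: integral_plus_mult \<iota>_integral)
  define c where "c x = (SOME c. x = (\<Sum>b\<in>B. \<iota> (c b) * b))" for x
  have c: "x = (\<Sum>b\<in>B. \<iota> (c x b) * b)" if "x \<in> integers emb" for x
  proof -
    have "\<exists>c. x = (\<Sum>b\<in>B. \<iota> (c b) * b)"
      using that[unfolded B(3) zspan_def] by (elim rangeE exI)
    thus ?thesis
      unfolding c_def by (rule someI_ex)
  qed
  \<comment> \<open>The restriction to \<open>B\<close> places the values in a finite set of
    extensional functions. The coordinates \<open>c\<close> are only chosen, but equality of their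
    residues already yields congruence.\<close>
  define g where "g x = (\<lambda>b\<in>B. residue (c x b) 1)" for x
  have T: "T \<subseteq> integers emb"
    using f by (auto simp: T_def)
  have inj: "inj_on g T"
  proof
    fix s t assume st: "s \<in> T" "t \<in> T" "g s = g t"
    have "padic_prime dvd c s b - c t b" if b: "b \<in> B" for b
      using fun_cong[OF st(3), of b] b by (simp add: g_def prime_dvd_iff_residue residue_diff)
    hence "\<forall>b\<in>B. \<exists>d. c s b - c t b = padic_prime * d"
      by (auto simp: dvd_def)
    then obtain d where d: "\<And>b. b \<in> B \<Longrightarrow> c s b - c t b = padic_prime * d b"
      by metis
    have "s - t = (\<Sum>b\<in>B. \<iota> (c s b - c t b) * b)"
      using c[of s] c[of t] T st(1,2) by (simp add: sum_subtractf left_diff_distrib subset_iff)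
    also have "\<dots> = (\<Sum>b\<in>B. \<iota> padic_prime * (\<iota> (d b) * b))"
      using d by (intro sum.cong refl) (simp del: zp.hom_minus)
    also have "\<dots> \<in> ideal_power 1"
    proof (intro ideal_power_sum)
      fix b assume b: "b \<in> B"
      have "\<iota> (d b) * b \<in> ideal_power 0"
        using b B(2) by (auto intro: integral_plus_mult \<iota>_integral)
      thus "\<iota> padic_prime * (\<iota> (d b) * b) \<in> ideal_power 1"
        using prime_mem_max_ideal ideal_power_mult[of "\<iota> padic_prime" 1 _ 0]
        by (simp add: max_ideal_eq_ideal_power)
    qed
    finally show "s = t"
      using unique[OF st(2)] unique[OF st(1), of s] by simp
  qed
  have "0 \<le> residue z 1 \<and> residue z 1 < int CARD('p)" for z :: "'p padic_int"
  proof -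
    have "\<forall>n. 0 \<le> residue z n \<and> residue z n < int CARD('p) ^ n"
      using residue[of z] by simp
    from spec[OF this, of 1] show ?thesis
      by simp
  qed
  hence "g ` T \<subseteq> PiE B (\<lambda>_. {0..<int CARD('p)})"
    by (auto simp: g_def)
  hence "finite (g ` T)"
    by (rule finite_subset) (simp add: finite_PiE B(1))
  hence "finite T"
    using inj by (rule finite_imageD)
  hence "transversal 0 1 T"
    using T ex1 by (simp add: transversal_def)
  thus ?thesis ..
qed

text \<open>The carrier of the quotient ring consists of the cosets of \<open>ideal_power 1\<close>,
  which the representatives parametrize.\<close>

lemma card_residue_transversal:
  assumes T: "transversal 0 1 T"
  shows "card T = card (carrier (residue_field emb))"
proof -
  let ?R = "integer_ring emb"
  have "abelian_group ?R"
  proof (rule abelian_groupI)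
    fix x assume "x \<in> carrier ?R"
    thus "\<exists>y\<in>carrier ?R. y \<oplus>\<^bsub>?R\<^esub> x = \<zero>\<^bsub>?R\<^esub>"
      by (intro bexI[of _ "- x"]) (auto simp: integer_ring_def integral_uminus)
  qed (auto simp: integer_ring_def integral_plus_mult)
  then interpret abelian_group ?R .
  have inv: "\<ominus>\<^bsub>?R\<^esub> x = - x" if "x \<in> integers emb" for x
    using that by (intro minus_equality) (auto simp: integer_ring_def integral_uminus)
  have "additive_subgroup (ideal_power 1) ?R"
  proof (unfold_locales)
    show "ideal_power 1 \<subseteq> carrier (add_monoid ?R)"
      using ideal_power_integral by (auto simp: integer_ring_def)
    fix x assume x: "x \<in> ideal_power 1"
    hence "inv\<^bsub>add_monoid ?R\<^esub> x = - x"
      using inv[of x] ideal_power_integral by (auto simp: a_inv_def)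
    thus "inv\<^bsub>add_monoid ?R\<^esub> x \<in> ideal_power 1"
      using x by simp
  qed (auto simp: integer_ring_def ideal_power_add)
  hence sub: "abelian_subgroup (ideal_power 1) ?R"
    by (intro abelian_subgroupI3 abelian_group_axioms)
  have "bij_betw (\<lambda>s. ideal_power 1 +>\<^bsub>?R\<^esub> s) T (a_rcosets\<^bsub>?R\<^esub> ideal_power 1)"
  proof (rule bij_betw_transversal_a_rcosets[OF sub])
    fix x assume x: "x \<in> carrier ?R"
    have "(\<exists>h\<in>ideal_power 1. x = h \<oplus>\<^bsub>?R\<^esub> s) \<longleftrightarrow> x - s \<in> ideal_power 1" for s
      by (auto simp: integer_ring_def intro: bexI[of _ "x - s"])
    thus "\<exists>!s. s \<in> T \<and> (\<exists>h\<in>ideal_power 1. x = h \<oplus>\<^bsub>?R\<^esub> s)"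
      using T x by (simp add: transversal_def integer_ring_def)
  qed (use T in \<open>auto simp: transversal_def integer_ring_def\<close>)
  thus ?thesis
    by (simp add: residue_field_def FactRing_def max_ideal_eq_ideal_power bij_betw_same_card)
qed

text \<open>Digit expansion: modulo \<pi>^(k+1) an integer is t + \<pi> u, with a lowest digit t and
  a representative u modulo \<pi>^k.\<close>

lemma transversal_Suc:
  assumes T: "transversal 0 1 T" and U: "transversal 0 k U"
  shows "\<exists>V. transversal 0 (Suc k) V \<and> card V = card T * card U"
proof -
  define f where "f = (\<lambda>(t, u). t + \<pi> * u)"
  have TR: "T \<subseteq> integers emb" and UR: "U \<subseteq> integers emb"
    using T U by (auto simp: transversal_def)
  have shift: "\<pi> * x \<in> ideal_power (Suc j) \<longleftrightarrow> x \<in> ideal_power j" for x j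
    by (simp add: ideal_power_def)
  \<comment> \<open>Here \<open>u\<close> and \<open>u'\<close> range over all integers, not only
    over \<open>U\<close>, because uniqueness later compares the quotient \<open>y\<close> with a
    representative. The lowest digit is settled modulo \<pi>, after which \<pi> cancels.\<close>
  have step: "t = t' \<and> u - u' \<in> ideal_power k"
    if "t \<in> T" "t' \<in> T" "u \<in> integers emb" "u' \<in> integers emb"
      "(t + \<pi> * u) - (t' + \<pi> * u') \<in> ideal_power (Suc k)" for t t' u u'
  proof -
    have "(t + \<pi> * u) - (t' + \<pi> * u') \<in> ideal_power 1"
      using that(5) ideal_power_antimono[of 1 "Suc k"] by auto
    moreover have "\<pi> * (u - u') \<in> ideal_power 1"
      using shift[of "u - u'" 0] that integral_minus by simp
    ultimately have "t - t' \<in> ideal_power 1"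
      using ideal_power_minus[of "(t + \<pi> * u) - (t' + \<pi> * u')" 1 "\<pi> * (u - u')"]
      by (simp add: algebra_simps)
    hence "t = t'"
      using transversal_unique[OF T] that by simp
    thus ?thesis
      using that(5) shift[of "u - u'" k] by (simp add: right_diff_distrib)
  qed
  have inj: "inj_on f (T \<times> U)"
  proof
    fix x y assume xy: "x \<in> T \<times> U" "y \<in> T \<times> U" "f x = f y"
    obtain t u t' u' where tu: "x = (t, u)" "y = (t', u')"
      by (cases x, cases y)
    have "t = t' \<and> u - u' \<in> ideal_power k"
      using xy UR by (intro step) (auto simp: tu f_def)
    thus "x = y"
      using transversal_unique[OF U, of u u'] xy by (simp add: tu)
  qed
  have "transversal 0 (Suc k) (f ` (T \<times> U))"
    unfolding transversal_def
  proof (intro conjI ballI)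
    show "finite (f ` (T \<times> U))"
      using T U by (simp add: transversal_def)
    show "f ` (T \<times> U) \<subseteq> ideal_power 0"
      using TR UR uniformizer_integral by (auto simp: f_def intro!: integral_plus_mult)
    fix x assume x: "x \<in> ideal_power 0"
    then obtain t where t: "t \<in> T" "x - t \<in> ideal_power 1"
      using T by (auto simp: transversal_def)
    define y where "y = (x - t) / \<pi>"
    have y: "y \<in> ideal_power 0" "x = t + \<pi> * y"
      using t(2) by (auto simp: y_def ideal_power_def)
    then obtain u where u: "u \<in> U" "y - u \<in> ideal_power k"
      using U by (auto simp: transversal_def)
    show "\<exists>!v. v \<in> f ` (T \<times> U) \<and> x - v \<in> ideal_power (0 + Suc k)"
    proof (rule ex1I[of _ "f (t, u)"])
      have "x - f (t, u) = \<pi> * (y - u)"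
        using y by (simp add: f_def algebra_simps)
      thus "f (t, u) \<in> f ` (T \<times> U) \<and> x - f (t, u) \<in> ideal_power (0 + Suc k)"
        using t u shift by auto
      fix v assume "v \<in> f ` (T \<times> U) \<and> x - v \<in> ideal_power (0 + Suc k)"
      then obtain t' u' where v: "v = t' + \<pi> * u'" "t' \<in> T" "u' \<in> U" "x - v \<in> ideal_power (Suc k)"
        by (auto simp: f_def)
      have eq: "t = t' \<and> y - u' \<in> ideal_power k"
        using v t y UR by (intro step) auto
      hence "u - u' \<in> ideal_power k"
        using ideal_power_minus[of "y - u'" k "y - u"] u(2) by simp
      hence "u = u'"
        using transversal_unique[OF U, of u u'] u v by simp
      thus "v = f (t, u)"
        using v eq by (simp add: f_def)
    qed
  qed
  moreover have "card (f ` (T \<times> U)) = card T * card U"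
    using inj by (simp add: card_image card_cartesian_product)
  ultimately show ?thesis
    by blast
qed

text \<open>Representatives modulo \<pi>^k come from k digits; multiplying them by \<pi>^m moves
  them to the ideal of exponent m without changing their number.\<close>

lemma transversal_exists:
  "\<exists>T. transversal m k T \<and> card T = card (carrier (residue_field emb)) ^ k"
proof -
  obtain T where T: "transversal 0 1 T"
    using residue_transversal_exists by blast
  have "\<exists>U. transversal 0 k U \<and> card U = card T ^ k"
  proof (induction k)
    case 0
    show ?case
      by (intro exI[of _ "{0}"]) (auto simp: transversal_def)
  next
    case (Suc k)
    then obtain U where U: "transversal 0 k U" "card U = card T ^ k"
      by blast
    show ?case
      using transversal_Suc[OF T U(1)] U(2) by auto
  qed
  then obtain U where U: "transversal 0 k U" "card U = card T ^ k"
    by blast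
  have "transversal m k ((*) (\<pi> ^ m) ` U)"
    unfolding transversal_def
  proof (intro conjI ballI)
    show "finite ((*) (\<pi> ^ m) ` U)"
      using U by (simp add: transversal_def)
    show "(*) (\<pi> ^ m) ` U \<subseteq> ideal_power m"
      using U by (auto simp: transversal_def ideal_power_eq)
    fix x assume "x \<in> ideal_power m"
    then obtain y where y: "y \<in> integers emb" "x = \<pi> ^ m * y"
      by (auto simp: ideal_power_eq)
    have shift: "\<pi> ^ m * y - \<pi> ^ m * u \<in> ideal_power (m + k) \<longleftrightarrow> y - u \<in> ideal_power (0 + k)" for u
      by (simp add: ideal_power_def power_add right_diff_distrib[symmetric])
    have ex1: "\<exists>!u. u \<in> U \<and> y - u \<in> ideal_power (0 + k)"
      using U(1) y(1) by (simp add: transversal_def)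
    show "\<exists>!t. t \<in> (*) (\<pi> ^ m) ` U \<and> x - t \<in> ideal_power (m + k)"
      unfolding y(2) using ex1 shift by (smt (verit, best) imageE image_eqI)
  qed
  moreover have "card ((*) (\<pi> ^ m) ` U) = card U"
    by (intro card_image inj_onI) simp
  ultimately show ?thesis
    using U(2) card_residue_transversal[OF T] by auto
qed

end

section \<open>Lie lattices of matrices\<close>

lemma index_mult_mat_sum:
  assumes "x \<in> carrier_mat n n" "y \<in> carrier_mat n n" "i < n" "j < n"
  shows "(x * y) $$ (i, j) = (\<Sum>r<n. x $$ (i, r) * y $$ (r, j))"
  using assms by (auto simp: scalar_prod_def lessThan_atLeast0 intro!: sum.cong)

text \<open>Each double bracket expands into four triple products, and the twelve terms cancel in
  pairs. The entries of the products stay unexpanded, so this is a cancellation of atoms.\<close>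

lemma commutator_jacobi:
  fixes x y z :: "'a::comm_ring_1 mat"
  assumes xyz: "x \<in> carrier_mat n n" "y \<in> carrier_mat n n" "z \<in> carrier_mat n n"
  shows "x * (y * z - z * y) - (y * z - z * y) * x + (y * (z * x - x * z) - (z * x - x * z) * y) +
    (z * (x * y - y * x) - (x * y - y * x) * z) = 0\<^sub>m n n"
proof -
  have expand: "u * (v * w - w * v) - (v * w - w * v) * u =
      u * (v * w) - u * (w * v) - (v * (w * u) - w * (v * u))"
    if "u \<in> carrier_mat n n" "v \<in> carrier_mat n n" "w \<in> carrier_mat n n" for u v w :: "'a mat"
    using that by (simp add: mult_minus_distrib_mat[of _ n n _ n] minus_mult_distrib_mat[of _ n n _ _ n]
        assoc_mult_mat[of _ n n _ n _ n])
  show ?thesis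
    unfolding expand[OF xyz] expand[OF xyz(2,3,1)] expand[OF xyz(3,1,2)]
    by (rule eq_matI) (use xyz in \<open>simp_all del: index_mult_mat(1)\<close>)
qed

context padic_uniformizer
begin

abbreviation matrix_module :: "nat \<Rightarrow> 'k mat set \<Rightarrow> ('p padic_int, 'k mat) module" where
  "matrix_module \<equiv> commutator_lie emb"

lemma matrix_module_simps:
  "carrier (matrix_module n X) = X"
  "x \<otimes>\<^bsub>matrix_module n X\<^esub> y = x * y - y * x"
  "\<zero>\<^bsub>matrix_module n X\<^esub> = 0\<^sub>m n n"
  "x \<oplus>\<^bsub>matrix_module n X\<^esub> y = x + y"
  "c \<odot>\<^bsub>matrix_module n X\<^esub> x = \<iota> c \<cdot>\<^sub>m x"
  by (simp_all add: commutator_lie_def \<iota>_def)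

lemma matrix_module_restrict: "(matrix_module n X)\<lparr>carrier := Y\<rparr> = matrix_module n Y"
  by (simp add: commutator_lie_def)

lemma module_matrix_module:
  assumes X: "X \<subseteq> carrier_mat n n" "0\<^sub>m n n \<in> X"
    and add: "\<And>x y. x \<in> X \<Longrightarrow> y \<in> X \<Longrightarrow> x + y \<in> X"
    and scale: "\<And>a x. x \<in> X \<Longrightarrow> \<iota> a \<cdot>\<^sub>m x \<in> X"
  shows "module padic_ring (matrix_module n X)"
proof (rule module_criteria)
  have dim: "x \<in> carrier_mat n n" if "x \<in> X" for x
    using X(1) that by blast
  show "\<forall>v\<in>carrier (matrix_module n X).
      \<exists>neg_v\<in>carrier (matrix_module n X). v \<oplus>\<^bsub>matrix_module n X\<^esub> neg_v = \<zero>\<^bsub>matrix_module n X\<^esub>"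
  proof
    fix v assume v: "v \<in> carrier (matrix_module n X)"
    have "v + \<iota> (- 1) \<cdot>\<^sub>m v = 0\<^sub>m n n"
      by (rule eq_matI) (use dim[of v] v in \<open>auto simp: matrix_module_simps\<close>)
    thus "\<exists>neg_v\<in>carrier (matrix_module n X).
        v \<oplus>\<^bsub>matrix_module n X\<^esub> neg_v = \<zero>\<^bsub>matrix_module n X\<^esub>"
      unfolding matrix_module_simps using scale v matrix_module_simps(1) by blast
  qed
  show "\<forall>v w. v \<in> carrier (matrix_module n X) \<and> w \<in> carrier (matrix_module n X) \<longrightarrow>
      v \<oplus>\<^bsub>matrix_module n X\<^esub> w = w \<oplus>\<^bsub>matrix_module n X\<^esub> v"
    unfolding matrix_module_simps using dim comm_add_mat by blast
  show "\<forall>v w x. v \<in> carrier (matrix_module n X) \<and> w \<in> carrier (matrix_module n X) \<and>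
      x \<in> carrier (matrix_module n X) \<longrightarrow>
      v \<oplus>\<^bsub>matrix_module n X\<^esub> w \<oplus>\<^bsub>matrix_module n X\<^esub> x =
      v \<oplus>\<^bsub>matrix_module n X\<^esub> (w \<oplus>\<^bsub>matrix_module n X\<^esub> x)"
    unfolding matrix_module_simps using dim assoc_add_mat by blast
  show "\<forall>v\<in>carrier (matrix_module n X). v \<oplus>\<^bsub>matrix_module n X\<^esub> \<zero>\<^bsub>matrix_module n X\<^esub> = v"
    unfolding matrix_module_simps using dim by auto
  show "\<forall>a b v. a \<in> carrier padic_ring \<and> b \<in> carrier padic_ring \<and> v \<in> carrier (matrix_module n X) \<longrightarrow>
      (a \<otimes>\<^bsub>padic_ring\<^esub> b) \<odot>\<^bsub>matrix_module n X\<^esub> v =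
      a \<odot>\<^bsub>matrix_module n X\<^esub> (b \<odot>\<^bsub>matrix_module n X\<^esub> v)"
    unfolding matrix_module_simps by (auto intro!: eq_matI simp: mult.assoc)
  show "\<forall>v\<in>carrier (matrix_module n X). \<one>\<^bsub>padic_ring\<^esub> \<odot>\<^bsub>matrix_module n X\<^esub> v = v"
    unfolding matrix_module_simps by auto
  show "\<forall>a b v. a \<in> carrier padic_ring \<and> b \<in> carrier padic_ring \<and> v \<in> carrier (matrix_module n X) \<longrightarrow>
      (a \<oplus>\<^bsub>padic_ring\<^esub> b) \<odot>\<^bsub>matrix_module n X\<^esub> v =
      a \<odot>\<^bsub>matrix_module n X\<^esub> v \<oplus>\<^bsub>matrix_module n X\<^esub> b \<odot>\<^bsub>matrix_module n X\<^esub> v"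
    unfolding matrix_module_simps by (auto intro!: eq_matI simp: distrib_right)
  show "\<forall>a v w. a \<in> carrier padic_ring \<and> v \<in> carrier (matrix_module n X) \<and>
      w \<in> carrier (matrix_module n X) \<longrightarrow>
      a \<odot>\<^bsub>matrix_module n X\<^esub> (v \<oplus>\<^bsub>matrix_module n X\<^esub> w) =
      a \<odot>\<^bsub>matrix_module n X\<^esub> v \<oplus>\<^bsub>matrix_module n X\<^esub> a \<odot>\<^bsub>matrix_module n X\<^esub> w"
    unfolding matrix_module_simps by (simp add: add_smult_distrib_left_mat[OF dim dim])
qed (use X add scale in \<open>auto simp: matrix_module_simps intro: class_cring.cring_axioms\<close>)

lemma lie_algebra_matrix_module:
  assumes X: "X \<subseteq> carrier_mat n n" "0\<^sub>m n n \<in> X"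
    and add: "\<And>x y. x \<in> X \<Longrightarrow> y \<in> X \<Longrightarrow> x + y \<in> X"
    and scale: "\<And>a x. x \<in> X \<Longrightarrow> \<iota> a \<cdot>\<^sub>m x \<in> X"
    and bracket: "\<And>x y. x \<in> X \<Longrightarrow> y \<in> X \<Longrightarrow> x * y - y * x \<in> X"
  shows "lie_algebra padic_ring (matrix_module n X)"
proof (rule lie_algebra.intro[OF module_matrix_module[OF assms(1-4)]], unfold_locales,
    unfold matrix_module_simps)
  have dim: "x \<in> carrier_mat n n" if "x \<in> X" for x
    using X(1) that by blast
  fix x y z assume x: "x \<in> X"
  show "x * x - x * x = 0\<^sub>m n n"
    using dim[OF x] by (intro eq_matI) auto
  assume y: "y \<in> X"
  show "x * y - y * x \<in> X"
    by (rule bracket[OF x y])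
  show "(\<iota> a \<cdot>\<^sub>m x) * y - y * (\<iota> a \<cdot>\<^sub>m x) = \<iota> a \<cdot>\<^sub>m (x * y - y * x)" for a
    using dim[OF x] dim[OF y]
    by (simp add: mult_smult_assoc_mat[of _ n n] mult_smult_distrib[of _ n n])
      (intro eq_matI, auto simp: right_diff_distrib)
  show "x * (\<iota> a \<cdot>\<^sub>m y) - (\<iota> a \<cdot>\<^sub>m y) * x = \<iota> a \<cdot>\<^sub>m (x * y - y * x)" for a
    using dim[OF x] dim[OF y]
    by (simp add: mult_smult_assoc_mat[of _ n n] mult_smult_distrib[of _ n n])
      (intro eq_matI, auto simp: right_diff_distrib)
  assume z: "z \<in> X"
  show "(x + y) * z - z * (x + y) = x * z - z * x + (y * z - z * y)"
    using dim[OF x] dim[OF y] dim[OF z]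
    by (simp add: add_mult_distrib_mat[of _ n n] mult_add_distrib_mat[of _ n n])
      (intro eq_matI, auto)
  show "x * (y + z) - (y + z) * x = x * y - y * x + (x * z - z * x)"
    using dim[OF x] dim[OF y] dim[OF z]
    by (simp add: add_mult_distrib_mat[of _ n n] mult_add_distrib_mat[of _ n n])
      (intro eq_matI, auto)
  show "x * (y * z - z * y) - (y * z - z * y) * x + (y * (z * x - x * z) - (z * x - x * z) * y) +
      (z * (x * y - y * x) - (x * y - y * x) * z) = 0\<^sub>m n n"
    by (rule commutator_jacobi[OF dim[OF x] dim[OF y] dim[OF z]])
qed

lemma padic_module_matrix_module:
  assumes X: "X \<subseteq> carrier_mat n n" "0\<^sub>m n n \<in> X"
    and add: "\<And>x y. x \<in> X \<Longrightarrow> y \<in> X \<Longrightarrow> x + y \<in> X"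
    and scale: "\<And>a x. x \<in> X \<Longrightarrow> \<iota> a \<cdot>\<^sub>m x \<in> X"
    and integral: "\<And>x i j. \<lbrakk>x \<in> X; i < n; j < n\<rbrakk> \<Longrightarrow> x $$ (i, j) \<in> integers emb"
  shows "padic_module (matrix_module n X)"
proof (intro padic_module.intro module_matrix_module[OF assms(1-4)], unfold_locales,
    unfold matrix_module_simps)
  fix x assume x: "x \<in> X"
  have dim: "x \<in> carrier_mat n n" if "x \<in> X" for x
    using X(1) that by blast
  show "x = 0\<^sub>m n n" if zero: "\<iota> padic_prime \<cdot>\<^sub>m x = 0\<^sub>m n n"
  proof (rule eq_matI)
    fix i j assume ij: "i < dim_row (0\<^sub>m n n :: 'k mat)" "j < dim_col (0\<^sub>m n n :: 'k mat)"
    have "(\<iota> padic_prime \<cdot>\<^sub>m x) $$ (i, j) = 0"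
      using ij by (simp add: zero)
    thus "x $$ (i, j) = 0\<^sub>m n n $$ (i, j)"
      using dim[OF x] ij by simp
  qed (use dim[OF x] in auto)
  show "x = 0\<^sub>m n n" if div: "\<And>k. \<exists>y\<in>X. x = \<iota> (padic_prime ^ k) \<cdot>\<^sub>m y"
  proof (rule eq_matI)
    fix i j assume ij: "i < dim_row (0\<^sub>m n n :: 'k mat)" "j < dim_col (0\<^sub>m n n :: 'k mat)"
    have "x $$ (i, j) / \<iota> padic_prime ^ k \<in> integers emb" for k
    proof -
      obtain y where y: "y \<in> X" "x = \<iota> (padic_prime ^ k) \<cdot>\<^sub>m y"
        using div by blast
      thus ?thesis
        using integral[OF y(1), of i j] dim[OF y(1)] ij by simp
    qed
    thus "x $$ (i, j) = 0\<^sub>m n n $$ (i, j)"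
      using integers_separated ij by simp
  qed (use dim[OF x] in auto)
qed

text \<open>A set of matrices is a set of vectors indexed by the pairs of row and column indices, so
  the rank bound over K applies and yields a finite basis. The Lie axioms are inherited from the
  matrix algebra.\<close>

lemma lie_lattice_matrix_module:
  assumes X: "X \<subseteq> carrier_mat n n" "0\<^sub>m n n \<in> X"
    and add: "\<And>x y. x \<in> X \<Longrightarrow> y \<in> X \<Longrightarrow> x + y \<in> X"
    and scale: "\<And>a x. x \<in> X \<Longrightarrow> \<iota> a \<cdot>\<^sub>m x \<in> X"
    and bracket: "\<And>x y. x \<in> X \<Longrightarrow> y \<in> X \<Longrightarrow> x * y - y * x \<in> X"
    and integral: "\<And>x i j. \<lbrakk>x \<in> X; i < n; j < n\<rbrakk> \<Longrightarrow> x $$ (i, j) \<in> integers emb"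
  shows "lie_lattice padic_ring (matrix_module n X)"
proof -
  interpret padic_module "matrix_module n X"
    by (rule padic_module_matrix_module[OF assms(1-4) integral])
  have lincomb_index: "lincomb c B \<in> carrier_mat n n \<and>
      (\<forall>i<n. \<forall>j<n. lincomb c B $$ (i, j) = (\<Sum>b\<in>B. \<iota> (c b) * b $$ (i, j)))"
    if "finite B" "B \<subseteq> X" for c B
    using that
  proof (induction B rule: finite_induct)
    case empty
    have "lincomb c {} = 0\<^sub>m n n"
      unfolding lincomb_def by simp (simp add: matrix_module_simps)
    thus ?case
      by simp
  next
    case (insert x B)
    have "lincomb c (insert x B) = \<iota> (c x) \<cdot>\<^sub>m x + lincomb c B"
      using lincomb_insert[of B c x] insert by (simp add: matrix_module_simps)
    moreover have "x \<in> carrier_mat n n"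
      using insert.prems X(1) by auto
    moreover have "dim_row (lincomb c B) = n" "dim_col (lincomb c B) = n"
      using insert by auto
    ultimately show ?case
      using insert by simp
  qed
  obtain N where N: "\<And>(T :: 'k mat set) (v :: 'k mat \<Rightarrow> nat \<times> nat \<Rightarrow> 'k). \<lbrakk>finite T; N < card T\<rbrakk> \<Longrightarrow>
      \<exists>c. (\<exists>t\<in>T. c t \<noteq> 0) \<and> (\<forall>s\<in>{..<n} \<times> {..<n}. (\<Sum>t\<in>T. \<iota> (c t) * v t s) = 0)"
    using bounded_rank[of "{..<n} \<times> {..<n}"] by blast
  have "lin_dep B" if B: "finite B" "B \<subseteq> carrier (matrix_module n X)" "N < card B" for B
  proof -
    obtain c b where c: "b \<in> B" "c b \<noteq> 0"
      and zero: "\<And>i j. i < n \<Longrightarrow> j < n \<Longrightarrow> (\<Sum>t\<in>B. \<iota> (c t) * t $$ (i, j)) = 0"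
      using N[OF B(1,3), of "\<lambda>t s. t $$ s"] by auto
    have "lincomb c B = \<zero>\<^bsub>matrix_module n X\<^esub>"
      unfolding matrix_module_simps
      by (rule eq_matI) (use lincomb_index[OF B(1), of c] B(2) zero in \<open>auto simp: matrix_module_simps\<close>)
    thus ?thesis
      using lin_dep_crit[OF B(1) subset_refl, of c b] c by simp
  qed
  then obtain B where "finite B" "B \<subseteq> carrier (matrix_module n X)" "\<not> lin_dep B"
      "span B = carrier (matrix_module n X)"
    using finite_basis_exists by metis
  thus ?thesis
    unfolding lie_lattice_def using lie_algebra_matrix_module[OF assms(1-5)] by blast
qed

end

section \<open>Graded Lie algebras of matrices\<close>

text \<open>
  A Lie algebra \<open>g\<close> of matrices over \<open>K\<close> that is stable under conjugation by the diagonal matrices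
  with entries $c^{w_i}$, so that it is graded by the differences of the weights \<open>w\<close>. The part of
  negative degree consists, up to signs, of copies of the entries of the row \<open>a\<close> in the columns
  \<open>P\<close>, which are arbitrary.
\<close>

locale graded_matrices = padic_uniformizer emb \<pi>
  for emb :: "'p::prime_card padic \<Rightarrow> 'k::field" and \<pi> :: 'k +
  fixes n :: nat and g :: "'k mat set" and a :: nat and w :: "nat \<Rightarrow> nat" and P :: "nat set"
  assumes g_dim: "g \<subseteq> carrier_mat n n"
    and g_zero: "0\<^sub>m n n \<in> g"
    and g_add: "\<lbrakk>x \<in> g; y \<in> g\<rbrakk> \<Longrightarrow> x + y \<in> g"
    and g_smult: "x \<in> g \<Longrightarrow> c \<cdot>\<^sub>m x \<in> g"
    and g_bracket: "\<lbrakk>x \<in> g; y \<in> g\<rbrakk> \<Longrightarrow> x * y - y * x \<in> g"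
    and g_conj: "\<lbrakk>x \<in> g; c \<noteq> 0\<rbrakk> \<Longrightarrow> mat n n (\<lambda>(i, j). c ^ w i * x $$ (i, j) / c ^ w j) \<in> g"
    and a_less: "a < n"
    and weight_a: "w a = 0"
    and weight_pos: "\<lbrakk>j < n; j \<noteq> a\<rbrakk> \<Longrightarrow> 0 < w j"
    and P_subset: "P \<subseteq> {..<n} - {a}"
    and free: "\<exists>x\<in>g. (\<forall>j<n. x $$ (a, j) = (if j \<in> P then d j else 0)) \<and>
      (\<forall>i<n. \<forall>j<n. x $$ (i, j) = 0 \<or> (\<exists>k\<in>P. x $$ (i, j) = d k \<or> x $$ (i, j) = - d k))"
    and determined: "\<lbrakk>x \<in> g; i < n; j < n; w i < w j\<rbrakk> \<Longrightarrow>
      x $$ (i, j) = 0 \<or> (\<exists>k\<in>P. w i + w k = w j \<and>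
        (x $$ (i, j) = x $$ (a, k) \<or> x $$ (i, j) = - x $$ (a, k)))"
    and rigid_corner: "\<lbrakk>x \<in> g; \<And>j. \<lbrakk>j < n; j \<noteq> a\<rbrakk> \<Longrightarrow> x $$ (a, j) = 0;
      \<And>b k. \<lbrakk>b \<in> P; k < n; k \<noteq> a\<rbrakk> \<Longrightarrow> x $$ (b, k) = (if k = b then x $$ (a, a) else 0)\<rbrakk> \<Longrightarrow>
      x $$ (a, a) = 0"
    and rigid: "\<lbrakk>x \<in> g; \<And>j. j < n \<Longrightarrow> x $$ (a, j) = 0;
      \<And>b k. \<lbrakk>b \<in> P; k < n\<rbrakk> \<Longrightarrow> x $$ (b, k) = 0\<rbrakk> \<Longrightarrow> x = 0\<^sub>m n n"
begin

lemma g_carrier [simp]: "x \<in> g \<Longrightarrow> x \<in> carrier_mat n n"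
  using g_dim by blast

lemma g_dims [simp]: "x \<in> g \<Longrightarrow> dim_row x = n" "x \<in> g \<Longrightarrow> dim_col x = n"
  using g_carrier[THEN carrier_matD(1)] g_carrier[THEN carrier_matD(2)] by auto

lemma finite_P: "finite P"
  using P_subset by (rule finite_subset) simp

lemma P_less: "k \<in> P \<Longrightarrow> k < n"
  using P_subset by auto

lemma g_minus:
  assumes "x \<in> g" "y \<in> g"
  shows "x - y \<in> g"
proof -
  have "x - y = x + (- 1) \<cdot>\<^sub>m y"
    by (rule eq_matI) (use assms in auto)
  thus ?thesis
    using g_add g_smult assms by simp
qed

definition lattice :: "nat \<Rightarrow> 'k mat set" where
  "lattice m = {x \<in> g. \<forall>i<n. \<forall>j<n. x $$ (i, j) \<in> ideal_power m}"

lemma lattice_g: "x \<in> lattice m \<Longrightarrow> x \<in> g"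
  by (simp add: lattice_def)

lemma lattice_index: "\<lbrakk>x \<in> lattice m; i < n; j < n\<rbrakk> \<Longrightarrow> x $$ (i, j) \<in> ideal_power m"
  by (simp add: lattice_def)

lemma lattice_zero: "0\<^sub>m n n \<in> lattice m"
  using g_zero by (simp add: lattice_def)

lemma lattice_add: "\<lbrakk>x \<in> lattice m; y \<in> lattice m\<rbrakk> \<Longrightarrow> x + y \<in> lattice m"
  by (simp add: lattice_def g_add ideal_power_add)

lemma lattice_minus: "\<lbrakk>x \<in> lattice m; y \<in> lattice m\<rbrakk> \<Longrightarrow> x - y \<in> lattice m"
  by (simp add: lattice_def g_minus ideal_power_minus)

lemma lattice_scale: "x \<in> lattice m \<Longrightarrow> \<iota> c \<cdot>\<^sub>m x \<in> lattice m"
  by (simp add: lattice_def g_smult ideal_power_integral_mult \<iota>_integral)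

lemma lattice_bracket:
  assumes x: "x \<in> lattice m" and y: "y \<in> lattice m"
  shows "x * y - y * x \<in> lattice m"
proof -
  have prod: "(u * v) $$ (i, j) \<in> ideal_power m"
    if uv: "u \<in> lattice m" "v \<in> lattice m" and ij: "i < n" "j < n" for u v i j
  proof -
    have entry: "u $$ (i, r) * v $$ (r, j) \<in> ideal_power m" if "r < n" for r
      using lattice_index[OF uv(1) ij(1) that] lattice_index[OF uv(2) that ij(2)] ideal_power_integral
      by (intro ideal_power_integral_mult) auto
    have "(u * v) $$ (i, j) = (\<Sum>r<n. u $$ (i, r) * v $$ (r, j))"
      using uv ij lattice_g by (intro index_mult_mat_sum) auto
    also have "\<dots> \<in> ideal_power m"
      using entry by (intro ideal_power_sum) simp
    finally show ?thesis .
  qed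
  have "(x * y - y * x) $$ (i, j) \<in> ideal_power m" if "i < n" "j < n" for i j
    using prod[OF x y that] prod[OF y x that] lattice_g[OF x] lattice_g[OF y] that
    by (simp add: ideal_power_minus del: index_mult_mat(1))
  thus ?thesis
    using lattice_g[OF x] lattice_g[OF y] by (simp add: lattice_def g_bracket)
qed

lemma lie_lattice_lattice: "lie_lattice padic_ring (matrix_module n (lattice m))"
proof (rule lie_lattice_matrix_module)
  show "x $$ (i, j) \<in> integers emb" if "x \<in> lattice m" "i < n" "j < n" for x i j
    using lattice_index[OF that] ideal_power_integral by blast
qed (use g_dim lattice_g in \<open>blast intro: lattice_zero lattice_add lattice_scale lattice_bracket\<close>)+

subsection \<open>Conjugation by a diagonal matrix\<close>

text \<open>This is D x D^(-1) for the diagonal matrix D with entries \<pi>^(k w_i), written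
  entrywise so that no inverse matrix is needed.\<close>

definition diag_conj :: "nat \<Rightarrow> 'k mat \<Rightarrow> 'k mat" where
  "diag_conj k x = mat n n (\<lambda>(i, j). (\<pi> ^ k) ^ w i * x $$ (i, j) / (\<pi> ^ k) ^ w j)"

lemma diag_conj_carrier [simp]: "diag_conj k x \<in> carrier_mat n n" "dim_row (diag_conj k x) = n" "dim_col (diag_conj k x) = n"
  by (simp_all add: diag_conj_def)

lemma diag_conj_index: "i < n \<Longrightarrow> j < n \<Longrightarrow>
    diag_conj k x $$ (i, j) = (\<pi> ^ k) ^ w i * x $$ (i, j) / (\<pi> ^ k) ^ w j"
  by (simp add: diag_conj_def)

lemma diag_conj_g: "x \<in> g \<Longrightarrow> diag_conj k x \<in> g"
  unfolding diag_conj_def by (rule g_conj) simp_all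

lemma diag_conj_zero: "diag_conj k (0\<^sub>m n n) = 0\<^sub>m n n"
  by (rule eq_matI) (auto simp: diag_conj_index)

lemma diag_conj_add:
  assumes "x \<in> g" "y \<in> g"
  shows "diag_conj k (x + y) = diag_conj k x + diag_conj k y"
  by (rule eq_matI) (use assms in \<open>auto simp: diag_conj_index add_divide_distrib distrib_left\<close>)

lemma diag_conj_minus:
  assumes "x \<in> carrier_mat n n" "y \<in> carrier_mat n n"
  shows "diag_conj k (x - y) = diag_conj k x - diag_conj k y"
  by (rule eq_matI) (use assms in \<open>auto simp: diag_conj_index diff_divide_distrib right_diff_distrib\<close>)

lemma diag_conj_smult:
  assumes "x \<in> g"
  shows "diag_conj k (c \<cdot>\<^sub>m x) = c \<cdot>\<^sub>m diag_conj k x"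
  by (rule eq_matI) (use assms in \<open>auto simp: diag_conj_index\<close>)

lemma diag_conj_mult:
  assumes "x \<in> g" "y \<in> g"
  shows "diag_conj k (x * y) = diag_conj k x * diag_conj k y"
proof (rule eq_matI)
  fix i j assume "i < dim_row (diag_conj k x * diag_conj k y)" "j < dim_col (diag_conj k x * diag_conj k y)"
  hence ij: "i < n" "j < n"
    by simp_all
  have "(diag_conj k x * diag_conj k y) $$ (i, j) = (\<Sum>r<n. diag_conj k x $$ (i, r) * diag_conj k y $$ (r, j))"
    using ij by (intro index_mult_mat_sum) auto
  also have "\<dots> = (\<Sum>r<n. (\<pi> ^ k) ^ w i * (x $$ (i, r) * y $$ (r, j)) / (\<pi> ^ k) ^ w j)"
    using ij by (intro sum.cong refl) (simp add: diag_conj_index)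
  also have "\<dots> = (\<pi> ^ k) ^ w i * (x * y) $$ (i, j) / (\<pi> ^ k) ^ w j"
    unfolding index_mult_mat_sum[OF g_carrier[OF assms(1)] g_carrier[OF assms(2)] ij]
    by (simp add: sum_distrib_left sum_divide_distrib)
  finally show "diag_conj k (x * y) $$ (i, j) = (diag_conj k x * diag_conj k y) $$ (i, j)"
    using ij by (simp add: diag_conj_index)
qed simp_all

lemma diag_conj_bracket:
  assumes "x \<in> g" "y \<in> g"
  shows "diag_conj k (x * y - y * x) = diag_conj k x * diag_conj k y - diag_conj k y * diag_conj k x"
proof -
  have "diag_conj k (x * y - y * x) = diag_conj k (x * y) - diag_conj k (y * x)"
    using assms by (intro diag_conj_minus) (auto intro!: mult_carrier_mat[of _ n n])
  thus ?thesis
    using assms by (simp add: diag_conj_mult)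
qed

text \<open>Since \<open>a\<close> has weight 0, the entry in column \<open>j\<close> of this row is
  simply divided by \<pi>^(k w_j).\<close>

lemma diag_conj_a_index:
  assumes "j < n"
  shows "diag_conj k x $$ (a, j) \<in> ideal_power m \<longleftrightarrow> x $$ (a, j) \<in> ideal_power (m + k * w j)"
  using assms a_less
  by (simp add: diag_conj_index weight_a ideal_power_def power_add power_mult mult.commute)

definition conj_domain :: "nat \<Rightarrow> nat \<Rightarrow> 'k mat set" where
  "conj_domain m k = {x \<in> lattice m. diag_conj k x \<in> lattice m}"

text \<open>Entries of nonnegative degree w_i - w_j are multiplied by a power of \<pi> and stay in
  the lattice. An entry of negative degree is zero or, up to sign, an entry of row \<open>a\<close>
  whose weight is exactly w_j - w_i, so it meets the same divisibility condition.\<close>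

lemma mem_conj_domain_iff:
  assumes x: "x \<in> lattice m"
  shows "x \<in> conj_domain m k \<longleftrightarrow> (\<forall>j\<in>P. x $$ (a, j) \<in> ideal_power (m + k * w j))"
proof
  assume "x \<in> conj_domain m k"
  thus "\<forall>j\<in>P. x $$ (a, j) \<in> ideal_power (m + k * w j)"
    using P_less a_less diag_conj_a_index lattice_index unfolding conj_domain_def by blast
next
  assume row: "\<forall>j\<in>P. x $$ (a, j) \<in> ideal_power (m + k * w j)"
  have "diag_conj k x $$ (i, j) \<in> ideal_power m" if ij: "i < n" "j < n" for i j
  proof (cases "w j \<le> w i")
    case True
    have "diag_conj k x $$ (i, j) = (\<pi> ^ k) ^ (w i - w j) * x $$ (i, j)"
      using True ij by (simp add: diag_conj_index power_diff)
    thus ?thesis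
      using lattice_index[OF x ij]
      by (simp add: ideal_power_integral_mult integral_power uniformizer_integral)
  next
    case False
    hence "(\<pi> ^ k) ^ w j = (\<pi> ^ k) ^ w i * (\<pi> ^ k) ^ (w j - w i)"
      by (simp add: power_add[symmetric])
    hence entry: "diag_conj k x $$ (i, j) = x $$ (i, j) / (\<pi> ^ k) ^ (w j - w i)"
      using ij by (simp add: diag_conj_index)
    have "x $$ (i, j) \<in> ideal_power (m + k * (w j - w i))"
    proof -
      consider "x $$ (i, j) = 0" | l where "l \<in> P" "w i + w l = w j"
          "x $$ (i, j) = x $$ (a, l) \<or> x $$ (i, j) = - x $$ (a, l)"
        using determined[OF lattice_g[OF x] ij] False by auto
      thus ?thesis
      proof cases
        case (2 l)
        hence "w l = w j - w i"
          by simp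
        thus ?thesis
          using 2 row by auto
      qed simp
    qed
    thus ?thesis
      unfolding entry by (simp add: ideal_power_def power_add power_mult mult.commute)
  qed
  thus "x \<in> conj_domain m k"
    using x diag_conj_g[OF lattice_g[OF x]] by (simp add: conj_domain_def lattice_def)
qed

lemma conj_domain_closed:
  "0\<^sub>m n n \<in> conj_domain m k"
  "\<lbrakk>x \<in> conj_domain m k; y \<in> conj_domain m k\<rbrakk> \<Longrightarrow> x + y \<in> conj_domain m k"
  "x \<in> conj_domain m k \<Longrightarrow> \<iota> c \<cdot>\<^sub>m x \<in> conj_domain m k"
  "\<lbrakk>x \<in> conj_domain m k; y \<in> conj_domain m k\<rbrakk> \<Longrightarrow> x * y - y * x \<in> conj_domain m k"
  using lattice_g[of x m] lattice_g[of y m]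
  by (simp_all add: conj_domain_def diag_conj_zero lattice_zero diag_conj_add lattice_add
      diag_conj_smult lattice_scale diag_conj_bracket lattice_bracket)

lemma lie_subalgebra_conj_domain: "lie_subalgebra (conj_domain m k) padic_ring (matrix_module n (lattice m))"
proof -
  interpret L: module padic_ring "matrix_module n (lattice m)"
    using lie_lattice_lattice[of m] by (simp add: lie_lattice_def lie_algebra_def)
  have "module padic_ring (matrix_module n (conj_domain m k))"
    using lattice_g[of _ m] g_dim
    by (intro module_matrix_module conj_domain_closed) (auto simp: conj_domain_def)
  hence "Module.submodule (conj_domain m k) padic_ring (matrix_module n (lattice m))"
    by (intro L.module_incl_imp_submodule) (auto simp: matrix_module_simps matrix_module_restrict conj_domain_def)
  thus ?thesis
    by (simp add: lie_subalgebra_def matrix_module_simps conj_domain_closed)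
qed

subsection \<open>The index of the domain\<close>

text \<open>A section of the map that reads off the free entries of row \<open>a\<close>. It
  supplies coset representatives as well as the test elements of the simplicity argument.\<close>

definition build :: "(nat \<Rightarrow> 'k) \<Rightarrow> 'k mat" where
  "build c = (SOME x. x \<in> g \<and> (\<forall>j<n. x $$ (a, j) = (if j \<in> P then c j else 0)) \<and>
      (\<forall>i<n. \<forall>j<n. x $$ (i, j) = 0 \<or> (\<exists>k\<in>P. x $$ (i, j) = c k \<or> x $$ (i, j) = - c k)))"

lemma build:
  "build c \<in> g" (is ?A)
  "j < n \<Longrightarrow> build c $$ (a, j) = (if j \<in> P then c j else 0)" (is "_ \<Longrightarrow> ?B j")
  "\<lbrakk>i < n; j < n\<rbrakk> \<Longrightarrow>
    build c $$ (i, j) = 0 \<or> (\<exists>k\<in>P. build c $$ (i, j) = c k \<or> build c $$ (i, j) = - c k)" (is "_ \<Longrightarrow> _ \<Longrightarrow> ?C i j")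
proof -
  have "?A \<and> (\<forall>j<n. ?B j) \<and> (\<forall>i<n. \<forall>j<n. ?C i j)"
    unfolding build_def by (rule someI_ex) (use free[of c] in blast)
  thus ?A "j < n \<Longrightarrow> ?B j" "\<lbrakk>i < n; j < n\<rbrakk> \<Longrightarrow> ?C i j"
    by simp_all
qed

text \<open>All entries of the lift are zero or prescribed values up to sign, so prescribing a row
  with values in an ideal produces no denominators elsewhere.\<close>

lemma build_lattice:
  assumes "\<And>j. j \<in> P \<Longrightarrow> c j \<in> ideal_power m"
  shows "build c \<in> lattice m"
proof -
  have "build c $$ (i, j) \<in> ideal_power m" if "i < n" "j < n" for i j
    using build(3)[OF that, of c] assms by auto
  thus ?thesis
    using build(1) by (simp add: lattice_def)
qed

text \<open>The domain is cut out by one congruence per free column: the entry in column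
  \<open>j\<close>, a priori divisible by \<pi>^m, must be divisible by \<pi>^(m + k w_j). Each
  column contributes a factor q^(k w_j), and the columns are independent.\<close>

lemma card_cosets_conj_domain:
  defines "L \<equiv> \<lambda>m. matrix_module n (lattice m)"
  defines "q \<equiv> card (carrier (residue_field emb))"
  shows "finite (a_rcosets\<^bsub>L m\<^esub> conj_domain m k)" "card (a_rcosets\<^bsub>L m\<^esub> conj_domain m k) = q ^ (k * sum w P)"
proof -
  have "\<exists>T. transversal m (k * w j) T \<and> card T = q ^ (k * w j)" for j
    unfolding q_def by (rule transversal_exists)
  then obtain T where T: "\<And>j. transversal m (k * w j) (T j)" "\<And>j. card (T j) = q ^ (k * w j)"
    by metis
  have T_sub: "c j \<in> ideal_power m" if "c \<in> PiE P T" "j \<in> P" for c j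
    using T(1)[of j] that by (auto simp: transversal_def PiE_def Pi_def)
  have mem: "build c \<in> lattice m" if "c \<in> PiE P T" for c
    using T_sub[OF that] by (rule build_lattice)
  have "abelian_subgroup (conj_domain m k) (L m)"
  proof (rule abelian_subgroupI3)
    have "module padic_ring (L m)"
      using lie_lattice_lattice[of m] by (simp add: lie_lattice_def lie_algebra_def L_def)
    thus "abelian_group (L m)"
      by (simp add: module_def)
    show "additive_subgroup (conj_domain m k) (L m)"
      using lie_subalgebra_conj_domain[of m k]
      by (simp add: lie_subalgebra_def Module.submodule_def additive_subgroup_def L_def)
  qed
  hence bij: "bij_betw (\<lambda>s. conj_domain m k +>\<^bsub>L m\<^esub> s) (build ` PiE P T) (a_rcosets\<^bsub>L m\<^esub> conj_domain m k)"
  proof (rule bij_betw_transversal_a_rcosets)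
    show "build ` PiE P T \<subseteq> carrier (L m)"
      using mem by (auto simp: L_def matrix_module_simps)
    fix x assume "x \<in> carrier (L m)"
    hence x: "x \<in> lattice m"
      by (simp add: L_def matrix_module_simps)
    \<comment> \<open>The coset of a matrix depends only on its row \<open>a\<close>, since
      membership of the difference in the domain is decided there.\<close>
    have coset: "(\<exists>h\<in>conj_domain m k. x = h \<oplus>\<^bsub>L m\<^esub> build c) \<longleftrightarrow>
        (\<forall>j\<in>P. x $$ (a, j) - c j \<in> ideal_power (m + k * w j))" if c: "c \<in> PiE P T" for c
    proof -
      have xc: "x \<in> carrier_mat n n" "build c \<in> carrier_mat n n"
        using lattice_g[OF x] build(1) by auto
      have "(\<exists>h\<in>conj_domain m k. x = h + build c) \<longleftrightarrow> x - build c \<in> conj_domain m k"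
      proof
        assume "\<exists>h\<in>conj_domain m k. x = h + build c"
        then obtain h where h: "h \<in> conj_domain m k" "x = h + build c"
          by blast
        have "x - build c = h"
          using h(1) lattice_g xc unfolding h(2) by (intro eq_matI) (auto simp: conj_domain_def)
        thus "x - build c \<in> conj_domain m k"
          using h(1) by simp
      next
        assume "x - build c \<in> conj_domain m k"
        moreover have "x = (x - build c) + build c"
          using xc by (intro eq_matI) auto
        ultimately show "\<exists>h\<in>conj_domain m k. x = h + build c"
          by blast
      qed
      also have "\<dots> \<longleftrightarrow> (\<forall>j\<in>P. (x - build c) $$ (a, j) \<in> ideal_power (m + k * w j))"
        by (rule mem_conj_domain_iff[OF lattice_minus[OF x mem[OF c]]])
      also have "\<dots> \<longleftrightarrow> (\<forall>j\<in>P. x $$ (a, j) - c j \<in> ideal_power (m + k * w j))"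
        using xc P_less a_less by (intro ball_cong refl) (simp add: build(2))
      finally show ?thesis
        by (simp add: L_def matrix_module_simps)
    qed
    have ex1: "\<exists>!t. t \<in> T j \<and> x $$ (a, j) - t \<in> ideal_power (m + k * w j)" if "j \<in> P" for j
      using T(1)[of j] lattice_index[OF x a_less P_less[OF that]] by (simp add: transversal_def)
    \<comment> \<open>The restriction to \<open>P\<close> makes \<open>c\<close> extensional, so
      that it is the unique element of \<open>PiE P T\<close> representing \<open>x\<close>.\<close>
    define c where "c = (\<lambda>j\<in>P. THE t. t \<in> T j \<and> x $$ (a, j) - t \<in> ideal_power (m + k * w j))"
    have c: "c j \<in> T j \<and> x $$ (a, j) - c j \<in> ideal_power (m + k * w j)" if "j \<in> P" for j
      using theI'[OF ex1[OF that]] that by (simp add: c_def)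
    have c_unique: "d = c"
      if d: "d \<in> PiE P T" "\<And>j. j \<in> P \<Longrightarrow> x $$ (a, j) - d j \<in> ideal_power (m + k * w j)" for d
    proof
      fix j
      show "d j = c j"
      proof (cases "j \<in> P")
        case True
        have "(x $$ (a, j) - c j) - (x $$ (a, j) - d j) \<in> ideal_power (m + k * w j)"
          by (rule ideal_power_minus[OF conjunct2[OF c[OF True]] d(2)[OF True]])
        thus ?thesis
          using transversal_unique[OF T(1), of "d j" j "c j"] c[OF True] d(1) True
          by (simp add: PiE_mem)
      next
        case False
        thus ?thesis
          using d(1) by (simp add: c_def PiE_def extensional_def)
      qed
    qed
    have c_mem: "c \<in> PiE P T"
      using c by (auto simp: c_def)
    show "\<exists>!s. s \<in> build ` PiE P T \<and> (\<exists>h\<in>conj_domain m k. x = h \<oplus>\<^bsub>L m\<^esub> s)"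
    proof (rule ex1I)
      show "build c \<in> build ` PiE P T \<and> (\<exists>h\<in>conj_domain m k. x = h \<oplus>\<^bsub>L m\<^esub> build c)"
        unfolding coset[OF c_mem] using c c_mem by blast
      fix s assume s: "s \<in> build ` PiE P T \<and> (\<exists>h\<in>conj_domain m k. x = h \<oplus>\<^bsub>L m\<^esub> s)"
      then obtain d where d: "d \<in> PiE P T" "s = build d"
        by blast
      have "\<forall>j\<in>P. x $$ (a, j) - d j \<in> ideal_power (m + k * w j)"
        using s coset[OF d(1)] d(2) by simp
      thus "s = build c"
        using c_unique[OF d(1)] d(2) by simp
    qed
  qed
  have fin: "finite (PiE P T)"
    using finite_P T(1) by (intro finite_PiE) (auto simp: transversal_def)
  have "inj_on build (PiE P T)"
  proof
    fix c d assume cd: "c \<in> PiE P T" "d \<in> PiE P T" "build c = build d"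
    show "c = d"
    proof (rule PiE_ext[OF cd(1,2)])
      fix j assume "j \<in> P"
      thus "c j = d j"
        using build(2)[OF P_less, of j c] build(2)[OF P_less, of j d] cd(3) by simp
    qed
  qed
  hence "card (build ` PiE P T) = (\<Prod>j\<in>P. q ^ (k * w j))"
    using T(2) finite_P by (simp add: card_image card_PiE)
  also have "\<dots> = q ^ (k * sum w P)"
    by (simp add: power_sum sum_distrib_left)
  finally show "card (a_rcosets\<^bsub>L m\<^esub> conj_domain m k) = q ^ (k * sum w P)"
    using bij_betw_same_card[OF bij] by simp
  show "finite (a_rcosets\<^bsub>L m\<^esub> conj_domain m k)"
    using bij_betw_finite[OF bij] fin by simp
qed

subsection \<open>Simplicity\<close>

text \<open>
  Iterating \<^const>\<open>diag_conj\<close> divides the entries of the row \<open>a\<close> outside the diagonal by ever higher powers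
  of the uniformizer, so they vanish on an invariant ideal. Brackets with elements whose row \<open>a\<close>
  is a multiple of a unit vector then move the other rows into the row \<open>a\<close>.
\<close>

lemma invariant_ideal_zero:
  assumes k: "0 < k" and I: "I \<subseteq> conj_domain m k" "\<And>x. x \<in> I \<Longrightarrow> diag_conj k x \<in> I"
    and ideal: "\<And>x y. \<lbrakk>x \<in> lattice m; y \<in> I\<rbrakk> \<Longrightarrow> x * y - y * x \<in> I"
    and x: "x \<in> I"
  shows "x = 0\<^sub>m n n"
proof -
  have Ig: "y \<in> g" if "y \<in> I" for y
    using that I(1) lattice_g by (auto simp: conj_domain_def)
  \<comment> \<open>The matrix is generalized because the induction hypothesis is applied to its
    conjugate, which lies in the ideal again. Each step gains the exponent k w_j, which is at least
    1 off the diagonal.\<close>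
  have row_power: "y $$ (a, j) \<in> ideal_power t" if "y \<in> I" "j < n" "j \<noteq> a" for t y j
    using that
  proof (induction t arbitrary: y)
    case 0
    hence "y \<in> lattice m"
      using I(1) by (auto simp: conj_domain_def)
    thus ?case
      using lattice_index[OF _ a_less 0(2)] ideal_power_integral by auto
  next
    case (Suc t)
    have "diag_conj k y $$ (a, j) \<in> ideal_power t"
      using Suc I(2) by blast
    hence "y $$ (a, j) \<in> ideal_power (t + k * w j)"
      using diag_conj_a_index[OF Suc.prems(2)] by simp
    moreover have "Suc t \<le> t + k * w j"
      using weight_pos[OF Suc.prems(2,3)] k by simp
    ultimately show ?case
      using ideal_power_antimono by blast
  qed
  have row: "y $$ (a, j) = 0" if "y \<in> I" "j < n" "j \<noteq> a" for y j
    using ideal_powers_separated row_power[OF that] by blast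
  \<comment> \<open>The test element has row \<open>a\<close> equal to \<pi>^m times the unit vector
    of \<open>b\<close>; the factor \<pi>^m keeps it in the lattice. Multiplication by it from the
    left brings row \<open>b\<close> of \<open>y\<close> into row \<open>a\<close>, while from the
    right only \<open>y $$ (a, a)\<close> contributes, the rest of that row being zero.\<close>
  have bracket: "\<exists>z\<in>I. (\<forall>l<n. z $$ (a, l) =
      \<pi> ^ m * (y $$ (b, l) - (if l = b then y $$ (a, a) else 0)))" if y: "y \<in> I" and b: "b \<in> P" for y b
  proof -
    define e where "e = build (\<lambda>j. if j = b then \<pi> ^ m else 0)"
    have e: "e \<in> lattice m"
      unfolding e_def by (rule build_lattice) simp
    have e_row: "e $$ (a, r) = (if r = b then \<pi> ^ m else 0)" if "r < n" for r
      using build(2)[OF that, of "\<lambda>j. if j = b then \<pi> ^ m else 0"] b by (auto simp: e_def)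
    have dims: "e \<in> carrier_mat n n" "y \<in> carrier_mat n n"
      using lattice_g[OF e] Ig[OF y] by auto
    have "(e * y - y * e) $$ (a, l) = \<pi> ^ m * (y $$ (b, l) - (if l = b then y $$ (a, a) else 0))"
      if l: "l < n" for l
    proof -
      have "(e * y) $$ (a, l) = (\<Sum>r<n. if r = b then \<pi> ^ m * y $$ (r, l) else 0)"
        unfolding index_mult_mat_sum[OF dims a_less l] using e_row by (intro sum.cong) auto
      also have "\<dots> = \<pi> ^ m * y $$ (b, l)"
        using P_less[OF b] by simp
      finally have 1: "(e * y) $$ (a, l) = \<pi> ^ m * y $$ (b, l)" .
      have "(y * e) $$ (a, l) = (\<Sum>r<n. if r = a then y $$ (r, a) * e $$ (r, l) else 0)"
        unfolding index_mult_mat_sum[OF dims(2,1) a_less l] using row[OF y] by (intro sum.cong) auto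
      also have "\<dots> = y $$ (a, a) * e $$ (a, l)"
        using a_less by simp
      finally have "(y * e) $$ (a, l) = y $$ (a, a) * e $$ (a, l)" .
      thus ?thesis
        using 1 e_row[OF l] dims a_less l by (simp add: right_diff_distrib del: index_mult_mat(1))
    qed
    thus ?thesis
      using ideal[OF e y] by blast
  qed
  \<comment> \<open>The bracket is in the ideal, so its row \<open>a\<close> vanishes off the
    diagonal as well, and \<pi>^m cancels.\<close>
  have other_rows: "y $$ (b, l) = (if l = b then y $$ (a, a) else 0)"
    if "y \<in> I" "b \<in> P" "l < n" "l \<noteq> a" for y b l
    using bracket[OF that(1,2)] row that(3,4) by fastforce
  \<comment> \<open>Off column \<open>a\<close>, the rows in \<open>P\<close> now agree with those
    of \<open>y $$ (a, a)\<close> times the identity. The trace condition or skewness, encoded in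
    \<open>rigid_corner\<close>, forces this scalar to vanish.\<close>
  have corner: "y $$ (a, a) = 0" if "y \<in> I" for y
    using rigid_corner[OF Ig[OF that]] row other_rows that by blast
  \<comment> \<open>The remaining entry of row \<open>b\<close> becomes the diagonal entry of the
    bracket in row \<open>a\<close>, and the vanishing of corners applies to that bracket.\<close>
  have "y $$ (b, a) = 0" if yb: "y \<in> I" "b \<in> P" for y b
  proof -
    have "a \<noteq> b"
      using P_subset yb(2) by auto
    then obtain z where z: "z \<in> I" "z $$ (a, a) = \<pi> ^ m * y $$ (b, a)"
      using bracket[OF yb] a_less by auto
    thus ?thesis
      using corner[OF z(1)] by simp
  qed
  hence "x $$ (b, l) = 0" if "b \<in> P" "l < n" for b l
    using other_rows[OF x that] corner x that by (cases "l = a") auto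
  moreover have "x $$ (a, j) = 0" if "j < n" for j
    using row[OF x that] corner[OF x] by (cases "j = a") auto
  ultimately show ?thesis
    using rigid[OF Ig[OF x]] by blast
qed

theorem self_similar_lattice:
  assumes k: "0 < k"
  shows "self_similar padic_ring (matrix_module n (lattice m))
    (card (carrier (residue_field emb)) ^ (k * sum w P))"
proof -
  let ?L = "matrix_module n (lattice m)"
  have "diag_conj k \<in> module_hom padic_ring (?L\<lparr>carrier := conj_domain m k\<rparr>) ?L"
    using lattice_g
    by (auto simp: module_hom_def matrix_module_restrict matrix_module_simps conj_domain_def diag_conj_add diag_conj_smult)
  moreover have "diag_conj k (x * y - y * x) = diag_conj k x * diag_conj k y - diag_conj k y * diag_conj k x"
    if "x \<in> conj_domain m k" "y \<in> conj_domain m k" for x y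
    using that lattice_g by (intro diag_conj_bracket) (auto simp: conj_domain_def)
  ultimately have "virtual_endomorphism padic_ring ?L
      (card (carrier (residue_field emb)) ^ (k * sum w P)) (conj_domain m k) (diag_conj k)"
    unfolding virtual_endomorphism_def
    using lie_subalgebra_conj_domain[of m k] card_cosets_conj_domain[of m k] by (simp add: matrix_module_simps)
  moreover have "I = {\<zero>\<^bsub>?L\<^esub>}"
    if I: "lie_ideal I padic_ring ?L" "I \<subseteq> conj_domain m k" "diag_conj k ` I \<subseteq> I" for I
  proof -
    have "x = 0\<^sub>m n n" if "x \<in> I" for x
      by (rule invariant_ideal_zero[OF k I(2) _ _ that])
        (use I(1,3) in \<open>auto simp: lie_ideal_def matrix_module_simps\<close>)
    moreover have "0\<^sub>m n n \<in> I"
      using I(1) subgroup.one_closed[of I "add_monoid ?L"]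
      by (simp add: lie_ideal_def Module.submodule_def matrix_module_simps)
    ultimately show ?thesis
      unfolding matrix_module_simps by blast
  qed
  ultimately have "simple_virtual_endomorphism padic_ring ?L
      (card (carrier (residue_field emb)) ^ (k * sum w P)) (conj_domain m k) (diag_conj k)"
    unfolding simple_virtual_endomorphism_def by blast
  thus ?thesis
    unfolding self_similar_def using lie_lattice_lattice[of m] by blast
qed

end

section \<open>From the graded Lie algebra to the scaled integral lattices\<close>

context graded_matrices
begin

text \<open>The Lie algebra \<open>g\<close> is a vector space over K, so \<pi>^m can be divided out
  within it.\<close>

lemma smult_image_eq_lattice:
  "(\<cdot>\<^sub>m) (\<pi> ^ m) ` {x \<in> g. elements_mat x \<subseteq> integers emb} = lattice m"
proof (intro equalityI subsetI)
  fix y assume "y \<in> (\<cdot>\<^sub>m) (\<pi> ^ m) ` {x \<in> g. elements_mat x \<subseteq> integers emb}"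
  then obtain x where x: "x \<in> g" "elements_mat x \<subseteq> integers emb" "y = \<pi> ^ m \<cdot>\<^sub>m x"
    by blast
  have "x $$ (i, j) \<in> integers emb" if "i < n" "j < n" for i j
    using x(2) elements_matI[OF g_carrier[OF x(1)] that refl] by blast
  thus "y \<in> lattice m"
    using x by (simp add: lattice_def g_smult ideal_power_def)
next
  fix y assume y: "y \<in> lattice m"
  define x where "x = (1 / \<pi> ^ m) \<cdot>\<^sub>m y"
  have x: "x \<in> g"
    unfolding x_def by (rule g_smult[OF lattice_g[OF y]])
  have "x $$ (i, j) \<in> integers emb" if "i < n" "j < n" for i j
    using lattice_index[OF y that] lattice_g[OF y] that by (simp add: x_def ideal_power_def)
  hence "elements_mat x \<subseteq> integers emb"
    using x by (auto dest!: elements_matD)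
  moreover have "y = \<pi> ^ m \<cdot>\<^sub>m x"
    unfolding x_def by (rule eq_matI) auto
  ultimately show "y \<in> (\<cdot>\<^sub>m) (\<pi> ^ m) ` {x \<in> g. elements_mat x \<subseteq> integers emb}"
    using x by blast
qed

lemma self_similar_smult_image:
  assumes "0 < k" "X = {x \<in> g. elements_mat x \<subseteq> integers emb}"
    "N = card (carrier (residue_field emb)) ^ (k * sum w P)"
  shows "self_similar padic_ring (commutator_lie emb n ((\<cdot>\<^sub>m) (\<pi> ^ m) ` X)) N"
  unfolding assms(2,3) smult_image_eq_lattice by (rule self_similar_lattice[OF assms(1)])

end

context padic_uniformizer
begin

lemma of_nat_field_eq_0_iff: "(of_nat m :: 'k) = 0 \<longleftrightarrow> m = 0"
proof -
  have "(of_nat m :: 'k) = \<iota> (of_nat m)"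
    by (simp add: zp.hom_of_nat)
  thus ?thesis
    by (simp add: of_nat_padic_eq_0_iff del: zp.hom_of_nat)
qed

text \<open>Only the characteristic of K matters, so this covers p = 2.\<close>

lemma eq_uminus_iff: "(x :: 'k) = - x \<longleftrightarrow> x = 0"
proof
  assume "x = - x"
  hence "of_nat 2 * x = 0"
    by (simp add: eq_neg_iff_add_eq_0)
  thus "x = 0"
    using of_nat_field_eq_0_iff[of 2] by (metis mult_eq_0_iff zero_neq_numeral)
qed simp

section \<open>The special linear Lie algebra\<close>

text \<open>The grading belongs to the block decomposition n = 1 + (n - 1). Its part of degree -1 is
  the first row without its diagonal entry; filling that row freely does not affect the
  trace.\<close>

lemma graded_matrices_sl:
  assumes "2 \<le> n"
  shows "graded_matrices emb \<pi> n (sl_mats n UNIV) 0 (\<lambda>j. if j = 0 then 0 else 1) {1..<n}"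
proof (unfold_locales)
  let ?g = "sl_mats n (UNIV :: 'k set)"
  have mem: "x \<in> ?g \<longleftrightarrow> x \<in> carrier_mat n n \<and> (\<Sum>i<n. x $$ (i, i)) = 0" for x
    by (simp add: sl_mats_def)
  show "?g \<subseteq> carrier_mat n n"
    by (auto simp: mem)
  show "0\<^sub>m n n \<in> ?g"
    by (simp add: mem)
  show "x + y \<in> ?g" if "x \<in> ?g" "y \<in> ?g" for x y
  proof -
    have "(\<Sum>i<n. (x + y) $$ (i, i)) = (\<Sum>i<n. x $$ (i, i)) + (\<Sum>i<n. y $$ (i, i))"
      unfolding sum.distrib[symmetric] using that by (intro sum.cong) (auto simp: mem)
    thus ?thesis
      using that by (simp add: mem)
  qed
  show "c \<cdot>\<^sub>m x \<in> ?g" if "x \<in> ?g" for x c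
  proof -
    have "(\<Sum>i<n. (c \<cdot>\<^sub>m x) $$ (i, i)) = c * (\<Sum>i<n. x $$ (i, i))"
      unfolding sum_distrib_left using that by (intro sum.cong) (auto simp: mem)
    thus ?thesis
      using that by (simp add: mem)
  qed
  show "x * y - y * x \<in> ?g" if "x \<in> ?g" "y \<in> ?g" for x y
  proof -
    have xy: "x \<in> carrier_mat n n" "y \<in> carrier_mat n n"
      using that by (auto simp: mem)
    have "(\<Sum>i<n. (x * y - y * x) $$ (i, i)) =
        (\<Sum>i<n. (\<Sum>r<n. x $$ (i, r) * y $$ (r, i)) - (\<Sum>r<n. y $$ (i, r) * x $$ (r, i)))"
      using xy by (intro sum.cong refl)
        (simp add: index_mult_mat_sum[of _ n] del: index_mult_mat(1))
    \<comment> \<open>Both products have the same trace: exchanging the order of summation turns one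
      double sum into the other.\<close>
    also have "\<dots> = 0"
      unfolding sum_subtractf
      by (subst sum.swap) (simp add: mult.commute)
    finally show ?thesis
      using minus_carrier_mat[OF mult_carrier_mat[OF xy(2,1)], of "x * y"] by (simp add: mem)
  qed
  show "mat n n (\<lambda>(i, j). c ^ (if i = 0 then 0 else 1) * x $$ (i, j) / c ^ (if j = 0 then 0 else 1)) \<in> ?g"
    if "x \<in> ?g" "c \<noteq> 0" for x and c :: 'k
  proof -
    have "(\<Sum>i<n. mat n n (\<lambda>(i, j). c ^ (if i = 0 then 0 else 1) * x $$ (i, j) /
        c ^ (if j = 0 then 0 else 1)) $$ (i, i)) = (\<Sum>i<n. x $$ (i, i))"
      using that(2) by (intro sum.cong) auto
    thus ?thesis
      using that by (simp add: mem)
  qed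
  show "0 < n"
    using assms by simp
  show "{1..<n} \<subseteq> {..<n} - {0}"
    by auto
  show "\<exists>x\<in>?g. (\<forall>j<n. x $$ (0, j) = (if j \<in> {1..<n} then d j else 0)) \<and>
      (\<forall>i<n. \<forall>j<n. x $$ (i, j) = 0 \<or> (\<exists>k\<in>{1..<n}. x $$ (i, j) = d k \<or> x $$ (i, j) = - d k))"
    for d :: "nat \<Rightarrow> 'k"
  proof (rule bexI)
    let ?x = "mat n n (\<lambda>(i, j). if i = 0 \<and> j \<noteq> 0 then d j else 0)"
    show "(\<forall>j<n. ?x $$ (0, j) = (if j \<in> {1..<n} then d j else 0)) \<and>
        (\<forall>i<n. \<forall>j<n. ?x $$ (i, j) = 0 \<or> (\<exists>k\<in>{1..<n}. ?x $$ (i, j) = d k \<or> ?x $$ (i, j) = - d k))"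
      using assms by auto
    show "?x \<in> ?g"
      by (auto simp: mem intro!: sum.neutral)
  qed
  show "x $$ (i, j) = 0 \<or> (\<exists>k\<in>{1..<n}. (if i = 0 then 0 else 1) + (if k = 0 then 0 else 1) =
      (if j = 0 then 0 else 1 :: nat) \<and> (x $$ (i, j) = x $$ (0, k) \<or> x $$ (i, j) = - x $$ (0, k)))"
    if "j < n" "(if i = 0 then 0 else 1) < (if j = 0 then 0 else 1 :: nat)" for x :: "'k mat" and i j
    using that by (intro disjI2 bexI[of _ j]) (auto split: if_splits)
  \<comment> \<open>All diagonal entries are equal, so the trace is n times the corner, and n is
    nonzero in K even if p divides it.\<close>
  show "x $$ (0, 0) = 0"
    if x: "x \<in> ?g" and rows: "\<And>b k. \<lbrakk>b \<in> {1..<n}; k < n; k \<noteq> 0\<rbrakk> \<Longrightarrow>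
      x $$ (b, k) = (if k = b then x $$ (0, 0) else 0)" for x
  proof -
    have "(\<Sum>i<n. x $$ (i, i)) = (\<Sum>i<n. x $$ (0, 0))"
    proof (intro sum.cong refl)
      fix i assume "i \<in> {..<n}"
      thus "x $$ (i, i) = x $$ (0, 0)"
        using rows[of i i] by (cases "i = 0") simp_all
    qed
    thus ?thesis
      using x of_nat_field_eq_0_iff[of n] assms by (simp add: mem)
  qed
  show "x = 0\<^sub>m n n"
    if "x \<in> ?g" "\<And>j. j < n \<Longrightarrow> x $$ (0, j) = 0" "\<And>b k. \<lbrakk>b \<in> {1..<n}; k < n\<rbrakk> \<Longrightarrow> x $$ (b, k) = 0" for x
  proof (rule eq_matI)
    fix i j assume ij: "i < dim_row (0\<^sub>m n n :: 'k mat)" "j < dim_col (0\<^sub>m n n :: 'k mat)"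
    thus "x $$ (i, j) = 0\<^sub>m n n $$ (i, j)"
      using that(2)[of j] that(3)[of i j] by (cases "i = 0") auto
  qed (use that(1) in \<open>auto simp: mem\<close>)
qed auto

lemma self_similar_sl:
  assumes "2 \<le> n" "0 < k"
  shows "self_similar padic_ring (sl_lattice emb \<pi> n m) (card (carrier (residue_field emb)) ^ ((n - 1) * k))"
  unfolding sl_lattice_def
proof (rule graded_matrices.self_similar_smult_image[OF graded_matrices_sl[OF assms(1)] assms(2)])
  show "sl_mats n (integers emb) = {x \<in> sl_mats n UNIV. elements_mat x \<subseteq> integers emb}"
    by (auto simp: sl_mats_def)
  have "(\<Sum>j\<in>{1..<n}. if j = 0 then 0 else 1 :: nat) = n - 1"
    by simp
  thus "card (carrier (residue_field emb)) ^ ((n - 1) * k) =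
      card (carrier (residue_field emb)) ^ (k * (\<Sum>j\<in>{1..<n}. if j = 0 then 0 else 1))"
    by (simp add: mult.commute)
qed

section \<open>Orthogonal and symplectic Lie algebras\<close>

text \<open>
  The Gram matrices are monomial: row \<open>i\<close> has the single nonzero entry \<open>\<epsilon> i\<close> in the column \<open>f i\<close>,
  with \<open>f\<close> an involution. They are symmetric for \<open>\<tau> = 1\<close> and alternating for \<open>\<tau> = -1\<close>.
\<close>

definition signed_skew :: "nat \<Rightarrow> (nat \<Rightarrow> nat) \<Rightarrow> (nat \<Rightarrow> 'k) \<Rightarrow> 'k mat set" where
  "signed_skew n f \<epsilon> = {x \<in> carrier_mat n n.
     \<forall>i<n. \<forall>j<n. x $$ (i, j) = - (\<epsilon> i * \<epsilon> j * x $$ (f j, f i))}"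

text \<open>If \<open>f a\<close> differs from \<open>a\<close>, the weights of \<open>j\<close> and
  \<open>f j\<close> always sum to 2, also at fixed points of \<open>f\<close>. The diagonal matrix
  with entries c^(w_j) is therefore a similitude of the form with multiplier c^2, and conjugation by
  it preserves skewness.\<close>

definition skew_weight :: "(nat \<Rightarrow> nat) \<Rightarrow> nat \<Rightarrow> nat \<Rightarrow> nat" where
  "skew_weight f a j = (if j = a then 0 else if j = f a then 2 else 1)"

text \<open>For a symmetric form the entry in column \<open>f a\<close> of row \<open>a\<close> is
  forced to be zero, so that column is not free.\<close>

definition skew_columns :: "nat \<Rightarrow> (nat \<Rightarrow> nat) \<Rightarrow> 'k \<Rightarrow> nat \<Rightarrow> nat set" where
  "skew_columns n f \<tau> a = (if \<tau> = 1 then {..<n} - {a, f a} else {..<n} - {a})"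

context
  fixes n :: nat and f :: "nat \<Rightarrow> nat" and \<epsilon> :: "nat \<Rightarrow> 'k" and \<tau> :: 'k
  assumes f_less: "i < n \<Longrightarrow> f i < n" and f_f: "i < n \<Longrightarrow> f (f i) = i"
    and sign: "\<epsilon> i = 1 \<or> \<epsilon> i = - 1" and tau: "\<tau> = 1 \<or> \<tau> = - 1"
    and sign_f: "i < n \<Longrightarrow> \<epsilon> (f i) = \<tau> * \<epsilon> i"
begin

lemma sign_square: "\<epsilon> i * \<epsilon> i = 1" "\<epsilon> i * (\<epsilon> i * z) = z"
  using sign[of i] by auto

lemma f_eq_iff: "i < n \<Longrightarrow> j < n \<Longrightarrow> f i = j \<longleftrightarrow> i = f j"
  using f_f by auto

lemma signed_skewD:
  "\<lbrakk>x \<in> signed_skew n f \<epsilon>; i < n; j < n\<rbrakk> \<Longrightarrow> x $$ (i, j) = - (\<epsilon> i * \<epsilon> j * x $$ (f j, f i))"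
  by (simp add: signed_skew_def)

lemma signed_skewI:
  assumes "x \<in> carrier_mat n n"
    "\<And>i j. \<lbrakk>i < n; j < n\<rbrakk> \<Longrightarrow> x $$ (i, j) = - (\<epsilon> i * \<epsilon> j * x $$ (f j, f i))"
  shows "x \<in> signed_skew n f \<epsilon>"
  using assms by (simp add: signed_skew_def)

text \<open>The entry (i, j) of s x + x^t s pairs x at (f i, j) with x at (f j, i). Reindexing the
  rows by the involution and multiplying by the sign \<tau> \<epsilon>_i solves the equation for x
  at (i, j).\<close>

lemma skew_mats_eq_signed_skew:
  assumes s: "s \<in> carrier_mat n n"
    and s_index: "\<And>i j. \<lbrakk>i < n; j < n\<rbrakk> \<Longrightarrow> s $$ (i, j) = (if j = f i then \<epsilon> i else 0)"
  shows "skew_mats n s A = {x \<in> signed_skew n f \<epsilon>. elements_mat x \<subseteq> A}"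
proof -
  have "s * x + transpose_mat x * s = 0\<^sub>m n n \<longleftrightarrow>
      (\<forall>i<n. \<forall>j<n. x $$ (i, j) = - (\<epsilon> i * \<epsilon> j * x $$ (f j, f i)))" if x: "x \<in> carrier_mat n n" for x
  proof -
    have entry: "(s * x + transpose_mat x * s) $$ (i, j) = \<epsilon> i * x $$ (f i, j) + \<epsilon> (f j) * x $$ (f j, i)"
      if ij: "i < n" "j < n" for i j
    proof -
      have "(s * x) $$ (i, j) = (\<Sum>r<n. if r = f i then \<epsilon> i * x $$ (r, j) else 0)"
        unfolding index_mult_mat_sum[OF s x ij] using ij s_index by (intro sum.cong) auto
      also have "\<dots> = \<epsilon> i * x $$ (f i, j)"
        using f_less[OF ij(1)] by simp
      finally have 1: "(s * x) $$ (i, j) = \<epsilon> i * x $$ (f i, j)" .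
      have "(transpose_mat x * s) $$ (i, j) = (\<Sum>r<n. transpose_mat x $$ (i, r) * s $$ (r, j))"
        using s x ij by (intro index_mult_mat_sum) auto
      also have "\<dots> = (\<Sum>r<n. if r = f j then \<epsilon> r * x $$ (r, i) else 0)"
        using ij x s_index f_eq_iff by (intro sum.cong) auto
      also have "\<dots> = \<epsilon> (f j) * x $$ (f j, i)"
        using f_less[OF ij(2)] by simp
      finally show ?thesis
        using 1 s x ij by (simp del: index_mult_mat(1))
    qed
    have "s * x + transpose_mat x * s = 0\<^sub>m n n \<longleftrightarrow>
        (\<forall>i<n. \<forall>j<n. \<epsilon> i * x $$ (f i, j) + \<epsilon> (f j) * x $$ (f j, i) = 0)"
    proof
      assume zero: "s * x + transpose_mat x * s = 0\<^sub>m n n"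
      show "\<forall>i<n. \<forall>j<n. \<epsilon> i * x $$ (f i, j) + \<epsilon> (f j) * x $$ (f j, i) = 0"
        using entry unfolding zero by simp
    next
      assume "\<forall>i<n. \<forall>j<n. \<epsilon> i * x $$ (f i, j) + \<epsilon> (f j) * x $$ (f j, i) = 0"
      thus "s * x + transpose_mat x * s = 0\<^sub>m n n"
        using entry s x by (intro eq_matI) (auto simp del: index_mult_mat(1) index_add_mat(1))
    qed
    \<comment> \<open>The row index \<open>i\<close> is replaced by \<open>f i\<close>, which again
      runs through all rows.\<close>
    also have "\<dots> \<longleftrightarrow> (\<forall>i<n. \<forall>j<n. \<epsilon> (f i) * x $$ (i, j) + \<epsilon> (f j) * x $$ (f j, f i) = 0)"
    proof (intro iffI allI impI)
      fix i j assume "i < n" "j < n"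
        and zero: "\<forall>i<n. \<forall>j<n. \<epsilon> i * x $$ (f i, j) + \<epsilon> (f j) * x $$ (f j, i) = 0"
      thus "\<epsilon> (f i) * x $$ (i, j) + \<epsilon> (f j) * x $$ (f j, f i) = 0"
        using zero[rule_format, of "f i" j] f_less[of i] f_f[of i] by simp
    next
      fix i j assume "i < n" "j < n"
        and zero: "\<forall>i<n. \<forall>j<n. \<epsilon> (f i) * x $$ (i, j) + \<epsilon> (f j) * x $$ (f j, f i) = 0"
      thus "\<epsilon> i * x $$ (f i, j) + \<epsilon> (f j) * x $$ (f j, i) = 0"
        using zero[rule_format, of "f i" j] f_less[of i] f_f[of i] by simp
    qed
    also have "\<dots> \<longleftrightarrow> (\<forall>i<n. \<forall>j<n. x $$ (i, j) = - (\<epsilon> i * \<epsilon> j * x $$ (f j, f i)))"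
    proof -
      have "\<epsilon> (f i) * x $$ (i, j) + \<epsilon> (f j) * x $$ (f j, f i) = 0 \<longleftrightarrow>
          x $$ (i, j) = - (\<epsilon> i * \<epsilon> j * x $$ (f j, f i))" if "i < n" "j < n" for i j
      proof -
        have "\<epsilon> (f i) * x $$ (i, j) + \<epsilon> (f j) * x $$ (f j, f i) =
            \<tau> * \<epsilon> i * (x $$ (i, j) + \<epsilon> i * \<epsilon> j * x $$ (f j, f i))"
          using sign_f that sign_square(2)[of i "\<tau> * (\<epsilon> j * x $$ (f j, f i))"] by (simp add: algebra_simps)
        moreover have "\<tau> * \<epsilon> i \<noteq> 0"
          using tau sign[of i] by auto
        ultimately show ?thesis
          by (simp add: eq_neg_iff_add_eq_0)
      qed
      thus ?thesis
        by simp
    qed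
    finally show ?thesis .
  qed
  thus ?thesis
    by (auto simp: skew_mats_def signed_skew_def)
qed

lemma signed_skew_diag: "\<lbrakk>x \<in> signed_skew n f \<epsilon>; i < n\<rbrakk> \<Longrightarrow> x $$ (f i, f i) = - x $$ (i, i)"
  using signed_skewD[of x i i] sign_square(1)[of i] by simp

text \<open>This entry is paired with itself, and for a symmetric form the pairing sign is -1. The
  orthogonal and symplectic exponents differ for this reason.\<close>

lemma signed_skew_antidiag:
  assumes "x \<in> signed_skew n f \<epsilon>" "\<tau> = 1" "i < n"
  shows "x $$ (i, f i) = 0"
proof -
  have "x $$ (i, f i) = - x $$ (i, f i)"
    using signed_skewD[OF assms(1,3) f_less[OF assms(3)]] sign_f[OF assms(3)] assms(2) f_f[OF assms(3)]
      sign_square(1)[of i] by simp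
  thus ?thesis
    by (simp only: eq_uminus_iff)
qed

text \<open>The condition \<open>f a \<noteq> a\<close> says that the basis vector \<open>a\<close>
  is isotropic, so that it can have weight 0 and its dual weight 2. In the symmetric case a basis
  vector outside this hyperbolic plane is needed: for n = 2 the Lie algebra is one-dimensional
  abelian and no column would be free.\<close>

lemma graded_matrices_skew:
  assumes a: "a < n" "f a \<noteq> a" and three: "\<tau> = 1 \<Longrightarrow> 3 \<le> n"
  shows "graded_matrices emb \<pi> n (signed_skew n f \<epsilon>) a (skew_weight f a) (skew_columns n f \<tau> a)"
proof (unfold_locales)
  let ?g = "signed_skew n f \<epsilon>" and ?w = "skew_weight f a" and ?P = "skew_columns n f \<tau> a"
  have fa: "f a < n" "f (f a) = a"
    using f_less[OF a(1)] f_f[OF a(1)] by auto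
  have tau_neg: "\<tau> = - 1" if "\<tau> \<noteq> 1"
    using tau that by simp
  have skew_columns: "j \<in> ?P" if "j < n" "j \<noteq> a" "j \<noteq> f a" for j
    using that by (simp add: skew_columns_def)
  have weight_f: "?w j + ?w (f j) = 2" if "j < n" for j
    using a fa f_eq_iff[OF that a(1)] f_eq_iff[OF that fa(1)] by (auto simp: skew_weight_def)
  have dims: "x \<in> carrier_mat n n" if "x \<in> ?g" for x
    using that by (simp add: signed_skew_def)
  show "?g \<subseteq> carrier_mat n n"
    by (auto simp: signed_skew_def)
  show "0\<^sub>m n n \<in> ?g"
    using f_less by (intro signed_skewI) auto
  show "x + y \<in> ?g" if "x \<in> ?g" "y \<in> ?g" for x y
  proof -
    have "(x + y) $$ (i, j) = - (\<epsilon> i * \<epsilon> j * (x + y) $$ (f j, f i))" if ij: "i < n" "j < n" for i j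
      using signed_skewD[OF \<open>x \<in> ?g\<close> ij] signed_skewD[OF \<open>y \<in> ?g\<close> ij] dims[OF \<open>x \<in> ?g\<close>]
        dims[OF \<open>y \<in> ?g\<close>] ij f_less[OF ij(1)] f_less[OF ij(2)] by (simp add: distrib_left)
    thus ?thesis
      by (rule signed_skewI[OF add_carrier_mat[OF dims[OF that(2)]]])
  qed
  show "c \<cdot>\<^sub>m x \<in> ?g" if "x \<in> ?g" for x c
  proof -
    have "(c \<cdot>\<^sub>m x) $$ (i, j) = - (\<epsilon> i * \<epsilon> j * (c \<cdot>\<^sub>m x) $$ (f j, f i))" if ij: "i < n" "j < n" for i j
      using signed_skewD[OF \<open>x \<in> ?g\<close> ij] dims[OF \<open>x \<in> ?g\<close>]
        ij f_less[OF ij(1)] f_less[OF ij(2)] by (simp add: mult.left_commute)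
    thus ?thesis
      by (rule signed_skewI[OF smult_carrier_mat[OF dims[OF that]]])
  qed
  show "x * y - y * x \<in> ?g" if xy: "x \<in> ?g" "y \<in> ?g" for x y
  proof -
    \<comment> \<open>The form defines an anti-automorphism of the matrix algebra whose -1
      eigenspace is \<open>?g\<close>. It reverses products, and the two minus signs cancel.\<close>
    have prod: "(u * v) $$ (i, j) = \<epsilon> i * \<epsilon> j * (v * u) $$ (f j, f i)"
      if uv: "u \<in> ?g" "v \<in> ?g" and ij: "i < n" "j < n" for u v i j
    proof -
      have bij: "bij_betw f {..<n} {..<n}"
        by (rule bij_betw_byWitness[of _ f]) (auto simp: f_less f_f)
      have "(u * v) $$ (i, j) = (\<Sum>r<n. u $$ (i, r) * v $$ (r, j))"
        using uv ij dims by (intro index_mult_mat_sum) auto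
      also have "\<dots> = (\<Sum>r<n. \<epsilon> i * \<epsilon> j * (v $$ (f j, f r) * u $$ (f r, f i)))"
      proof (intro sum.cong refl)
        fix r assume "r \<in> {..<n}"
        hence r: "r < n"
          by simp
        show "u $$ (i, r) * v $$ (r, j) = \<epsilon> i * \<epsilon> j * (v $$ (f j, f r) * u $$ (f r, f i))"
          unfolding signed_skewD[OF uv(1) ij(1) r] signed_skewD[OF uv(2) r ij(2)]
          using sign[of r] by auto
      qed
      also have "\<dots> = \<epsilon> i * \<epsilon> j * (\<Sum>r<n. v $$ (f j, f r) * u $$ (f r, f i))"
        by (simp add: sum_distrib_left)
      also have "(\<Sum>r<n. v $$ (f j, f r) * u $$ (f r, f i)) = (\<Sum>r<n. v $$ (f j, r) * u $$ (r, f i))"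
        by (rule sum.reindex_bij_betw[OF bij])
      also have "\<dots> = (v * u) $$ (f j, f i)"
        using uv ij dims f_less by (intro index_mult_mat_sum[symmetric]) auto
      finally show ?thesis .
    qed
    have "(x * y - y * x) $$ (i, j) = - (\<epsilon> i * \<epsilon> j * (x * y - y * x) $$ (f j, f i))"
      if ij: "i < n" "j < n" for i j
      using prod[OF xy ij] prod[OF xy(2,1) ij] dims[OF xy(1)] dims[OF xy(2)] ij f_less[OF ij(1)]
        f_less[OF ij(2)] by (simp add: right_diff_distrib del: index_mult_mat(1))
    thus ?thesis
      by (rule signed_skewI[OF minus_carrier_mat[OF mult_carrier_mat[OF dims[OF xy(2)] dims[OF xy(1)]]]])
  qed
  show "mat n n (\<lambda>(i, j). c ^ ?w i * x $$ (i, j) / c ^ ?w j) \<in> ?g" if x: "x \<in> ?g" and c: "c \<noteq> 0" for x c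
  proof -
    \<comment> \<open>As dual weights sum to 2, the paired positions (i, j) and (f j, f i) have the
      same degree.\<close>
    have entry: "c ^ ?w i * x $$ (i, j) / c ^ ?w j =
        - (\<epsilon> i * \<epsilon> j * (c ^ ?w (f j) * x $$ (f j, f i) / c ^ ?w (f i)))" if ij: "i < n" "j < n" for i j
    proof -
      have "c ^ ?w i * c ^ ?w (f i) = c ^ ?w j * c ^ ?w (f j)"
        using weight_f[OF ij(1)] weight_f[OF ij(2)] by (simp add: power_add[symmetric])
      hence "c ^ ?w i / c ^ ?w j = c ^ ?w (f j) / c ^ ?w (f i)"
        using c by (simp add: frac_eq_eq mult.commute)
      hence "c ^ ?w i / c ^ ?w j * x $$ (i, j) =
          c ^ ?w (f j) / c ^ ?w (f i) * - (\<epsilon> i * \<epsilon> j * x $$ (f j, f i))"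
        using signed_skewD[OF x ij] by (simp only:)
      thus ?thesis
        by simp
    qed
    show ?thesis
    proof (rule signed_skewI)
      fix i j assume ij: "i < n" "j < n"
      show "mat n n (\<lambda>(i, j). c ^ ?w i * x $$ (i, j) / c ^ ?w j) $$ (i, j) =
          - (\<epsilon> i * \<epsilon> j * mat n n (\<lambda>(i, j). c ^ ?w i * x $$ (i, j) / c ^ ?w j) $$ (f j, f i))"
        using entry[OF ij] ij f_less[OF ij(1)] f_less[OF ij(2)] by simp
    qed simp
  qed
  show "a < n"
    by fact
  show "?w a = 0"
    by (simp add: skew_weight_def)
  show "0 < ?w j" if "j \<noteq> a" for j
    using that by (simp add: skew_weight_def)
  show "?P \<subseteq> {..<n} - {a}"
    by (auto simp: skew_columns_def)
  show "\<exists>x\<in>?g. (\<forall>j<n. x $$ (a, j) = (if j \<in> ?P then d j else 0)) \<and>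
      (\<forall>i<n. \<forall>j<n. x $$ (i, j) = 0 \<or> (\<exists>k\<in>?P. x $$ (i, j) = d k \<or> x $$ (i, j) = - d k))" for d
  proof (rule bexI)
    \<comment> \<open>The prescribed row \<open>a\<close> determines column \<open>f a\<close>
      through the pairing of (i, f a) with (a, f i). The two meet in the entry (a, f a), where the
      row takes precedence.\<close>
    let ?h = "\<lambda>i j. if i = a then if j \<in> ?P then d j else 0
      else if j = f a \<and> f i \<in> ?P then - (\<epsilon> i * \<epsilon> (f a) * d (f i)) else 0"
    let ?x = "mat n n (\<lambda>(i, j). ?h i j)"
    have "?h i j = 0 \<or> (\<exists>k\<in>?P. ?h i j = d k \<or> ?h i j = - d k)" for i j
      using sign[of i] sign[of "f a"] by auto
    thus "(\<forall>j<n. ?x $$ (a, j) = (if j \<in> ?P then d j else 0)) \<and>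
        (\<forall>i<n. \<forall>j<n. ?x $$ (i, j) = 0 \<or> (\<exists>k\<in>?P. ?x $$ (i, j) = d k \<or> ?x $$ (i, j) = - d k))"
      using a by simp
    have a_notin: "a \<notin> ?P"
      by (auto simp: skew_columns_def)
    have entry: "?h i j = - (\<epsilon> i * \<epsilon> j * ?h (f j) (f i))" if ij: "i < n" "j < n" for i j
    proof (cases "i = a")
      case i: True
      show ?thesis
      proof (cases "j = f a")
        case True
        \<comment> \<open>The self-paired entry (a, f a) may be prescribed only for an alternating
          form, where this sign makes the condition on it void.\<close>
        have "\<epsilon> a * \<epsilon> (f a) = - 1" if "f a \<in> ?P"
        proof -
          have "\<tau> \<noteq> 1"
            using that by (auto simp: skew_columns_def)
          thus ?thesis
            using sign_f[OF a(1)] tau_neg sign_square(1)[of a] by simp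
        qed
        thus ?thesis
          using True i fa by auto
      next
        case False
        hence "f j \<noteq> a"
          using f_eq_iff[OF ij(2) a(1)] by simp
        moreover have "\<epsilon> a * \<epsilon> j * (\<epsilon> (f j) * \<epsilon> (f a)) = 1"
          using sign_f[OF a(1)] sign_f[OF ij(2)] tau sign[of a] sign[of j] by auto
        ultimately show ?thesis
          using i f_f[OF ij(2)] by (auto simp: mult.assoc)
      qed
    next
      case i: False
      hence "f i \<noteq> f a"
        using f_f[OF ij(1)] fa by metis
      thus ?thesis
        using i ij a fa f_eq_iff[OF ij(2) a(1)] by auto
    qed
    show "?x \<in> ?g"
    proof (rule signed_skewI)
      fix i j assume ij: "i < n" "j < n"
      have "?x $$ (i, j) = ?h i j" "?x $$ (f j, f i) = ?h (f j) (f i)"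
        using ij f_less[OF ij(1)] f_less[OF ij(2)] by simp_all
      thus "?x $$ (i, j) = - (\<epsilon> i * \<epsilon> j * ?x $$ (f j, f i))"
        using entry[OF ij] by (simp only:)
    qed simp
  qed
  show "x $$ (i, j) = 0 \<or> (\<exists>k\<in>?P. ?w i + ?w k = ?w j \<and>
      (x $$ (i, j) = x $$ (a, k) \<or> x $$ (i, j) = - x $$ (a, k)))"
    if x: "x \<in> ?g" and ij: "i < n" "j < n" and less: "?w i < ?w j" for x i j
  proof (cases "i = a")
    case True
    show ?thesis
    proof (cases "j \<in> ?P")
      case True
      thus ?thesis
        using \<open>i = a\<close> by (intro disjI2 bexI[of _ j]) (auto simp: skew_weight_def)
    next
      case False
      hence "\<tau> = 1 \<and> j = f a"
        using less ij \<open>i = a\<close> by (auto simp: skew_columns_def skew_weight_def split: if_splits)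
      thus ?thesis
        using signed_skew_antidiag[OF x _ a(1)] \<open>i = a\<close> by simp
    qed
  next
    case False
    \<comment> \<open>Outside row \<open>a\<close> a negative degree can only arise from weights 1 <
      2, so the entry lies in column \<open>f a\<close> and its partner lies in row
      \<open>a\<close>.\<close>
    hence ifj: "i \<noteq> a" "i \<noteq> f a" "j = f a"
      using less by (auto simp: skew_weight_def split: if_splits)
    hence fi: "f i \<noteq> a" "f i \<noteq> f a"
      using f_eq_iff[OF ij(1) a(1)] f_eq_iff[OF ij(1) fa(1)] fa(2) by auto
    hence "f i \<in> ?P"
      using f_less[OF ij(1)] by (intro skew_columns)
    moreover have "?w i + ?w (f i) = ?w j"
      using ifj fi a by (simp add: skew_weight_def)
    moreover have "x $$ (i, j) = x $$ (a, f i) \<or> x $$ (i, j) = - x $$ (a, f i)"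
      using signed_skewD[OF x ij] sign[of i] sign[of j] ifj(3) fa(2) by auto
    ultimately show ?thesis
      by blast
  qed
  show "x $$ (a, a) = 0"
    if x: "x \<in> ?g" and diag: "\<And>b k. \<lbrakk>b \<in> ?P; k < n; k \<noteq> a\<rbrakk> \<Longrightarrow>
      x $$ (b, k) = (if k = b then x $$ (a, a) else 0)" for x
  proof -
    \<comment> \<open>Dual diagonal entries are opposite, whereas those in rows of \<open>?P\<close>
      equal the corner. For a symmetric form this is applied to a pair b, f b outside the hyperbolic
      plane, where b may be a fixed point; for an alternating form \<open>f a\<close> itself is in
      \<open>?P\<close>.\<close>
    have "x $$ (a, a) = - x $$ (a, a)"
    proof (cases "\<tau> = 1")
      case True
      have "card {a, f a} < card {..<n}"
        using three[OF True] a(2) by simp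
      hence "\<not> {..<n} \<subseteq> {a, f a}"
        by (metis card_mono finite.emptyI finite.insertI not_le)
      then obtain b where b: "b < n" "b \<noteq> a" "b \<noteq> f a"
        by auto
      hence fb: "f b \<noteq> a" "f b \<noteq> f a"
        using f_eq_iff[OF b(1) a(1)] f_eq_iff[OF b(1) fa(1)] fa(2) by auto
      have "x $$ (b, b) = x $$ (a, a)"
        using diag[OF skew_columns[OF b] b(1,2)] by simp
      moreover have "x $$ (f b, f b) = x $$ (a, a)"
        using diag[OF skew_columns[OF f_less[OF b(1)] fb] f_less[OF b(1)] fb(1)] by simp
      ultimately show ?thesis
        using signed_skew_diag[OF x b(1)] by simp
    next
      case False
      hence "f a \<in> ?P"
        using fa a by (simp add: skew_columns_def)
      hence "x $$ (f a, f a) = x $$ (a, a)"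
        using diag fa a by simp
      thus ?thesis
        using signed_skew_diag[OF x a(1)] by simp
    qed
    thus ?thesis
      by (simp only: eq_uminus_iff)
  qed
  show "x = 0\<^sub>m n n"
    if x: "x \<in> ?g" and row: "\<And>j. j < n \<Longrightarrow> x $$ (a, j) = 0"
      and rows: "\<And>b k. \<lbrakk>b \<in> ?P; k < n\<rbrakk> \<Longrightarrow> x $$ (b, k) = 0" for x
  proof (rule eq_matI)
    fix i j assume "i < dim_row (0\<^sub>m n n :: 'k mat)" "j < dim_col (0\<^sub>m n n :: 'k mat)"
    hence ij: "i < n" "j < n"
      by simp_all
    have "i = a \<or> i \<in> ?P \<or> \<tau> = 1 \<and> i = f a"
      using ij by (auto simp: skew_columns_def)
    then consider "i = a" | "i \<in> ?P" | "\<tau> = 1" "i = f a"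
      by blast
    hence "x $$ (i, j) = 0"
    proof cases
      \<comment> \<open>The only row not covered is \<open>f a\<close> for a symmetric form. Its
        entries are paired with those of column \<open>a\<close> in the other rows, except for the
        self-paired one, which vanishes.\<close>
      case 3
      show ?thesis
      proof (cases "f j = i")
        case True
        hence "j = f i"
          using f_eq_iff ij by simp
        thus ?thesis
          using signed_skew_antidiag[OF x 3(1) ij(1)] by simp
      next
        case False
        have "f j = a \<or> f j \<in> ?P"
          using False 3 f_less[OF ij(2)] skew_columns by blast
        hence "x $$ (f j, f i) = 0"
          using row rows f_less[OF ij(1)] by auto
        thus ?thesis
          using signed_skewD[OF x ij] by simp
      qed
    qed (use row rows ij in auto)
    thus "x $$ (i, j) = 0\<^sub>m n n $$ (i, j)"
      using ij by simp
  qed (use dims[OF x] in auto)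
qed

text \<open>There are n - 2 columns of weight 1; in the alternating case column \<open>f a\<close>
  adds its weight 2.\<close>

lemma sum_skew_weight:
  assumes "a < n" "f a \<noteq> a"
  shows "sum (skew_weight f a) (skew_columns n f \<tau> a) = (if \<tau> = 1 then n - 2 else n)"
proof -
  have eq: "sum (skew_weight f a) ({..<n} - {a, f a}) = n - 2"
  proof -
    have "sum (skew_weight f a) ({..<n} - {a, f a}) = card ({..<n} - {a, f a})"
      by (simp add: skew_weight_def)
    also have "\<dots> = n - 2"
      using assms f_less[OF assms(1)] by (subst card_Diff_subset) auto
    finally show ?thesis .
  qed
  have "{..<n} - {a} = insert (f a) ({..<n} - {a, f a})"
    using assms f_less[OF assms(1)] by auto
  hence "sum (skew_weight f a) ({..<n} - {a}) = 2 + (n - 2)"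
    using eq assms by (simp add: skew_weight_def[of f a "f a"])
  moreover have "2 \<le> n"
    using assms f_less[OF assms(1)] by linarith
  ultimately have "sum (skew_weight f a) ({..<n} - {a}) = n"
    by linarith
  thus ?thesis
    using eq by (simp add: skew_columns_def)
qed

lemma self_similar_skew:
  assumes "0 < k" "a < n" "f a \<noteq> a" "\<tau> = 1 \<Longrightarrow> 3 \<le> n" "s \<in> carrier_mat n n"
    "\<And>i j. \<lbrakk>i < n; j < n\<rbrakk> \<Longrightarrow> s $$ (i, j) = (if j = f i then \<epsilon> i else 0)"
  shows "self_similar padic_ring
    (commutator_lie emb n ((\<cdot>\<^sub>m) (\<pi> ^ m) ` skew_mats n s (integers emb)))
    (card (carrier (residue_field emb)) ^ ((if \<tau> = 1 then n - 2 else n) * k))"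
  by (rule graded_matrices.self_similar_smult_image[OF graded_matrices_skew[OF assms(2-4)] assms(1)
        skew_mats_eq_signed_skew[OF assms(5,6)]])
    (simp_all only: sum_skew_weight[OF assms(2,3)] mult.commute)

end

lemma swap_block_index:
  assumes "i < 2 * l" "j < 2 * l"
  shows "four_block_mat (0\<^sub>m l l) (1\<^sub>m l) (1\<^sub>m l) (0\<^sub>m l l) $$ (i, j) =
    (if j = (if i < l then i + l else i - l) then 1 else (0 :: 'k))"
  using assms by (cases "i < l"; cases "j < l") auto

lemma self_similar_sp:
  assumes "2 \<le> n" "even n" "0 < k"
  shows "self_similar padic_ring (sp_lattice emb \<pi> n m) (card (carrier (residue_field emb)) ^ (n * k))"
proof -
  obtain l where n: "n = 2 * l" "0 < l"
    using assms by (auto elim: evenE)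
  \<comment> \<open>This decides the case distinction on \<tau> = -1 in favour of the alternating
    form.\<close>
  have "(- 1 :: 'k) \<noteq> 1"
    using eq_uminus_iff[of 1] by auto
  moreover have "self_similar padic_ring (sp_lattice emb \<pi> n m)
      (card (carrier (residue_field emb)) ^ ((if (- 1 :: 'k) = 1 then n - 2 else n) * k))"
    unfolding sp_lattice_def sp_mats_def
  proof (rule self_similar_skew[where a = 0 and f = "\<lambda>i. if i < l then i + l else i - l"
        and \<epsilon> = "\<lambda>i. if i < l then 1 else - 1"])
    show "sp_form n \<in> carrier_mat n n"
      using n by (simp add: sp_form_def Let_def mult_2)
    show "sp_form n $$ (i, j) =
        (if j = (if i < l then i + l else i - l) then if i < l then 1 else - 1 else (0 :: 'k))"
      if "i < n" "j < n" for i j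
      using that n by (cases "i < l"; cases "j < l") (auto simp: sp_form_def Let_def)
    show "3 \<le> n" if "- 1 = (1 :: 'k)"
      using that \<open>(- 1 :: 'k) \<noteq> 1\<close> by contradiction
  qed (use n assms in \<open>auto split: if_splits\<close>)
  ultimately show ?thesis
    by simp
qed

lemma self_similar_so:
  assumes "3 \<le> n" "0 < k"
  shows "self_similar padic_ring (so_lattice emb \<pi> n m) (card (carrier (residue_field emb)) ^ ((n - 2) * k))"
proof (cases "even n")
  case True
  then obtain l where n: "n = 2 * l" "0 < l"
    using assms by (auto elim: evenE)
  have "self_similar padic_ring (so_lattice emb \<pi> n m)
      (card (carrier (residue_field emb)) ^ ((if (1 :: 'k) = 1 then n - 2 else n) * k))"
    unfolding so_lattice_def so_mats_def
  proof (rule self_similar_skew[where a = 0 and f = "\<lambda>i. if i < l then i + l else i - l" and \<epsilon> = "\<lambda>_. 1"])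
    show "so_form n \<in> carrier_mat n n"
      using n by (simp add: so_form_def Let_def mult_2)
    show "so_form n $$ (i, j) = (if j = (if i < l then i + l else i - l) then 1 else (0 :: 'k))"
      if "i < n" "j < n" for i j
      using that n swap_block_index[of i l j] by (simp add: so_form_def Let_def)
  qed (use n assms in \<open>auto split: if_splits\<close>)
  thus ?thesis
    by simp
next
  case False
  then obtain l where n: "n = Suc (2 * l)" "0 < l"
    using assms by (auto elim: oddE)
  have "self_similar padic_ring (so_lattice emb \<pi> n m)
      (card (carrier (residue_field emb)) ^ ((if (1 :: 'k) = 1 then n - 2 else n) * k))"
    unfolding so_lattice_def so_mats_def
  \<comment> \<open>The index 0 is fixed by the involution, since its basis vector is not isotropic.
    The hyperbolic pairs start at 1, which shifts the block boundary to
    \<open>i \<le> l\<close>.\<close>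
  proof (rule self_similar_skew[where a = 1 and \<epsilon> = "\<lambda>_. 1"
        and f = "\<lambda>i. if i = 0 then 0 else if i \<le> l then i + l else i - l"])
    show "so_form n \<in> carrier_mat n n"
      using n by (auto simp: so_form_def Let_def intro!: carrier_matI)
    show "so_form n $$ (i, j) =
        (if j = (if i = 0 then 0 else if i \<le> l then i + l else i - l) then 1 else (0 :: 'k))"
      if ij: "i < n" "j < n" for i j
    proof (cases i)
      case 0
      thus ?thesis
        using ij n by (simp add: so_form_def Let_def)
    next
      case i: (Suc i')
      show ?thesis
      proof (cases j)
        case 0
        thus ?thesis
          using ij n i by (simp add: so_form_def Let_def)
      next
        case (Suc j')
        have "so_form n $$ (i, j) = (if j' = (if i' < l then i' + l else i' - l) then 1 else (0 :: 'k))"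
          using ij n i Suc swap_block_index[of i' l j'] by (simp add: so_form_def Let_def)
        thus ?thesis
          using ij n i Suc by (auto simp: Suc_le_eq Suc_diff_le not_less)
      qed
    qed
  qed (use n assms in \<open>auto split: if_splits\<close>)
  thus ?thesis
    by simp
qed

end

theorem theorem7:
  fixes emb :: "'p::prime_card padic \<Rightarrow> 'k::field"
    and \<pi> :: 'k
    and q n k m :: nat
  assumes "finite_padic_extension emb"
    and "uniformizer emb \<pi>"
    and "q = card (carrier (residue_field emb))"
    and "n \<ge> 2"
    and "k \<ge> 1"
  shows "self_similar padic_ring (sl_lattice emb \<pi> n m) (q ^ ((n - 1) * k)) \<and>
    (even n \<longrightarrow> self_similar padic_ring (sp_lattice emb \<pi> n m) (q ^ (n * k))) \<and>
    (n \<ge> 3 \<longrightarrow> self_similar padic_ring (so_lattice emb \<pi> n m) (q ^ ((n - 2) * k)))"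
proof -
  interpret padic_uniformizer emb \<pi>
    using assms(1,2) by (simp add: padic_uniformizer_def padic_uniformizer_axioms_def)
  have "0 < k"
    using assms(5) by simp
  thus ?thesis
    unfolding assms(3) using assms(4)
    by (intro conjI impI self_similar_sl self_similar_sp self_similar_so)
qed

end
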